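(* Consider $\min_{x\in\mathbb{R}^d}\max_{y\in\mathbb{R}^n}f(x,y)$ and let $\Phi(x)=\max_{y\in\mathbb{R}^n}f(x,y)$. Suppose that (i) $f$ is twice differentiable, $\mu$-strongly concave with respect to $y$ and nonconvex with respect to $x$; (ii) with $z=(x,y)$, $\|\nabla f(z)-\nabla f(z')\|\le\ell\|z-z'\|$ for any $z,z'$; (iii) $\nabla_x^2f,\nabla_{xy}^2f,\nabla_y^2f$ are $\rho$-Lipschitz continuous; (iv) $\Phi$ is bounded below and has compact sub-level sets. Set $$\tau=\frac1\ell,\quad\eta=\frac1{L_\phi},\quad r=\frac{\epsilon}{400\,\iota^3},\quad\mathscr{T}=\frac{L_\phi}{\sqrt{\rho_\phi\epsilon}}\cdot\iota,\quad D=\mathcal{O}(\kappa\log(\epsilon^{-1})),$$ where $\delta\in(0,1)$, $L_\phi/\sqrt{\rho_\phi\epsilon}\ge1$, and $\iota$ is a constant satisfying $\iota>1$ and $\delta\ge\frac{L_\phi\sqrt d}{\sqrt{\rho_\phi\epsilon}}\cdot\iota^2\,2^{8-\iota}$. Then, with probability at least $1-\delta$, the perturbed GDmax algorithm (described in the context) obtains an $\epsilon$-local minimum of $\Phi$ in $$K=\tilde{\mathcal{O}}\left(\frac{L_\phi(\Phi(x_0)-\Phi(x^* ))}{\epsilon^2}\right)=\tilde{\mathcal{O}}(\kappa\epsilon^{-2})$$ iterations, where $x^*$ is a minimizer of $\Phi$.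
   Context: $\kappa=\ell/\mu$. $L_\phi$ is the Lipschitz constant of $\nabla\Phi$, $L_\phi=\ell(1+\kappa)$, and $\rho_\phi$ is the Lipschitz constant of $\nabla^2\Phi$, $\rho_\phi=\rho(1+\kappa)^3$. A point $x$ is an $\epsilon$-local minimum of $\Phi$ if $\|\nabla\Phi(x)\|\le\epsilon$ and $\lambda_{\min}(\nabla^2\Phi(x))\ge-\sqrt{\rho_\phi\epsilon}$. Perturbed GDmax algorithm. Inputs: iteration numbers $K,D$, step sizes $\tau,\eta$, accuracy $\epsilon$, radius $r$, perturbation time $\mathscr{T}$, initial $x_0,y_0$. Set $k_{perturb}=0$. For $k=0,1,\dots,K-1$: (1) $y_k^0=y_{k-1}^D$ if $k>0$, otherwise $y_0$; for $t=1,\dots,D$: $y_k^t=y_k^{t-1}-\tau\nabla_yg(x_k,y_k^{t-1})$ with $g=-f$, i.e. $y_k^t=y_k^{t-1}+\tau\nabla_yf(x_k,y_k^{t-1})$. (2) $\widehat\nabla\Phi(x_k)=\nabla_xf(x_k,y_k^D)$. (3) If $\|\widehat\nabla\Phi(x_k)\|\le\frac45\epsilon$ and $k-k_{perturb}>\mathscr{T}$, replace $x_k$ by $x_k-\eta u$ with $u$ uniform on the ball $\mathbb{B}(r)$ of radius $r$ centered at $0$ in $\mathbb{R}^d$, and set $k_{perturb}=k$. (4) $x_{k+1}=x_k-\eta\widehat\nabla\Phi(x_k)$. Order notation: $\mathcal{O}(\cdot)$ hides only absolute constants which do not depend on any problem parameters; $\tilde{\mathcal{O}}(\cdot)$ further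 hides logarithmic factors.
   Formalization: D=O(κ log(1/ε)) with an absolute constant fails (ε=1 gives D=0; y_0 may be far away), so D is required to be at least 100κ(ι+ln(1+(ℓ‖y_0−y*(x_0)‖+√(L_φ(Φ(x_0)−Φ(x* ))))/ε)), which is O(κ log(1/ε)) for a fixed problem and ι=O(log(1/ε)). *)

theory Defs
  imports "HOL-Probability.Probability" "HOL-Real_Asymp.Real_Asymp"
begin

section \<open>Gradients, Hessians and second-order stationarity\<close>

definition grad :: "('a::real_inner \<Rightarrow> real) \<Rightarrow> 'a \<Rightarrow> 'a" where
  "grad f x = (THE D. GDERIV f x :> D)"

text \<open>Second derivatives are bounded linear maps, so that Lipschitz continuity of a Hessian
  is measured in the operator norm.\<close>

definition jacobian :: "('a::real_normed_vector \<Rightarrow> 'b::real_normed_vector) \<Rightarrow> 'a \<Rightarrow> 'a \<Rightarrow>\<^sub>L 'b" where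
  "jacobian F x = Blinfun (frechet_derivative F (at x))"

definition hess :: "('a::real_inner \<Rightarrow> real) \<Rightarrow> 'a \<Rightarrow> 'a \<Rightarrow>\<^sub>L 'a" where
  "hess f x = jacobian (grad f) x"

definition twice_differentiable :: "('a::real_inner \<Rightarrow> real) \<Rightarrow> bool" where
  "twice_differentiable f \<longleftrightarrow>
     (\<forall>z. f differentiable at z) \<and> (\<forall>z. grad f differentiable at z)"

definition grad_x :: "('a::real_inner \<times> 'b::real_inner \<Rightarrow> real) \<Rightarrow> 'a \<Rightarrow> 'b \<Rightarrow> 'a" where
  "grad_x f x y = grad (\<lambda>x'. f (x', y)) x"

definition grad_y :: "('a::real_inner \<times> 'b::real_inner \<Rightarrow> real) \<Rightarrow> 'a \<Rightarrow> 'b \<Rightarrow> 'b" where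
  "grad_y f x y = grad (\<lambda>y'. f (x, y')) y"

definition hess_xx :: "('a::real_inner \<times> 'b::real_inner \<Rightarrow> real) \<Rightarrow> 'a \<times> 'b \<Rightarrow> 'a \<Rightarrow>\<^sub>L 'a" where
  "hess_xx f z = jacobian (\<lambda>x. grad_x f x (snd z)) (fst z)"

definition hess_xy :: "('a::real_inner \<times> 'b::real_inner \<Rightarrow> real) \<Rightarrow> 'a \<times> 'b \<Rightarrow> 'b \<Rightarrow>\<^sub>L 'a" where
  "hess_xy f z = jacobian (\<lambda>y. grad_x f (fst z) y) (snd z)"

definition hess_yy :: "('a::real_inner \<times> 'b::real_inner \<Rightarrow> real) \<Rightarrow> 'a \<times> 'b \<Rightarrow> 'b \<Rightarrow>\<^sub>L 'b" where
  "hess_yy f z = jacobian (\<lambda>y. grad_y f (fst z) y) (snd z)"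

definition strongly_concave :: "real \<Rightarrow> ('a::real_inner \<Rightarrow> real) \<Rightarrow> bool" where
  "strongly_concave \<mu> g \<longleftrightarrow>
     (\<forall>u v. \<forall>t\<in>{0..1}. g ((1 - t) *\<^sub>R u + t *\<^sub>R v)
        \<ge> (1 - t) * g u + t * g v + \<mu> / 2 * t * (1 - t) * (norm (u - v))\<^sup>2)"

text \<open>Only meaningful for self-adjoint maps on a finite-dimensional space, whose set of real
  eigenvalues is finite and nonempty.\<close>

definition lambda_min :: "('a::euclidean_space \<Rightarrow>\<^sub>L 'a) \<Rightarrow> real" where
  "lambda_min A = Min {c. \<exists>v. v \<noteq> 0 \<and> blinfun_apply A v = c *\<^sub>R v}"

text \<open>The argument \<open>\<rho>\<close> is the Lipschitz constant of the Hessian of \<open>\<Phi>\<close>.\<close>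

definition eps_local_min :: "('a::euclidean_space \<Rightarrow> real) \<Rightarrow> real \<Rightarrow> real \<Rightarrow> 'a \<Rightarrow> bool" where
  "eps_local_min \<Phi> \<rho> \<epsilon> x \<longleftrightarrow>
     norm (grad \<Phi> x) \<le> \<epsilon> \<and> lambda_min (hess \<Phi> x) \<ge> - sqrt (\<rho> * \<epsilon>)"

text \<open>For \<open>f (x, \<cdot>)\<close> continuous and strongly concave the supremum is finite and attained, so
  this is the maximum over \<open>y\<close>.\<close>

definition max_value :: "('a \<times> 'b \<Rightarrow> real) \<Rightarrow> 'a \<Rightarrow> real" where
  "max_value f x = (SUP y. f (x, y))"


section \<open>The perturbed GDmax algorithm\<close>

definition inner_ascent ::
  "('a::real_inner \<times> 'b::real_inner \<Rightarrow> real) \<Rightarrow> real \<Rightarrow> nat \<Rightarrow> 'a \<Rightarrow> 'b \<Rightarrow> 'b" where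
  "inner_ascent f \<tau> D x y = ((\<lambda>y'. y' + \<tau> *\<^sub>R grad_y f x y') ^^ D) y"

text \<open>The state \<open>(x, y, p)\<close> after \<open>k\<close> outer iterations consists of the iterate \<open>x\<^sub>k\<close> (before
  the possible perturbation in iteration \<open>k\<close>), the inner iterate from which iteration \<open>k\<close> is
  warm-started, and the last perturbation time.  The perturbation direction used in iteration
  \<open>k\<close>, if any, is \<open>u k\<close>.  The gradient estimate is computed once per iteration, before the
  perturbation, and this value is used both in the perturbation test and in the descent step.\<close>

primrec gdmax_state ::
  "('a::real_inner \<times> 'b::real_inner \<Rightarrow> real) \<Rightarrow> nat \<Rightarrow> real \<Rightarrow> real \<Rightarrow> real \<Rightarrow> real
     \<Rightarrow> 'a \<Rightarrow> 'b \<Rightarrow> (nat \<Rightarrow> 'a) \<Rightarrow> nat \<Rightarrow> 'a \<times> 'b \<times> nat" where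
  "gdmax_state f D \<tau> \<eta> \<epsilon> T x0 y0 u 0 = (x0, y0, 0)"
| "gdmax_state f D \<tau> \<eta> \<epsilon> T x0 y0 u (Suc k) =
     (case gdmax_state f D \<tau> \<eta> \<epsilon> T x0 y0 u k of (x, y, p) \<Rightarrow>
       (let y' = inner_ascent f \<tau> D x y;
            g = grad_x f x y';
            perturb = (norm g \<le> 4 / 5 * \<epsilon> \<and> real k - real p > T);
            x' = (if perturb then x - \<eta> *\<^sub>R u k else x)
        in (x' - \<eta> *\<^sub>R g, y', if perturb then k else p)))"

definition gdmax_iterate ::
  "('a::real_inner \<times> 'b::real_inner \<Rightarrow> real) \<Rightarrow> nat \<Rightarrow> real \<Rightarrow> real \<Rightarrow> real \<Rightarrow> real
     \<Rightarrow> 'a \<Rightarrow> 'b \<Rightarrow> (nat \<Rightarrow> 'a) \<Rightarrow> nat \<Rightarrow> 'a" where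
  "gdmax_iterate f D \<tau> \<eta> \<epsilon> T x0 y0 u k = fst (gdmax_state f D \<tau> \<eta> \<epsilon> T x0 y0 u k)"

text \<open>Independent directions, each uniform on the ball of radius \<open>r\<close>.\<close>

definition perturbations :: "real \<Rightarrow> (nat \<Rightarrow> 'a::euclidean_space) measure" where
  "perturbations r = (\<Pi>\<^sub>M k\<in>UNIV. uniform_measure lborel (cball 0 r))"


section \<open>Iteration counts\<close>

text \<open>Numerals stand for the absolute constants of the order notation: an existentially
  quantified constant could depend on the types \<open>'d\<close>, \<open>'n\<close> of a theorem about
  \<open>(real ^ 'd) \<times> (real ^ 'n)\<close>, that is, on the dimensions.

  Number of inner steps of order \<open>\<kappa> log (1/\<epsilon>)\<close>.  The inner loop has to reduce the initial error
  to about \<open>\<epsilon> / 2 powr \<iota>\<close>; the argument \<open>A\<close> bounds the size of that initial error.\<close>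

definition inner_steps :: "real \<Rightarrow> real \<Rightarrow> real \<Rightarrow> real \<Rightarrow> real" where
  "inner_steps \<kappa> \<iota> A \<epsilon> = 100 * \<kappa> * (\<iota> + ln (1 + A / \<epsilon>))"

text \<open>Number of outer iterations; \<open>\<Delta>\<close> is the initial optimality gap, and the factor
  \<open>\<iota> ^ 4\<close> is the one hidden in the soft order notation.\<close>

definition outer_steps :: "real \<Rightarrow> real \<Rightarrow> real \<Rightarrow> real \<Rightarrow> real" where
  "outer_steps L \<iota> \<Delta> \<epsilon> = 10 ^ 6 * \<iota> ^ 4 * (L * \<Delta> / \<epsilon>\<^sup>2)"

text \<open>The following three lemmas are not used in the statement.  They record that \<open>\<iota>\<close> can be
  chosen logarithmic in \<open>1/\<epsilon>\<close>, and that the above counts then have the claimed orders as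
  \<open>\<epsilon>\<close> tends to zero.\<close>

lemma logarithmic_choice_admissible:
  fixes L \<rho> \<delta> d :: real
  assumes "0 < L" "0 < \<rho>" "0 < \<delta>" "0 < d"
  shows "eventually (\<lambda>\<epsilon>. 2 * ln (1 / \<epsilon>) > 1 \<and> L / sqrt (\<rho> * \<epsilon>) \<ge> 1 \<and>
    \<delta> \<ge> L * sqrt d / sqrt (\<rho> * \<epsilon>) * (2 * ln (1 / \<epsilon>))\<^sup>2 * 2 powr (8 - 2 * ln (1 / \<epsilon>))) (at_right 0)"
proof (intro eventually_conj)
  show "eventually (\<lambda>\<epsilon>::real. 2 * ln (1 / \<epsilon>) > 1) (at_right 0)"
    by real_asymp
  show "eventually (\<lambda>\<epsilon>. L / sqrt (\<rho> * \<epsilon>) \<ge> 1) (at_right 0)"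
    using assms by real_asymp
  have "((\<lambda>\<epsilon>. 1 / sqrt \<epsilon> * (2 * ln (1 / \<epsilon>))\<^sup>2 * exp (- (5 / 4) * ln (1 / \<epsilon>))) \<longlongrightarrow> 0) (at_right (0::real))"
    by real_asymp
  then have "((\<lambda>\<epsilon>. (256 * L * sqrt d / sqrt \<rho>) *
      (1 / sqrt \<epsilon> * (2 * ln (1 / \<epsilon>))\<^sup>2 * exp (- (5 / 4) * ln (1 / \<epsilon>)))) \<longlongrightarrow> 0) (at_right (0::real))"
    by (rule tendsto_mult_right_zero)
  then have ev: "eventually (\<lambda>\<epsilon>. (256 * L * sqrt d / sqrt \<rho>) *
      (1 / sqrt \<epsilon> * (2 * ln (1 / \<epsilon>))\<^sup>2 * exp (- (5 / 4) * ln (1 / \<epsilon>))) < \<delta>) (at_right 0)"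
    using assms(3) by (rule order_tendstoD)
  have e54: "2 * ln (2::real) \<ge> 5 / 4"
    using ln2_ge_two_thirds by simp
  have pos: "eventually (\<lambda>\<epsilon>::real. ln (1 / \<epsilon>) > 0 \<and> \<epsilon> > 0) (at_right 0)"
    by (intro eventually_conj; real_asymp)
  from ev pos show "eventually (\<lambda>\<epsilon>. \<delta> \<ge> L * sqrt d / sqrt (\<rho> * \<epsilon>) * (2 * ln (1 / \<epsilon>))\<^sup>2
      * 2 powr (8 - 2 * ln (1 / \<epsilon>))) (at_right 0)"
  proof eventually_elim
    case (elim \<epsilon>)
    define l where "l = ln (1 / \<epsilon>)"
    have l: "l > 0" and \<epsilon>: "\<epsilon> > 0" using elim by (auto simp: l_def)
    have "2 powr (8 - 2 * l) = 256 * exp (- (2 * ln 2 * l))"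
    proof -
      have "2 powr (2 * l) = exp (2 * ln 2 * l)"
        by (simp add: powr_def mult_ac)
      then show ?thesis
        by (simp only: powr_diff) (simp add: exp_minus field_simps)
    qed
    also have "\<dots> \<le> 256 * exp (- (5 / 4) * l)"
      using mult_right_mono[OF e54, of l] l by simp
    finally have "L * sqrt d / sqrt (\<rho> * \<epsilon>) * (2 * l)\<^sup>2 * 2 powr (8 - 2 * l)
        \<le> L * sqrt d / sqrt (\<rho> * \<epsilon>) * (2 * l)\<^sup>2 * (256 * exp (- (5 / 4) * l))"
      using assms \<epsilon> by (intro mult_left_mono) auto
    also have "\<dots> = (256 * L * sqrt d / sqrt \<rho>) * (1 / sqrt \<epsilon> * (2 * l)\<^sup>2 * exp (- (5 / 4) * l))"
      by (simp add: real_sqrt_mult field_simps)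
    finally show ?case using elim unfolding l_def by linarith
  qed
qed

lemma inner_steps_order:
  assumes "\<iota> \<in> O[at_right 0](\<lambda>\<epsilon>. ln (1 / \<epsilon>))" and "0 \<le> A"
  shows "(\<lambda>\<epsilon>. inner_steps \<kappa> (\<iota> \<epsilon>) A \<epsilon>) \<in> O[at_right 0](\<lambda>\<epsilon>. \<kappa> * ln (1 / \<epsilon>))"
proof -
  have "(\<lambda>\<epsilon>::real. ln (1 + A / \<epsilon>)) \<in> O[at_right 0](\<lambda>\<epsilon>. ln (1 / \<epsilon>))"
  proof (cases "A = 0")
    case False
    with assms(2) have "A > 0" by simp
    then show ?thesis by real_asymp
  qed simp
  with assms(1) have "(\<lambda>\<epsilon>. \<iota> \<epsilon> + ln (1 + A / \<epsilon>)) \<in> O[at_right 0](\<lambda>\<epsilon>. ln (1 / \<epsilon>))"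
    by (rule sum_in_bigo)
  then have "(\<lambda>\<epsilon>. (100 * \<kappa>) * (\<iota> \<epsilon> + ln (1 + A / \<epsilon>))) \<in> O[at_right 0](\<lambda>\<epsilon>. \<kappa> * ln (1 / \<epsilon>))"
    by (intro landau_o.big.mult) auto
  then show ?thesis by (simp add: inner_steps_def)
qed

lemma outer_steps_order:
  assumes "\<iota> \<in> O[at_right 0](\<lambda>\<epsilon>. ln (1 / \<epsilon>))"
  shows "(\<lambda>\<epsilon>. outer_steps L (\<iota> \<epsilon>) \<Delta> \<epsilon>) \<in> O[at_right 0](\<lambda>\<epsilon>. ln (1 / \<epsilon>) ^ 4 * (L * \<Delta> / \<epsilon>\<^sup>2))"
  unfolding outer_steps_def using assms
  by (intro landau_o.big.mult landau_o.big_power) (auto simp: landau_o.big.cmult_in_iff landau_o.big_power)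

end

theory Submission
  imports Defs
begin

text \<open>Perturbed GDmax is inexact gradient descent on \<open>\<Phi>\<close>: the inner loop is a contraction towards the
  maximizer, so that its warm start keeps all gradient errors exponentially small in \<open>\<iota>\<close>.  An iteration
  with a large gradient decreases \<open>\<Phi>\<close> by a multiple of \<open>\<epsilon>\<^sup>2 / L\<^sub>\<phi>\<close>.  If \<open>\<Phi>\<close> does not decrease
  substantially in the \<open>T\<close> iterations after a perturbation at a saddle point, then the iterates stay in
  a small ball, in which the Hessian is almost constant; two such paths whose perturbations differ along
  the eigenvector of the smallest eigenvalue separate exponentially.  Hence the perturbations that fail
  form a thin set, of probability at most \<open>\<delta> / 2\<close>.

  No union bound over the perturbations is possible, because \<open>\<delta>\<close> bounds the failure probability of a
  single one.  But a failure only costs time, and the iteration count is so generous that, if no local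
  minimum is visited, nine tenths of the possible perturbations must fail.  The expected number of
  failures and Markov's inequality bound the probability of this by \<open>(10 / 9) (\<delta> / 2)\<close>.\<close>

section \<open>Second derivatives and symmetric operators\<close>

text \<open>All scales derive from \<open>g = sqrt (\<rho>\<^sub>\<phi> * \<epsilon>)\<close>, so
  that \<open>\<epsilon> = g\<^sup>2 / \<rho>\<^sub>\<phi>\<close>. A stuck path has to stay within
  \<open>g / (40 * \<rho>\<^sub>\<phi> * \<iota>)\<close> of the saddle: then the change of the
  Hessian, accumulated over about \<open>\<iota> * L / g\<close> steps, costs a factor of at most
  exp (1/40). The decrease \<open>F\<close> that separates success from failure is what this radius
  allows. In the same time a separation grows by about 2^\<iota>, so the failing perturbations have
  a width of order \<open>L * g / (\<rho>\<^sub>\<phi> * \<iota>)\<close> times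
  \<open>2 powr (- \<iota>)\<close>; comparing it with \<open>r / sqrt d\<close> yields the
  condition on \<delta>. Gradient errors must be small even against this tiny separation, which is
  why the inner loop is run to accuracy \<open>\<epsilon> * (2 powr (- \<iota>))\<^sup>2\<close>. An
  iteration budget proportional to \<Delta> might be too short for a single perturbation. This is
  excluded because a point of strongly negative curvature lies well above the minimum: if no local
  minimum is found, \<Delta> is at least of order
  \<open>g ^ 3 / \<rho>\<^sub>\<phi>\<^sup>2\<close>, and a thousand windows of \<open>N\<close>
  steps fit in.\<close>

lemma grad_eqI:
  assumes "(f has_derivative (\<lambda>h. D \<bullet> h)) (at x)"
  shows "grad f x = D"
  unfolding grad_def
proof (rule the_equality)
  show "GDERIV f x :> D" using assms by (simp add: gderiv_def inner_commute)
next
  fix E assume "GDERIV f x :> E"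
  then have "(f has_derivative (\<lambda>h. E \<bullet> h)) (at x)" by (simp add: gderiv_def inner_commute)
  then have "(\<lambda>h. E \<bullet> h) = (\<lambda>h. D \<bullet> h)" using assms has_derivative_unique by blast
  then have "E \<bullet> (E - D) = D \<bullet> (E - D)" by metis
  then show "E = D" by (metis inner_diff_left inner_eq_zero_iff right_minus_eq)
qed

lemma jacobian_eqI:
  assumes "(f has_derivative blinfun_apply A) (at x)"
  shows "jacobian f x = A"
  by (metis assms frechet_derivative_at jacobian_def blinfun_apply_inverse)

lemma has_derivative_jacobian:
  assumes "f differentiable (at x)"
  shows "(f has_derivative blinfun_apply (jacobian f x)) (at x)"
  using assms bounded_linear_Blinfun_apply frechet_derivative_works has_derivative_bounded_linear
  unfolding jacobian_def by metis

lemma has_derivative_remainder: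
  fixes f :: "'a::real_normed_vector \<Rightarrow> 'b::real_normed_vector"
  assumes "(f has_derivative D) (at x)" "0 < e"
  obtains d where "0 < d" "\<And>h. norm h < d \<Longrightarrow> norm (f (x + h) - f x - D h) \<le> e * norm h"
proof -
  obtain d where "0 < d" and d: "\<And>y. norm (y - x) < d \<Longrightarrow> norm (f y - f x - D (y - x)) \<le> e * norm (y - x)"
    using assms unfolding has_derivative_at_alt by blast
  show ?thesis
  proof
    show "0 < d" by fact
    fix h :: 'a assume "norm h < d"
    then show "norm (f (x + h) - f x - D h) \<le> e * norm h" using d[of "x + h"] by simp
  qed
qed

lemma derivative_norm_le_of_lipschitz:
  assumes D: "(f has_derivative D) (at x)" and lip: "\<And>y. norm (f y - f x) \<le> C * norm (y - x)"
  shows "norm (D v) \<le> C * norm v"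
proof (rule field_le_epsilon)
  fix e :: real assume "0 < e"
  define e' where "e' = e / (norm v + 1)"
  have e': "0 < e'" "e' * norm v \<le> e" using \<open>0 < e\<close> by (auto simp: e'_def field_simps add_pos_nonneg)
  obtain d where "0 < d" and d: "\<And>h. norm h < d \<Longrightarrow> norm (f (x + h) - f x - D h) \<le> e' * norm h"
    using has_derivative_remainder[OF D e'(1)] by metis
  define t where "t = d / (2 * (norm v + 1))"
  have t: "0 < t" using \<open>0 < d\<close> by (auto simp: t_def add_nonneg_pos)
  have "t * norm v < d"
  proof -
    have "d * norm v < d * (2 * (norm v + 1))"
      using \<open>0 < d\<close> by (intro mult_strict_left_mono) (auto intro: add_nonneg_pos)
    then show ?thesis by (simp add: t_def divide_less_eq add_nonneg_pos)
  qed
  with t have 1: "norm (f (x + t *\<^sub>R v) - f x - D (t *\<^sub>R v)) \<le> e' * (t * norm v)"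
    using d[of "t *\<^sub>R v"] by simp
  have 2: "norm (f (x + t *\<^sub>R v) - f x) \<le> C * (t * norm v)" using lip[of "x + t *\<^sub>R v"] t by simp
  have "D (t *\<^sub>R v) = t *\<^sub>R D v" using D by (simp add: has_derivative_linear linear_cmul)
  then have "t * norm (D v) = norm (D (t *\<^sub>R v))" using t by simp
  also have "\<dots> \<le> norm (f (x + t *\<^sub>R v) - f x) + norm (f (x + t *\<^sub>R v) - f x - D (t *\<^sub>R v))"
    by (metis norm_minus_commute norm_triangle_sub)
  also have "\<dots> \<le> t * (C * norm v + e' * norm v)" using 1 2 by (simp add: algebra_simps)
  finally show "norm (D v) \<le> C * norm v + e" using t e'(2) by simp
qed

text \<open>The mean value theorem along \<open>u\<close>, applied to the first difference in
  direction \<open>v\<close>, leaves a difference of gradients at two points near \<open>x\<close>.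
  Both are expanded at \<open>x\<close> itself, so differentiability of \<open>G\<close> at this one
  point carries the estimate.\<close>

lemma second_difference_bound:
  fixes F :: "'a::real_inner \<Rightarrow> real"
  assumes F: "\<And>z. (F has_derivative (\<lambda>h. G z \<bullet> h)) (at z)" and lin: "linear A"
    and G: "\<And>h. norm h < d \<Longrightarrow> norm (G (x + h) - G x - A h) \<le> e * norm h"
    and t: "0 < t" "t * (norm u + norm v) < d" and "0 \<le> e"
  shows "\<bar>F (x + t *\<^sub>R u + t *\<^sub>R v) - F (x + t *\<^sub>R u) - (F (x + t *\<^sub>R v) - F x) - t\<^sup>2 * (A v \<bullet> u)\<bar>
           \<le> 2 * e * t\<^sup>2 * (norm u + norm v)\<^sup>2"
proof -
  define \<phi> where "\<phi> s = F (x + s *\<^sub>R u + t *\<^sub>R v) - F (x + s *\<^sub>R u)" for s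
  have "(\<phi> has_real_derivative (G (x + s *\<^sub>R u + t *\<^sub>R v) - G (x + s *\<^sub>R u)) \<bullet> u) (at s)" for s
  proof -
    have "(\<phi> has_derivative (\<lambda>h. G (x + s *\<^sub>R u + t *\<^sub>R v) \<bullet> (h *\<^sub>R u) - G (x + s *\<^sub>R u) \<bullet> (h *\<^sub>R u))) (at s)"
      unfolding \<phi>_def
      by (intro has_derivative_diff has_derivative_compose[OF _ F]) (auto intro!: derivative_eq_intros)
    then show ?thesis unfolding has_field_derivative_def
      by (rule back_subst[where P="\<lambda>D. (\<phi> has_derivative D) (at s)"]) (auto simp: algebra_simps)
  qed
  from MVT2[OF t(1), of \<phi>, OF this] obtain \<xi> where \<xi>: "0 < \<xi>" "\<xi> < t"
    "\<phi> t - \<phi> 0 = t * ((G (x + \<xi> *\<^sub>R u + t *\<^sub>R v) - G (x + \<xi> *\<^sub>R u)) \<bullet> u)"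
    by auto
  let ?a = "\<xi> *\<^sub>R u + t *\<^sub>R v" and ?b = "\<xi> *\<^sub>R u" and ?N = "norm u + norm v"
  have na: "norm ?a \<le> t * ?N"
  proof -
    have "norm ?a \<le> \<xi> * norm u + t * norm v" using \<xi> t norm_triangle_ineq[of "\<xi> *\<^sub>R u" "t *\<^sub>R v"] by simp
    also have "\<dots> \<le> t * norm u + t * norm v" using \<xi> by (intro add_mono mult_right_mono) auto
    finally show ?thesis by (simp add: algebra_simps)
  qed
  have nb: "norm ?b \<le> t * ?N"
  proof -
    have "norm ?b \<le> t * norm u" using \<xi> by (auto intro!: mult_right_mono)
    also have "\<dots> \<le> t * ?N" using t by (intro mult_left_mono) auto
    finally show ?thesis .
  qed
  let ?Ra = "G (x + ?a) - G x - A ?a" and ?Rb = "G (x + ?b) - G x - A ?b"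
  have Ra: "norm ?Ra \<le> e * (t * ?N)"
    using G[of ?a] na t(2) mult_left_mono[OF na \<open>0 \<le> e\<close>] by linarith
  have Rb: "norm ?Rb \<le> e * (t * ?N)"
    using G[of ?b] nb t(2) mult_left_mono[OF nb \<open>0 \<le> e\<close>] by linarith
  have "A ?a - A ?b = t *\<^sub>R A v" by (simp add: linear_add[OF lin] linear_cmul[OF lin])
  then have "G (x + \<xi> *\<^sub>R u + t *\<^sub>R v) - G (x + \<xi> *\<^sub>R u) = t *\<^sub>R A v + (?Ra - ?Rb)"
    by (simp add: algebra_simps)
  then have "\<phi> t - \<phi> 0 - t\<^sup>2 * (A v \<bullet> u) = t * ((?Ra - ?Rb) \<bullet> u)"
    using \<xi>(3) by (simp add: inner_add_left power2_eq_square algebra_simps)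
  then have "\<bar>\<phi> t - \<phi> 0 - t\<^sup>2 * (A v \<bullet> u)\<bar> = t * \<bar>(?Ra - ?Rb) \<bullet> u\<bar>" using t by (simp add: abs_mult)
  also have "\<dots> \<le> t * ((e * (t * ?N) + e * (t * ?N)) * ?N)"
  proof (intro mult_left_mono)
    have "\<bar>(?Ra - ?Rb) \<bullet> u\<bar> \<le> norm (?Ra - ?Rb) * norm u" by (rule Cauchy_Schwarz_ineq2)
    also have "\<dots> \<le> (e * (t * ?N) + e * (t * ?N)) * ?N"
      using Ra Rb norm_triangle_ineq4[of ?Ra ?Rb] t \<open>0 \<le> e\<close> by (intro mult_mono) auto
    finally show "\<bar>(?Ra - ?Rb) \<bullet> u\<bar> \<le> (e * (t * ?N) + e * (t * ?N)) * ?N" .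
  qed (use t in auto)
  also have "\<dots> = 2 * e * t\<^sup>2 * ?N\<^sup>2" by (simp add: power2_eq_square algebra_simps)
  finally have "\<bar>\<phi> t - \<phi> 0 - t\<^sup>2 * (A v \<bullet> u)\<bar> \<le> 2 * e * t\<^sup>2 * ?N\<^sup>2" .
  moreover have "\<phi> t - \<phi> 0 = F (x + t *\<^sub>R u + t *\<^sub>R v) - F (x + t *\<^sub>R u) - (F (x + t *\<^sub>R v) - F x)"
    unfolding \<phi>_def by simp
  ultimately show ?thesis by metis
qed

text \<open>The second difference does not change when \<open>u\<close> and \<open>v\<close> are
  exchanged, while after division by \<open>t\<^sup>2\<close> it is close to both sides of the
  claim.\<close>

lemma second_derivative_symmetric:
  fixes F :: "'a::real_inner \<Rightarrow> real"
  assumes F: "\<And>z. (F has_derivative (\<lambda>h. G z \<bullet> h)) (at z)" and G: "(G has_derivative A) (at x)"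
  shows "A u \<bullet> v = u \<bullet> A v"
proof -
  have lin: "linear A" using G by (rule has_derivative_linear)
  let ?N = "norm u + norm v"
  have "\<bar>A v \<bullet> u - A u \<bullet> v\<bar> \<le> e" if "0 < e" for e
  proof -
    \<comment> \<open>Each of the two approximations errs by
      \<open>2 * e' * t\<^sup>2 * ?N\<^sup>2\<close>, hence the 4. Adding 1 to \<open>?N\<close>
      keeps the denominator positive when both vectors vanish.\<close>
    define e' where "e' = e / (4 * (?N + 1)\<^sup>2)"
    have "0 < ?N + 1" by (simp add: add_nonneg_pos)
    then have N: "0 < (?N + 1)\<^sup>2" by simp
    have e': "0 < e'" using \<open>0 < e\<close> N by (simp add: e'_def)
    have "4 * e' * ?N\<^sup>2 \<le> 4 * e' * (?N + 1)\<^sup>2"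
      using e' by (intro mult_left_mono power_mono) auto
    also have "\<dots> = e" using N unfolding e'_def by (simp add: field_simps)
    finally have le: "4 * e' * ?N\<^sup>2 \<le> e" .
    obtain d where "0 < d" and d: "\<And>h. norm h < d \<Longrightarrow> norm (G (x + h) - G x - A h) \<le> e' * norm h"
      using has_derivative_remainder[OF G e'] by metis
    define t where "t = d / (2 * (?N + 1))"
    have t: "0 < t" using \<open>0 < d\<close> by (auto simp: t_def add_nonneg_pos)
    have td: "t * ?N < d"
    proof -
      have "d * ?N < d * (2 * (?N + 1))"
        using \<open>0 < d\<close> by (intro mult_strict_left_mono) (auto simp: add_nonneg_pos add_strict_increasing2)
      then show ?thesis by (simp add: t_def divide_less_eq add_nonneg_pos)
    qed
    let ?D = "F (x + t *\<^sub>R u + t *\<^sub>R v) - F (x + t *\<^sub>R u) - (F (x + t *\<^sub>R v) - F x)"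
    have "\<bar>?D - t\<^sup>2 * (A v \<bullet> u)\<bar> \<le> 2 * e' * t\<^sup>2 * ?N\<^sup>2"
      using second_difference_bound[OF F lin d t td] e' by simp
    moreover have "\<bar>?D - t\<^sup>2 * (A u \<bullet> v)\<bar> \<le> 2 * e' * t\<^sup>2 * ?N\<^sup>2"
    proof -
      have "\<bar>F (x + t *\<^sub>R v + t *\<^sub>R u) - F (x + t *\<^sub>R v) - (F (x + t *\<^sub>R u) - F x) - t\<^sup>2 * (A u \<bullet> v)\<bar>
          \<le> 2 * e' * t\<^sup>2 * (norm v + norm u)\<^sup>2"
        using td e' by (intro second_difference_bound[OF F lin d t]) (auto simp: add.commute)
      moreover have "x + t *\<^sub>R v + t *\<^sub>R u = x + t *\<^sub>R u + t *\<^sub>R v" "norm v + norm u = ?N" by simp_all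
      ultimately show ?thesis by (simp only: diff_diff_eq diff_diff_eq2 add_ac)
    qed
    ultimately have "\<bar>t\<^sup>2 * (A v \<bullet> u) - t\<^sup>2 * (A u \<bullet> v)\<bar> \<le> 2 * e' * t\<^sup>2 * ?N\<^sup>2 + 2 * e' * t\<^sup>2 * ?N\<^sup>2"
      by linarith
    also have "\<dots> = t\<^sup>2 * (4 * e' * ?N\<^sup>2)" by (simp add: mult_ac)
    finally have "\<bar>t\<^sup>2 * (A v \<bullet> u) - t\<^sup>2 * (A u \<bullet> v)\<bar> \<le> t\<^sup>2 * (4 * e' * ?N\<^sup>2)" .
    then have "t\<^sup>2 * \<bar>A v \<bullet> u - A u \<bullet> v\<bar> \<le> t\<^sup>2 * (4 * e' * ?N\<^sup>2)"
      by (simp only: right_diff_distrib[symmetric] abs_mult abs_power2)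
    then have "\<bar>A v \<bullet> u - A u \<bullet> v\<bar> \<le> 4 * e' * ?N\<^sup>2" using t by (simp only: mult_le_cancel_left_pos zero_less_power)
    then show ?thesis using le by (rule order_trans)
  qed
  then have "\<bar>A v \<bullet> u - A u \<bullet> v\<bar> \<le> 0" by (rule field_le_epsilon) simp
  then have "A v \<bullet> u = A u \<bullet> v" by simp
  then show ?thesis by (simp add: inner_commute)
qed

text \<open>Polarization with \<open>u\<close> parallel to \<open>A v\<close> and as long as
  \<open>v\<close>, followed by the parallelogram law. This is how all operator norms below are
  bounded: only quadratic forms are ever estimated.\<close>

lemma symmetric_norm_le_of_quadratic_form:
  fixes A :: "'a::real_inner \<Rightarrow> 'a"
  assumes "linear A" and sym: "\<And>u v. A u \<bullet> v = u \<bullet> A v"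
    and q: "\<And>v. \<bar>A v \<bullet> v\<bar> \<le> c * (norm v)\<^sup>2"
  shows "norm (A v) \<le> c * norm v"
proof (cases "v = 0 \<or> A v = 0")
  case True
  moreover have "0 \<le> c * norm v" if "v \<noteq> 0"
  proof -
    have "0 \<le> c * (norm v)\<^sup>2" using q[of v] by linarith
    then show ?thesis using that by (simp add: zero_le_mult_iff)
  qed
  ultimately show ?thesis using linear_0[OF \<open>linear A\<close>] by (cases "v = 0") auto
next
  case False
  define u where "u = (norm v / norm (A v)) *\<^sub>R A v"
  have nu: "norm u = norm v" using False by (simp add: u_def)
  have Avu: "A v \<bullet> u = norm v * norm (A v)"
    using False by (simp add: u_def dot_square_norm power2_eq_square)
  have "4 * (A v \<bullet> u) = A (v + u) \<bullet> (v + u) - A (v - u) \<bullet> (v - u)"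
    using sym[of u v] by (simp add: linear_add[OF \<open>linear A\<close>] linear_diff[OF \<open>linear A\<close>] inner_commute algebra_simps)
  also have "\<dots> \<le> c * (norm (v + u))\<^sup>2 + c * (norm (v - u))\<^sup>2"
    using q[of "v + u"] q[of "v - u"] by linarith
  also have "\<dots> = c * (2 * (norm v)\<^sup>2 + 2 * (norm u)\<^sup>2)"
    unfolding distrib_left[symmetric] by (rule arg_cong[where f="(*) c"]) (simp add: power2_norm_eq_inner algebra_simps inner_commute)
  also have "\<dots> = 4 * (c * norm v * norm v)" by (simp add: nu power2_eq_square)
  finally have "norm v * norm (A v) \<le> norm v * (c * norm v)" unfolding Avu by (simp add: mult_ac)
  then show ?thesis using False by simp
qed

text \<open>Moving from \<open>v\<close> a little against \<open>B v\<close> would make the form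
  negative: the linear term \<open>2 * t * n\<close> beats the quadratic one unless
  \<open>n = 0\<close>. With \<open>B = A - m\<close> this shows that a minimizer of the Rayleigh
  quotient is an eigenvector.\<close>

lemma psd_null_vector:
  fixes B :: "'a::real_inner \<Rightarrow> 'a"
  assumes lin: "linear B" and sym: "\<And>u v. B u \<bullet> v = u \<bullet> B v"
    and psd: "\<And>v. 0 \<le> B v \<bullet> v" and "B v \<bullet> v = 0"
  shows "B v = 0"
proof -
  define w where "w = B v"
  define n where "n = w \<bullet> w"
  define c where "c = B w \<bullet> w"
  have c: "0 \<le> c" using psd by (simp add: c_def)
  define t where "t = - n / (c + 1)"
  have tc: "t * (c + 1) = - n" using c by (simp add: t_def)
  have "0 \<le> B (v + t *\<^sub>R w) \<bullet> (v + t *\<^sub>R w)" by (rule psd)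
  also have "\<dots> = 2 * t * n + t * t * c"
    using \<open>B v \<bullet> v = 0\<close> sym[of w v]
    by (simp add: linear_add[OF lin] linear_cmul[OF lin] n_def c_def w_def algebra_simps inner_commute)
  also have "\<dots> = - (t * t * (c + 2))"
  proof -
    have "n = - (t * (c + 1))" using tc by simp
    then have "2 * t * n = - 2 * t * (t * (c + 1))" by simp
    then show ?thesis by (simp add: algebra_simps)
  qed
  finally have "t * t * (c + 2) \<le> 0" by simp
  moreover have "0 \<le> t * t * (c + 2)" using c by simp
  ultimately have "t * t * (c + 2) = 0" by linarith
  then have "t = 0" using c by auto
  then have "n = 0" using tc by simp
  then show ?thesis by (simp add: n_def w_def)
qed

text \<open>Eigenvectors of distinct eigenvalues are orthogonal, hence independent. Finiteness gives
  the \<open>Min\<close> in \<open>lambda_min\<close> its meaning.\<close>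

lemma finite_eigenvalues_symmetric:
  fixes A :: "'a::euclidean_space \<Rightarrow>\<^sub>L 'a"
  assumes sym: "\<And>u v. A u \<bullet> v = u \<bullet> A v"
  shows "finite {c. \<exists>v. v \<noteq> 0 \<and> A v = c *\<^sub>R v}"
proof -
  let ?E = "{c. \<exists>v. v \<noteq> 0 \<and> A v = c *\<^sub>R v}"
  have "\<forall>c\<in>?E. \<exists>v. v \<noteq> 0 \<and> A v = c *\<^sub>R v" by blast
  from bchoice[OF this] obtain g where g: "\<And>c. c \<in> ?E \<Longrightarrow> g c \<noteq> 0 \<and> A (g c) = c *\<^sub>R g c"
    by blast
  have orth: "g c \<bullet> g c' = 0" if "c \<in> ?E" "c' \<in> ?E" "c \<noteq> c'" for c c'
    using sym[of "g c" "g c'"] g[OF that(1)] g[OF that(2)] that(3) by simp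
  have inj: "inj_on g ?E"
  proof (rule inj_onI, rule ccontr)
    fix c c' assume c: "c \<in> ?E" "c' \<in> ?E" "g c = g c'" "c \<noteq> c'"
    then have "g c \<bullet> g c = 0" using orth[OF c(1,2,4)] by simp
    then show False using g[OF c(1)] by simp
  qed
  have "pairwise orthogonal (g ` ?E)"
    unfolding pairwise_image orthogonal_def by (intro pairwiseI impI orth) auto
  moreover have "0 \<notin> g ` ?E"
  proof
    assume "0 \<in> g ` ?E"
    then obtain c where "c \<in> ?E" "g c = 0" by (metis (no_types, lifting) imageE)
    then show False using g[of c] by simp
  qed
  ultimately have "independent (g ` ?E)" by (rule pairwise_orthogonal_independent)
  then have "finite (g ` ?E)" by (rule independent_imp_finite)
  then show ?thesis using inj by (rule finite_imageD)
qed

text \<open>The Rayleigh quotient attains its minimum \<open>m\<close> on the compact unit sphere;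
  there \<open>A - m\<close> is positive semidefinite with vanishing form, so
  \<open>psd_null_vector\<close> applies.\<close>

lemma lambda_min_symmetric:
  fixes A :: "'a::euclidean_space \<Rightarrow>\<^sub>L 'a"
  assumes sym: "\<And>u v. A u \<bullet> v = u \<bullet> A v"
  shows "lambda_min A * (norm v)\<^sup>2 \<le> A v \<bullet> v" "\<exists>v. norm v = 1 \<and> A v = lambda_min A *\<^sub>R v"
proof -
  let ?E = "{c. \<exists>v. v \<noteq> 0 \<and> A v = c *\<^sub>R v}"
  have "sphere (0::'a) 1 \<noteq> {}" by simp
  moreover have "continuous_on (sphere 0 1) (\<lambda>v. A v \<bullet> v)" by (intro continuous_intros)
  ultimately obtain v0 where "v0 \<in> sphere 0 1" and "\<forall>v\<in>sphere 0 1. A v0 \<bullet> v0 \<le> A v \<bullet> v"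
    using continuous_attains_inf[OF compact_sphere] by blast
  then have v0: "norm v0 = 1" and min: "\<And>v. norm v = 1 \<Longrightarrow> A v0 \<bullet> v0 \<le> A v \<bullet> v"
    by auto
  define m where "m = A v0 \<bullet> v0"
  have q: "m * (norm v)\<^sup>2 \<le> A v \<bullet> v" for v
  proof (cases "v = 0")
    case False
    have "m \<le> A (v /\<^sub>R norm v) \<bullet> (v /\<^sub>R norm v)" unfolding m_def using False by (intro min) simp
    also have "\<dots> = (A v \<bullet> v) / (norm v)\<^sup>2"
      by (simp add: blinfun.scaleR_right power2_eq_square divide_inverse)
    finally show ?thesis using False by (simp add: field_simps)
  qed simp
  have "A v0 - m *\<^sub>R v0 = 0"
  proof (rule psd_null_vector[of "\<lambda>v. A v - m *\<^sub>R v"])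
    show "linear (\<lambda>v. A v - m *\<^sub>R v)"
      by (intro linear_compose_sub linear_scaleR bounded_linear.linear[OF blinfun.bounded_linear_right])
    show "0 \<le> (A v - m *\<^sub>R v) \<bullet> v" for v using q[of v] by (simp add: inner_diff_left dot_square_norm)
    show "(A v0 - m *\<^sub>R v0) \<bullet> v0 = 0" using v0 by (simp add: inner_diff_left m_def dot_square_norm)
  qed (simp add: sym algebra_simps)
  then have ev: "A v0 = m *\<^sub>R v0" by simp
  have "lambda_min A = m" unfolding lambda_min_def
  proof (rule Min_eqI)
    show "finite ?E" by (rule finite_eigenvalues_symmetric[OF sym])
    have "v0 \<noteq> 0" using v0 by auto
    then show "m \<in> ?E" using ev by blast
    fix c assume "c \<in> ?E"
    then obtain w where w: "w \<noteq> 0" "A w = c *\<^sub>R w" by blast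
    have "m * (norm w)\<^sup>2 \<le> c * (norm w)\<^sup>2" using q[of w] w by (simp add: dot_square_norm)
    then show "m \<le> c" using w by simp
  qed
  then show "lambda_min A * (norm v)\<^sup>2 \<le> A v \<bullet> v" "\<exists>v. norm v = 1 \<and> A v = lambda_min A *\<^sub>R v"
    using q ev v0 by auto
qed

text \<open>Weyl's inequality, from testing \<open>A\<close> on an eigenvector of \<open>B\<close>.
  It makes \<open>lambda_min\<close> of the Hessian continuous, as the measurability of local
  minimality requires.\<close>

lemma lambda_min_lipschitz:
  fixes A B :: "'a::euclidean_space \<Rightarrow>\<^sub>L 'a"
  assumes A: "\<And>u v. A u \<bullet> v = u \<bullet> A v" and B: "\<And>u v. B u \<bullet> v = u \<bullet> B v"
  shows "lambda_min A \<le> lambda_min B + norm (A - B)"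
proof -
  obtain v where v: "norm v = 1" "B v = lambda_min B *\<^sub>R v" using lambda_min_symmetric(2)[OF B] by blast
  have "lambda_min A \<le> A v \<bullet> v" using lambda_min_symmetric(1)[OF A, of v] v by simp
  also have "\<dots> = lambda_min B + (A - B) v \<bullet> v"
    using v by (simp add: blinfun.diff_left inner_diff_left dot_square_norm)
  also have "(A - B) v \<bullet> v \<le> norm ((A - B) v) * norm v" by (rule norm_cauchy_schwarz)
  also have "\<dots> \<le> norm (A - B)" using norm_blinfun[of "A - B" v] v by simp
  finally show ?thesis by simp
qed

section \<open>Inexact gradient descent with a Lipschitz Hessian\<close>

text \<open>The convex function 2^x lies below its chord on [0, 1]. This converts the growth factor
  \<open>1 + g / L\<close> into powers of 2.\<close>

lemma two_powr_le: "0 \<le> x \<Longrightarrow> x \<le> 1 \<Longrightarrow> 2 powr x \<le> 1 + (x::real)"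
  using convex_onD[OF exp_convex, of x 0 "ln 2"] by (simp add: powr_def algebra_simps)

text \<open>Gradient and Hessian are parameters, so that the derivatives constructed for the maximum
  function can be plugged in; \<open>grad_eq\<close> and \<open>hess_eq\<close> identify them
  afterwards.\<close>

locale smooth_hessian =
  fixes \<Phi> :: "'a::euclidean_space \<Rightarrow> real" and G :: "'a \<Rightarrow> 'a" and H :: "'a \<Rightarrow> 'a \<Rightarrow>\<^sub>L 'a"
    and L \<rho> :: real
  assumes L_pos: "0 < L" and rho_pos: "0 < \<rho>"
    and F_deriv: "\<And>x. (\<Phi> has_derivative (\<lambda>h. G x \<bullet> h)) (at x)"
    and G_deriv: "\<And>x. (G has_derivative blinfun_apply (H x)) (at x)"
    and G_lip: "\<And>x y. norm (G x - G y) \<le> L * norm (x - y)"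
    and H_lip: "\<And>x y. norm (H x - H y) \<le> \<rho> * norm (x - y)"
begin

lemma grad_eq: "grad \<Phi> = G"
  using grad_eqI[OF F_deriv] by auto

lemma hess_eq: "hess \<Phi> = H"
  unfolding hess_def grad_eq using jacobian_eqI[OF G_deriv] by auto

lemma H_symmetric: "H x u \<bullet> v = u \<bullet> H x v"
  by (rule second_derivative_symmetric[OF F_deriv G_deriv])

lemma H_norm_le: "norm (H x v) \<le> L * norm v"
  by (rule derivative_norm_le_of_lipschitz[OF G_deriv G_lip])

lemma H_quadratic_form_le: "\<bar>H x v \<bullet> v\<bar> \<le> L * (norm v)\<^sup>2"
proof -
  have "\<bar>H x v \<bullet> v\<bar> \<le> norm (H x v) * norm v" by (rule Cauchy_Schwarz_ineq2)
  also have "\<dots> \<le> L * norm v * norm v" by (intro mult_right_mono H_norm_le) simp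
  finally show ?thesis by (simp add: power2_eq_square mult_ac)
qed

lemma taylor2: "\<exists>\<xi>. 0 < \<xi> \<and> \<xi> < 1 \<and> \<Phi> (x + h) = \<Phi> x + G x \<bullet> h + (H (x + \<xi> *\<^sub>R h) h \<bullet> h) / 2"
proof -
  define d where "d m t = (if m = 0 then \<Phi> (x + t *\<^sub>R h) else if m = 1 then G (x + t *\<^sub>R h) \<bullet> h
    else H (x + t *\<^sub>R h) h \<bullet> h)" for m :: nat and t
  have 0: "DERIV (d 0) t :> d (Suc 0) t" for t
  proof -
    have "((\<lambda>t. \<Phi> (x + t *\<^sub>R h)) has_derivative (\<lambda>s. G (x + t *\<^sub>R h) \<bullet> (s *\<^sub>R h))) (at t)"
      by (intro has_derivative_compose[OF _ F_deriv]) (auto intro!: derivative_eq_intros)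
    then show ?thesis unfolding has_field_derivative_def d_def by (simp add: mult_commute_abs)
  qed
  have 1: "DERIV (d (Suc 0)) t :> d (Suc (Suc 0)) t" for t
  proof -
    have "((\<lambda>t. G (x + t *\<^sub>R h)) has_derivative (\<lambda>s. H (x + t *\<^sub>R h) (s *\<^sub>R h))) (at t)"
      by (intro has_derivative_compose[OF _ G_deriv]) (auto intro!: derivative_eq_intros)
    then have "((\<lambda>t. G (x + t *\<^sub>R h) \<bullet> h) has_derivative (\<lambda>s. H (x + t *\<^sub>R h) (s *\<^sub>R h) \<bullet> h)) (at t)"
      by (rule has_derivative_inner_left)
    then show ?thesis unfolding has_field_derivative_def d_def
      by (simp add: blinfun.scaleR_right mult_commute_abs)
  qed
  have "\<forall>m t. m < 2 \<and> 0 \<le> t \<and> t \<le> 1 \<longrightarrow> DERIV (d m) t :> d (Suc m) t"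
    using 0 1 by (auto simp: less_2_cases_iff)
  from Maclaurin[of 1 2 d "d 0", OF _ _ _ this] obtain t where "0 < t" "t < 1"
    "d 0 1 = (\<Sum>m<2. (d m 0 / fact m) * 1 ^ m) + (d 2 t / fact 2) * 1 ^ 2" by auto
  then show ?thesis by (intro exI[of _ t]) (simp add: d_def numeral_2_eq_2)
qed

lemma descent: "\<Phi> (x + h) \<le> \<Phi> x + G x \<bullet> h + L / 2 * (norm h)\<^sup>2"
proof -
  obtain \<xi> where "\<Phi> (x + h) = \<Phi> x + G x \<bullet> h + (H (x + \<xi> *\<^sub>R h) h \<bullet> h) / 2" using taylor2 by blast
  then show ?thesis using H_quadratic_form_le[of "x + \<xi> *\<^sub>R h" h] by simp
qed

text \<open>The Lagrange remainder compares the Hessian at an unknown intermediate point with the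
  one at \<open>x\<close>; bounding their distance by the whole step gives \<rho>/2 instead of the
  sharp \<rho>/6.\<close>

lemma cubic_upper_bound:
  "\<Phi> (x + h) \<le> \<Phi> x + G x \<bullet> h + (H x h \<bullet> h) / 2 + \<rho> / 2 * norm h ^ 3"
proof -
  obtain \<xi> where \<xi>: "0 < \<xi>" "\<xi> < 1"
    and eq: "\<Phi> (x + h) = \<Phi> x + G x \<bullet> h + (H (x + \<xi> *\<^sub>R h) h \<bullet> h) / 2" using taylor2 by blast
  let ?D = "H (x + \<xi> *\<^sub>R h) - H x"
  have "norm ?D \<le> \<rho> * (\<xi> * norm h)" using H_lip[of "x + \<xi> *\<^sub>R h" x] \<xi> by simp
  also have "\<dots> \<le> \<rho> * (1 * norm h)" using \<xi> rho_pos by (intro mult_left_mono mult_right_mono) auto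
  finally have D: "norm ?D \<le> \<rho> * norm h" by simp
  have "?D h \<bullet> h \<le> norm (?D h) * norm h" by (rule norm_cauchy_schwarz)
  also have "\<dots> \<le> norm ?D * norm h * norm h" by (intro mult_right_mono norm_blinfun) simp
  also have "\<dots> \<le> \<rho> * norm h * norm h * norm h" using D by (intro mult_right_mono) auto
  finally have "H (x + \<xi> *\<^sub>R h) h \<bullet> h \<le> H x h \<bullet> h + \<rho> * norm h ^ 3"
    by (simp add: blinfun.diff_left inner_diff_left power3_eq_cube mult_ac)
  then show ?thesis using eq by simp
qed

text \<open>The map \<open>G z - H c z\<close> has derivative \<open>H z - H c\<close>, which is at
  most \<open>\<rho> * R\<close> on the ball. Freezing the Hessian at \<open>c\<close> lets one
  fixed linear map drive the difference of two paths at all times.\<close>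

lemma gradient_difference_linearization:
  assumes "norm (x - c) \<le> R" "norm (y - c) \<le> R"
  shows "norm (G x - G y - H c (x - y)) \<le> \<rho> * R * norm (x - y)"
proof -
  have "norm ((G x - H c x) - (G y - H c y)) \<le> \<rho> * R * norm (x - y)"
  proof (rule differentiable_bound[where S="cball c R" and f="\<lambda>z. G z - H c z" and f'="\<lambda>z. blinfun_apply (H z - H c)"])
    fix z assume "z \<in> cball c R"
    then have "norm (z - c) \<le> R" by (simp add: dist_norm norm_minus_commute)
    have "((\<lambda>z. G z - H c z) has_derivative (\<lambda>h. H z h - H c h)) (at z)"
      by (intro has_derivative_diff G_deriv bounded_linear_imp_has_derivative blinfun.bounded_linear_right)
    then show "((\<lambda>z. G z - H c z) has_derivative blinfun_apply (H z - H c)) (at z within cball c R)"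
      by (simp add: minus_blinfun.rep_eq has_derivative_at_withinI)
    have "onorm (blinfun_apply (H z - H c)) = norm (H z - H c)" by (simp add: norm_blinfun.rep_eq)
    also have "\<dots> \<le> \<rho> * norm (z - c)" by (rule H_lip)
    also have "\<dots> \<le> \<rho> * R" using \<open>norm (z - c) \<le> R\<close> rho_pos by simp
    finally show "onorm (blinfun_apply (H z - H c)) \<le> \<rho> * R" .
  qed (use assms in \<open>auto simp: dist_norm norm_minus_commute\<close>)
  then show ?thesis by (simp add: blinfun.diff_right algebra_simps)
qed

text \<open>For step size \<open>1 / L\<close> the linear and quadratic terms of
  \<open>descent\<close> complete to a square, so that the direction error enters only
  quadratically.\<close>

lemma step_decrease:
  "\<Phi> (x - (1 / L) *\<^sub>R s) \<le> \<Phi> x - (norm (G x))\<^sup>2 / (2 * L) + (norm (s - G x))\<^sup>2 / (2 * L)"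
proof -
  have "\<Phi> (x - (1 / L) *\<^sub>R s) \<le> \<Phi> x - (1 / L) * (G x \<bullet> s) + L / 2 * ((1 / L) * norm s)\<^sup>2"
    using descent[of x "- (1 / L) *\<^sub>R s"] L_pos by simp
  also have "L / 2 * ((1 / L) * norm s)\<^sup>2 = (norm s)\<^sup>2 / (2 * L)"
    using L_pos by (simp add: power2_eq_square)
  also have "(norm s)\<^sup>2 = s \<bullet> s" by (rule power2_norm_eq_inner)
  also have "\<Phi> x - (1 / L) * (G x \<bullet> s) + (s \<bullet> s) / (2 * L)
      = \<Phi> x - (norm (G x))\<^sup>2 / (2 * L) + (norm (s - G x))\<^sup>2 / (2 * L)"
    using L_pos by (simp add: power2_norm_eq_inner inner_diff_left inner_diff_right inner_commute field_simps)
  finally show ?thesis .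
qed

text \<open>Stated through the step actually taken, so that squared step lengths can be summed along
  a path.\<close>

lemma step_decrease_by_length:
  "\<Phi> (x - (1 / L) *\<^sub>R s) \<le> \<Phi> x - (norm s)\<^sup>2 / (4 * L) + (norm (s - G x))\<^sup>2 / L"
proof -
  let ?g = "norm (G x)" and ?e = "norm (s - G x)"
  have "norm s \<le> ?g + ?e" using norm_triangle_ineq[of "G x" "s - G x"] by simp
  then have "(norm s)\<^sup>2 \<le> (?g + ?e)\<^sup>2" by (intro power_mono) auto
  also have "\<dots> \<le> 2 * ?g\<^sup>2 + 2 * ?e\<^sup>2"
    using zero_le_power2[of "?g - ?e"] by (simp add: power2_sum power2_diff)
  finally have "(norm s)\<^sup>2 / (4 * L) \<le> (2 * ?g\<^sup>2 + 2 * ?e\<^sup>2) / (4 * L)" using L_pos by (intro divide_right_mono) auto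
  also have "\<dots> = ?g\<^sup>2 / (2 * L) + ?e\<^sup>2 / (2 * L)" using L_pos by (simp add: field_simps)
  finally have "(norm s)\<^sup>2 / (4 * L) \<le> ?g\<^sup>2 / (2 * L) + ?e\<^sup>2 / (2 * L)" .
  moreover have "?e\<^sup>2 / (2 * L) + ?e\<^sup>2 / (2 * L) = ?e\<^sup>2 / L" by (simp add: field_simps)
  ultimately show ?thesis using step_decrease[of x s] by linarith
qed

text \<open>A step along the direction of negative curvature already descends this far, and it
  cannot go below the lower bound \<open>m\<close>.\<close>

lemma saddle_gap:
  assumes low: "\<And>y. m \<le> \<Phi> y" and v: "norm v = 1" "H x v \<bullet> v \<le> - g" and "0 < g"
  shows "2 / 27 * (g ^ 3 / \<rho>\<^sup>2) \<le> \<Phi> x - m"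
proof -
  \<comment> \<open>The sign is chosen so that the first-order term does not increase the
    function.\<close>
  define w where "w = (if G x \<bullet> v \<le> 0 then v else - v)"
  have w: "norm w = 1" "H x w \<bullet> w \<le> - g" "G x \<bullet> w \<le> 0"
    using v by (auto simp: w_def blinfun.minus_right)
  \<comment> \<open>The minimizer of
    \<open>- g * t\<^sup>2 / 2 + \<rho> * t ^ 3 / 2\<close>.\<close>
  define t where "t = 2 / 3 * g / \<rho>"
  have t: "0 < t" using \<open>0 < g\<close> rho_pos by (simp add: t_def)
  have "m \<le> \<Phi> (x + t *\<^sub>R w)" by (rule low)
  also have "\<dots> \<le> \<Phi> x + t * (G x \<bullet> w) + t\<^sup>2 * (H x w \<bullet> w) / 2 + \<rho> / 2 * t ^ 3"
    using cubic_upper_bound[of x "t *\<^sub>R w"] w t by (simp add: blinfun.scaleR_right power2_eq_square)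
  also have "\<dots> \<le> \<Phi> x + 0 + t\<^sup>2 * (- g) / 2 + \<rho> / 2 * t ^ 3"
    using w t rho_pos by (intro add_mono divide_right_mono mult_left_mono) (auto simp: mult_nonneg_nonpos)
  also have "\<dots> = \<Phi> x - 2 / 27 * (g ^ 3 / \<rho>\<^sup>2)"
    using rho_pos by (simp add: t_def power2_eq_square power3_eq_cube field_simps)
  finally show ?thesis by simp
qed

section \<open>Paths of inexact gradient steps\<close>

lemma path_decrease:
  assumes step: "\<And>t. t < n \<Longrightarrow> z (Suc t) = z t - (1 / L) *\<^sub>R s t"
  shows "(\<Sum>t<n. (norm (s t))\<^sup>2) / (4 * L) \<le> \<Phi> (z 0) - \<Phi> (z n) + (\<Sum>t<n. (norm (s t - G (z t)))\<^sup>2) / L"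
  using step
proof (induction n)
  case (Suc n)
  have "\<Phi> (z (Suc n)) \<le> \<Phi> (z n) - (norm (s n))\<^sup>2 / (4 * L) + (norm (s n - G (z n)))\<^sup>2 / L"
    using step_decrease_by_length Suc.prems[of n] by simp
  with Suc show ?case by (simp add: add_divide_distrib)
qed simp

lemma path_almost_decreasing:
  assumes step: "\<And>t. t < N \<Longrightarrow> z (Suc t) = z t - (1 / L) *\<^sub>R s t" and "n \<le> N"
  shows "\<Phi> (z N) \<le> \<Phi> (z n) + (\<Sum>t=n..<N. (norm (s t - G (z t)))\<^sup>2) / L"
  using \<open>n \<le> N\<close> step
proof (induction N rule: dec_induct)
  case (step N)
  have "\<Phi> (z (Suc N)) \<le> \<Phi> (z N) - (norm (s N))\<^sup>2 / (4 * L) + (norm (s N - G (z N)))\<^sup>2 / L"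
    using step_decrease_by_length step.prems[of N] by simp
  moreover have "0 \<le> (norm (s N))\<^sup>2 / (4 * L)" using L_pos by simp
  moreover have "\<Phi> (z N) \<le> \<Phi> (z n) + (\<Sum>t=n..<N. (norm (s t - G (z t)))\<^sup>2) / L" using step by simp
  ultimately show ?case using step.hyps by (simp add: add_divide_distrib)
qed simp

text \<open>By Cauchy-Schwarz the squared displacement is at most the number of steps times the sum
  of squared steps, and that sum is paid for by the decrease of \<Phi>. The bound uses the value at
  the final time \<open>N\<close>, the only one controlled for a stuck path; after \<open>n\<close>
  the function can rise only by the errors.\<close>

lemma path_localization:
  assumes step: "\<And>t. t < N \<Longrightarrow> z (Suc t) = z t - (1 / L) *\<^sub>R s t" and "n \<le> N"
  shows "(norm (z n - z 0))\<^sup>2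
    \<le> 4 * real N / L * (\<Phi> (z 0) - \<Phi> (z N) + (\<Sum>t<N. (norm (s t - G (z t)))\<^sup>2) / L)"
proof -
  let ?e = "\<lambda>t. (norm (s t - G (z t)))\<^sup>2"
  have z: "z k - z 0 = - (1 / L) *\<^sub>R (\<Sum>t<k. s t)" if "k \<le> n" for k
    using that
  proof (induction k)
    case (Suc k)
    then have "z k - z 0 = - (1 / L) *\<^sub>R (\<Sum>t<k. s t)" "z (Suc k) = z k - (1 / L) *\<^sub>R s k"
      using step[of k] \<open>n \<le> N\<close> by auto
    then have "z (Suc k) - z 0 = - (1 / L) *\<^sub>R (\<Sum>t<k. s t) - (1 / L) *\<^sub>R s k" by simp
    also have "\<dots> = - (1 / L) *\<^sub>R (\<Sum>t<Suc k. s t)" by (simp add: scaleR_add_right)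
    finally show ?case .
  qed simp
  have "norm (z n - z 0) = (1 / L) * norm (\<Sum>t<n. s t)" using z[of n] L_pos by simp
  also have "\<dots> \<le> (1 / L) * (\<Sum>t<n. norm (s t))" using L_pos by (intro mult_left_mono norm_sum) auto
  finally have "(norm (z n - z 0))\<^sup>2 \<le> ((1 / L) * (\<Sum>t<n. norm (s t)))\<^sup>2" by (intro power_mono) auto
  also have "\<dots> = (1 / L)\<^sup>2 * (\<Sum>t<n. norm (s t))\<^sup>2" by (rule power_mult_distrib)
  also have "\<dots> \<le> (1 / L)\<^sup>2 * (real n * (\<Sum>t<n. (norm (s t))\<^sup>2))"
    using sum_squared_le_sum_of_squares[of "\<lambda>t. norm (s t)" "{..<n}"] by (intro mult_left_mono) (auto simp: mult.commute)
  also have "\<dots> = 4 * real n / L * ((\<Sum>t<n. (norm (s t))\<^sup>2) / (4 * L))"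
    using L_pos by (simp add: power2_eq_square field_simps)
  also have "\<dots> \<le> 4 * real N / L * (\<Phi> (z 0) - \<Phi> (z N) + (\<Sum>t<N. ?e t) / L)"
  proof (intro mult_mono divide_right_mono)
    have "(\<Sum>t<n. (norm (s t))\<^sup>2) / (4 * L) \<le> \<Phi> (z 0) - \<Phi> (z n) + (\<Sum>t<n. ?e t) / L"
      using step \<open>n \<le> N\<close> by (intro path_decrease) auto
    moreover have "\<Phi> (z N) \<le> \<Phi> (z n) + (\<Sum>t=n..<N. ?e t) / L"
      using step \<open>n \<le> N\<close> by (rule path_almost_decreasing[where z=z and s=s])
    moreover have "(\<Sum>t<N. ?e t) = (\<Sum>t<n. ?e t) + (\<Sum>t=n..<N. ?e t)"
      using \<open>n \<le> N\<close> by (simp add: lessThan_atLeast0 sum.atLeastLessThan_concat)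
    ultimately show "(\<Sum>t<n. (norm (s t))\<^sup>2) / (4 * L) \<le> \<Phi> (z 0) - \<Phi> (z N) + (\<Sum>t<N. ?e t) / L"
      by (simp add: add_divide_distrib)
  qed (use L_pos \<open>n \<le> N\<close> in \<open>auto intro!: sum_nonneg divide_nonneg_pos\<close>)
  finally show ?thesis .
qed

text \<open>The sum of the component along \<open>v\<close> and the upper bound on the norm of the difference of the
  two paths grows at the pure rate \<open>1 + \<gamma> / L\<close>: the Hessian errors cancel in it.\<close>

lemma path_separation:
  assumes z: "\<And>t. t < N \<Longrightarrow> z (Suc t) = z t - (1 / L) *\<^sub>R s t"
    and z': "\<And>t. t < N \<Longrightarrow> z' (Suc t) = z' t - (1 / L) *\<^sub>R s' t"
    and e: "\<And>t. 1 \<le> t \<Longrightarrow> t < N \<Longrightarrow> norm (s t - G (z t)) \<le> e"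
    and e': "\<And>t. 1 \<le> t \<Longrightarrow> t < N \<Longrightarrow> norm (s' t - G (z' t)) \<le> e"
    and S: "\<And>t. 1 \<le> t \<Longrightarrow> t < N \<Longrightarrow> norm (z t - c) \<le> S" "\<And>t. 1 \<le> t \<Longrightarrow> t < N \<Longrightarrow> norm (z' t - c) \<le> S"
    and "0 \<le> S" "0 \<le> e" "0 < \<gamma>" "0 \<le> b"
    and v: "norm v = 1" "H c v = - \<gamma> *\<^sub>R v" and min: "\<And>w. - \<gamma> * (norm w)\<^sup>2 \<le> H c w \<bullet> w"
    and init: "z 1 - z' 1 = b *\<^sub>R v" and "j < N"
  shows "2 * b * (1 + \<gamma> / L) ^ j - (1 + \<gamma> / L + \<rho> * S / L) ^ j * (b + 2 * e / \<gamma>) \<le> norm (z (Suc j) - z' (Suc j))"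
proof -
  \<comment> \<open>Shifted by one: the perturbations act during step 0, so the paths first differ
    at time 1.\<close>
  define w where "w j = z (Suc j) - z' (Suc j)" for j
  define \<alpha> where "\<alpha> = 1 + \<gamma> / L"
  define \<sigma> where "\<sigma> = \<rho> * S / L"
  define \<beta> where "\<beta> = \<alpha> + \<sigma>"
  define k where "k = 2 * e / \<gamma>"
  \<comment> \<open>The solution of the norm recursion with \<open>B 0 = b\<close>. The offset
    \<open>k\<close> is such that \<open>k * (\<beta> - 1)\<close> covers the error
    \<open>2 * e / L\<close> of both gradients.\<close>
  define B where "B j = \<beta> ^ j * (b + k) - k" for j
  have \<alpha>: "1 < \<alpha>" using L_pos \<open>0 < \<gamma>\<close> by (simp add: \<alpha>_def)
  have \<sigma>: "0 \<le> \<sigma>" using L_pos rho_pos \<open>0 \<le> S\<close> by (simp add: \<sigma>_def)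
  have k: "0 \<le> k" using \<open>0 \<le> e\<close> \<open>0 < \<gamma>\<close> by (simp add: k_def)
  have "2 * e / L = k * (\<alpha> - 1)" using \<open>0 < \<gamma>\<close> by (simp add: k_def \<alpha>_def)
  also have "\<dots> \<le> k * (\<beta> - 1)" using k \<sigma> by (intro mult_left_mono) (auto simp: \<beta>_def)
  finally have ke: "2 * e / L \<le> k * (\<beta> - 1)" .
  have BSuc: "B (Suc j) = \<beta> * B j + k * (\<beta> - 1)" for j by (simp add: B_def algebra_simps)
  \<comment> \<open>The form of \<open>I - H c / L\<close> lies between 0, as \<open>H c\<close> is
    at most \<open>L\<close>, and \<alpha>, as \<open>H c\<close> is at least
    \<open>- \<gamma>\<close>.\<close>
  have lin: "norm (w - (1 / L) *\<^sub>R H c w) \<le> \<alpha> * norm w" for w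
  proof (rule symmetric_norm_le_of_quadratic_form[of "\<lambda>w. w - (1 / L) *\<^sub>R H c w"])
    show "linear (\<lambda>w. w - (1 / L) *\<^sub>R H c w)"
      by (intro linear_compose_sub linear_compose_scale_right bounded_linear.linear[OF blinfun.bounded_linear_right])
        (simp_all add: linear_iff)
    show "(u - (1 / L) *\<^sub>R H c u) \<bullet> v = u \<bullet> (v - (1 / L) *\<^sub>R H c v)" for u v
      by (simp add: inner_diff_left inner_diff_right H_symmetric)
    fix v
    have "(v - (1 / L) *\<^sub>R H c v) \<bullet> v = (norm v)\<^sup>2 - (H c v \<bullet> v) / L"
      by (simp add: inner_diff_left dot_square_norm)
    moreover have "(H c v \<bullet> v) / L \<le> (norm v)\<^sup>2"
      using H_quadratic_form_le[of c v] L_pos by (simp add: divide_le_eq mult.commute abs_le_iff)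
    moreover have "- (\<gamma> / L) * (norm v)\<^sup>2 \<le> (H c v \<bullet> v) / L"
      using divide_right_mono[OF min[of v], of L] L_pos by simp
    ultimately show "\<bar>(v - (1 / L) *\<^sub>R H c v) \<bullet> v\<bar> \<le> \<alpha> * (norm v)\<^sup>2"
      using \<open>0 < \<gamma>\<close> L_pos by (simp add: \<alpha>_def algebra_simps)
  qed
  \<comment> \<open>In one step the component along \<open>v\<close> falls short of its growth by at
    most \<open>\<sigma> * norm (w j) + 2 * e / L\<close>, while \<open>B\<close> gains at least
    that much beyond the factor \<alpha>. Both summands start at \<open>b\<close>, hence
    \<open>2 * b\<close>.\<close>
  have main: "norm (w j) \<le> B j \<and> 2 * b * \<alpha> ^ j \<le> w j \<bullet> v + B j" if "j < N" for j
    using that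
  proof (induction j)
    case 0
    have w0: "w 0 = b *\<^sub>R v" using init by (simp add: w_def)
    have "v \<bullet> v = 1" using v by (simp add: dot_square_norm)
    then show ?case using v(1) \<open>0 \<le> b\<close> by (simp add: w0 B_def)
  next
    case (Suc j)
    let ?t = "Suc j"
    define R where "R = (s ?t - s' ?t) - H c (w j)"
    have "norm (G (z ?t) - G (z' ?t) - H c (w j)) \<le> \<rho> * S * norm (w j)"
      unfolding w_def using Suc.prems S[of ?t] by (intro gradient_difference_linearization) auto
    moreover have "norm (s ?t - G (z ?t)) \<le> e" "norm (s' ?t - G (z' ?t)) \<le> e"
      using e[of ?t] e'[of ?t] Suc.prems by auto
    moreover have "R = (G (z ?t) - G (z' ?t) - H c (w j)) + ((s ?t - G (z ?t)) - (s' ?t - G (z' ?t)))"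
      by (simp add: R_def)
    ultimately have R: "norm R \<le> \<rho> * S * norm (w j) + 2 * e"
      using norm_triangle_ineq norm_triangle_ineq4 by (smt (verit))
    have RL: "norm ((1 / L) *\<^sub>R R) \<le> \<sigma> * norm (w j) + 2 * e / L"
      using divide_right_mono[OF R, of L] L_pos by (simp add: \<sigma>_def add_divide_distrib)
    have w: "w ?t = (w j - (1 / L) *\<^sub>R H c (w j)) - (1 / L) *\<^sub>R R"
      using z[of ?t] z'[of ?t] Suc.prems by (simp add: w_def R_def algebra_simps)
    have IH: "norm (w j) \<le> B j" "2 * b * \<alpha> ^ j \<le> w j \<bullet> v + B j" using Suc by auto
    have "norm (w ?t) \<le> \<alpha> * norm (w j) + (\<sigma> * norm (w j) + 2 * e / L)"
      unfolding w using norm_triangle_ineq4 lin[of "w j"] RL by (smt (verit))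
    also have "\<dots> = \<beta> * norm (w j) + 2 * e / L" by (simp add: \<beta>_def algebra_simps)
    also have "\<dots> \<le> \<beta> * B j + k * (\<beta> - 1)"
      using IH(1) ke \<alpha> \<sigma> by (intro add_mono mult_left_mono) (auto simp: \<beta>_def)
    finally have 1: "norm (w ?t) \<le> B ?t" unfolding BSuc .
    have "w ?t \<bullet> v = \<alpha> * (w j \<bullet> v) - ((1 / L) *\<^sub>R R) \<bullet> v"
      unfolding w using v(2) H_symmetric[of c "w j" v]
      by (simp add: inner_diff_left \<alpha>_def algebra_simps)
    moreover have "((1 / L) *\<^sub>R R) \<bullet> v \<le> \<sigma> * norm (w j) + 2 * e / L"
      using norm_cauchy_schwarz[of "(1 / L) *\<^sub>R R" v] RL v by simp
    moreover have "\<sigma> * norm (w j) \<le> \<sigma> * B j" using IH \<sigma> by (intro mult_left_mono) auto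
    moreover have "\<beta> * B j = \<alpha> * B j + \<sigma> * B j" by (simp add: \<beta>_def algebra_simps)
    ultimately have "\<alpha> * (w j \<bullet> v + B j) \<le> w ?t \<bullet> v + B ?t"
      unfolding BSuc using ke by (simp only: distrib_left)
    moreover have "\<alpha> * (2 * b * \<alpha> ^ j) \<le> \<alpha> * (w j \<bullet> v + B j)" using IH \<alpha> by (intro mult_left_mono) auto
    ultimately show ?case using 1 by (simp add: mult_ac)
  qed
  have "2 * b * \<alpha> ^ j \<le> w j \<bullet> v + B j" using main \<open>j < N\<close> by blast
  moreover have "w j \<bullet> v \<le> norm (w j)" using norm_cauchy_schwarz[of "w j" v] v by simp
  ultimately have "2 * b * \<alpha> ^ j - \<beta> ^ j * (b + k) \<le> norm (w j)" using k by (simp add: B_def)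
  then show ?thesis by (simp add: \<alpha>_def \<beta>_def \<sigma>_def k_def w_def)
qed

text \<open>\<open>path_localization\<close> with the actual constants. Little decrease over few
  steps means little displacement; the threshold with 8000 is calibrated to give the radius with
  40.\<close>

lemma stuck_path_localization:
  assumes g: "0 < g" "g \<le> L" and \<iota>: "16 \<le> \<iota>" "256 * \<iota>\<^sup>2 \<le> 2 powr \<iota>"
    and r: "r = g\<^sup>2 / \<rho> / (400 * \<iota> ^ 3)" and e: "e = g\<^sup>2 / \<rho> * (2 powr (- \<iota>))\<^sup>2"
    and N: "real N \<le> \<iota> * L / g + 1"
    and z: "\<And>t. t < N \<Longrightarrow> z (Suc t) = z t - (1 / L) *\<^sub>R s t"
    and e0: "norm (s 0 - G (z 0)) \<le> r + e"
    and e1: "\<And>t. 1 \<le> t \<Longrightarrow> t < N \<Longrightarrow> norm (s t - G (z t)) \<le> e"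
    and stuck: "\<Phi> (z 0) - g ^ 3 / (8000 * \<rho>\<^sup>2 * \<iota> ^ 3) \<le> \<Phi> (z N)"
    and "n \<le> N"
  shows "norm (z n - z 0) \<le> g / (40 * \<rho> * \<iota>)"
proof -
  define F where "F = g ^ 3 / (8000 * \<rho>\<^sup>2 * \<iota> ^ 3)"
  define k where "k = real N / L"
  define X where "X = g\<^sup>2 / \<rho>\<^sup>2 / \<iota>\<^sup>2"
  define \<epsilon> where "\<epsilon> = g\<^sup>2 / \<rho>"
  have \<epsilon>: "0 < \<epsilon>" using g rho_pos by (simp add: \<epsilon>_def)
  have p: "2 powr (- \<iota>) \<le> 1 / (256 * \<iota>\<^sup>2)"
    using \<iota> by (simp add: powr_minus inverse_eq_divide frac_le)
  have "(2 powr (- \<iota>))\<^sup>2 \<le> (1 / (256 * \<iota>\<^sup>2))\<^sup>2" using p by (intro power_mono) auto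
  also have "\<dots> = 1 / (65536 * \<iota> ^ 4)" by (simp add: power_divide power_mult_distrib flip: power_mult)
  finally have ele: "e \<le> \<epsilon> / (65536 * \<iota> ^ 4)"
    using mult_left_mono[of "(2 powr (- \<iota>))\<^sup>2" "1 / (65536 * \<iota> ^ 4)" \<epsilon>] \<epsilon> by (simp add: e \<epsilon>_def)
  have e_nonneg: "0 \<le> e" using g rho_pos by (simp add: e)
  \<comment> \<open>\<open>N\<close> exceeds \<open>\<iota> * L / g\<close> by at most 1, and that
    quantity is at least 16; hence 17/16.\<close>
  have k: "0 \<le> k" "k \<le> 17 / 16 * \<iota> / g"
  proof -
    have "1 * 1 \<le> (\<iota> / 16) * (L / g)" using \<iota> g by (intro mult_mono) auto
    then have "real N \<le> 17 / 16 * \<iota> * (L / g)" using N by (simp add: field_simps)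
    then show "k \<le> 17 / 16 * \<iota> / g" using L_pos g by (simp add: k_def field_simps)
    show "0 \<le> k" using L_pos by (simp add: k_def)
  qed
  have sum: "(\<Sum>t<N. (norm (s t - G (z t)))\<^sup>2) \<le> (r + e)\<^sup>2 + real N * e\<^sup>2"
  proof -
    have "(\<Sum>t<N. (norm (s t - G (z t)))\<^sup>2) \<le> (\<Sum>t<N. (if t = 0 then (r + e)\<^sup>2 else 0) + e\<^sup>2)"
    proof (rule sum_mono)
      fix t assume "t \<in> {..<N}"
      then show "(norm (s t - G (z t)))\<^sup>2 \<le> (if t = 0 then (r + e)\<^sup>2 else 0) + e\<^sup>2"
        using e0 e1[of t] power_mono[of "norm (s t - G (z t))" _ 2]
        by (cases "t = 0") (auto intro: add_increasing2)
    qed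
    also have "\<dots> \<le> (r + e)\<^sup>2 + real N * e\<^sup>2" by (simp add: sum.distrib sum.delta)
    finally show ?thesis .
  qed
  have re: "(r + e)\<^sup>2 \<le> \<epsilon>\<^sup>2 / (152100 * \<iota> ^ 6)"
  proof -
    have "e \<le> \<epsilon> / (16000 * \<iota> ^ 3)"
      using ele by (rule order_trans) (use \<epsilon> \<iota> in \<open>auto intro!: divide_left_mono simp: eval_nat_numeral\<close>)
    then have "r + e \<le> \<epsilon> / (400 * \<iota> ^ 3) + \<epsilon> / (16000 * \<iota> ^ 3)" by (simp add: r \<epsilon>_def)
    also have "\<dots> \<le> \<epsilon> / (390 * \<iota> ^ 3)" using \<epsilon> \<iota> by (simp add: field_simps)
    finally have "(r + e)\<^sup>2 \<le> (\<epsilon> / (390 * \<iota> ^ 3))\<^sup>2"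
      using g rho_pos \<iota> e_nonneg by (intro power_mono) (auto simp: r)
    also have "\<dots> = \<epsilon>\<^sup>2 / (152100 * \<iota> ^ 6)" by (simp add: power_divide power_mult_distrib flip: power_mult)
    finally show ?thesis .
  qed
  have X: "0 < X" using g rho_pos \<iota> by (simp add: X_def)
  \<comment> \<open>The squared radius is \<open>X / 1600\<close>. It receives contributions from
    the allowed decrease, which dominates, from the perturbed step 0, and from the gradient errors
    of all steps.\<close>
  have 1: "4 * k * F \<le> 17 / 32000 * X"
  proof -
    have "4 * k * F \<le> 4 * (17 / 16 * \<iota> / g) * F" using k g rho_pos \<iota> by (intro mult_right_mono mult_left_mono) (auto simp: F_def)
    also have "\<dots> = 17 / 32000 * X" using g rho_pos \<iota> by (simp add: F_def X_def eval_nat_numeral field_simps)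
    finally show ?thesis .
  qed
  have 2: "4 * k * ((r + e)\<^sup>2 / L) \<le> X / 100000"
  proof -
    have "(r + e)\<^sup>2 / L \<le> (\<epsilon>\<^sup>2 / (152100 * \<iota> ^ 6)) / g" using re g L_pos by (intro frac_le) auto
    then have "4 * k * ((r + e)\<^sup>2 / L) \<le> 4 * (17 / 16 * \<iota> / g) * ((\<epsilon>\<^sup>2 / (152100 * \<iota> ^ 6)) / g)"
      using k g \<iota> L_pos by (intro mult_mono) auto
    also have "\<dots> = 17 / 608400 * X / \<iota> ^ 3" using g rho_pos \<iota> by (simp add: \<epsilon>_def X_def eval_nat_numeral field_simps)
    also have "\<dots> \<le> 17 / 608400 * X / 16 ^ 3" using X \<iota> by (intro divide_left_mono power_mono) auto
    also have "\<dots> \<le> X / 100000" using X by simp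
    finally show ?thesis .
  qed
  have 3: "4 * k * (k * e\<^sup>2) \<le> X / 100000"
  proof -
    have "e\<^sup>2 \<le> (\<epsilon> / (65536 * \<iota> ^ 4))\<^sup>2" using ele e_nonneg by (rule power_mono)
    then have "4 * k * (k * e\<^sup>2) \<le> 4 * (17 / 16 * \<iota> / g) * ((17 / 16 * \<iota> / g) * (\<epsilon> / (65536 * \<iota> ^ 4))\<^sup>2)"
      using k g \<iota> by (intro mult_mono) auto
    also have "\<dots> = 289 / 64 / 65536\<^sup>2 * X / \<iota> ^ 4" using g rho_pos \<iota> by (simp add: \<epsilon>_def X_def eval_nat_numeral field_simps)
    also have "\<dots> \<le> 289 / 64 / 65536\<^sup>2 * X / 16 ^ 4" using X \<iota> by (intro divide_left_mono power_mono) auto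
    also have "\<dots> \<le> X / 100000" using X by simp
    finally show ?thesis .
  qed
  have "(norm (z n - z 0))\<^sup>2
      \<le> 4 * k * (\<Phi> (z 0) - \<Phi> (z N) + (\<Sum>t<N. (norm (s t - G (z t)))\<^sup>2) / L)"
    using path_localization[where z=z and s=s, OF z \<open>n \<le> N\<close>] by (simp add: k_def)
  also have "\<dots> \<le> 4 * k * (F + ((r + e)\<^sup>2 + real N * e\<^sup>2) / L)"
    using stuck sum k L_pos by (intro mult_left_mono add_mono divide_right_mono) (auto simp: F_def)
  also have "\<dots> = 4 * k * F + 4 * k * ((r + e)\<^sup>2 / L) + 4 * k * (k * e\<^sup>2)"
    by (simp add: k_def add_divide_distrib algebra_simps)
  also have "\<dots> \<le> X / 1600" using 1 2 3 X by linarith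
  also have "\<dots> = (g / (40 * \<rho> * \<iota>))\<^sup>2" by (simp add: X_def power_divide power_mult_distrib)
  finally show ?thesis using g rho_pos \<iota> by (auto dest: power2_le_imp_le)
qed

text \<open>Both paths remain in the ball of radius \<open>S\<close>, so their distance never
  exceeds \<open>2 * S\<close>. A larger \<open>d\<close> would be amplified beyond that by the
  negative curvature along \<open>v\<close>.\<close>

lemma stuck_pair_close:
  assumes g: "0 < g" "g \<le> L" and \<iota>: "16 \<le> \<iota>" "256 * \<iota>\<^sup>2 \<le> 2 powr \<iota>"
    and r: "r = g\<^sup>2 / \<rho> / (400 * \<iota> ^ 3)" and e: "e = g\<^sup>2 / \<rho> * (2 powr (- \<iota>))\<^sup>2"
    and N: "real N \<le> \<iota> * L / g + 1" "\<iota> * L / g < real N"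
    and z: "\<And>t. t < N \<Longrightarrow> z (Suc t) = z t - (1 / L) *\<^sub>R s t"
    and z': "\<And>t. t < N \<Longrightarrow> z' (Suc t) = z' t - (1 / L) *\<^sub>R s' t"
    and z0: "z 0 = c" "z' 0 = c"
    and e0: "norm (s 0 - G c) \<le> r + e" "norm (s' 0 - G c) \<le> r + e"
    and e1: "\<And>t. 1 \<le> t \<Longrightarrow> t < N \<Longrightarrow> norm (s t - G (z t)) \<le> e"
    and e1': "\<And>t. 1 \<le> t \<Longrightarrow> t < N \<Longrightarrow> norm (s' t - G (z' t)) \<le> e"
    and stuck: "\<Phi> c - g ^ 3 / (8000 * \<rho>\<^sup>2 * \<iota> ^ 3) \<le> \<Phi> (z N)" "\<Phi> c - g ^ 3 / (8000 * \<rho>\<^sup>2 * \<iota> ^ 3) \<le> \<Phi> (z' N)"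
    and v: "norm v = 1" "H c v = - \<gamma> *\<^sub>R v" and min: "\<And>w. - \<gamma> * (norm w)\<^sup>2 \<le> H c w \<bullet> w"
    and \<gamma>: "g \<le> \<gamma>" and init: "s' 0 - s 0 = d *\<^sub>R v" and "0 \<le> d"
  shows "d \<le> L * g * 2 powr (- \<iota>) / (8 * \<rho> * \<iota>)"
proof (rule ccontr)
  define S where "S = g / (40 * \<rho> * \<iota>)"
  define p where "p = 2 powr (- \<iota>)"
  define b where "b = d / L"
  define m where "m = N - 1"
  define \<alpha> where "\<alpha> = 1 + \<gamma> / L"
  define \<sigma> where "\<sigma> = \<rho> * S / L"
  assume "\<not> ?thesis"
  \<comment> \<open>Dividing the negated bound by \<open>L\<close> gives
    \<open>g * p / (8 * \<rho> * \<iota>)\<close>, which is \<open>5 * p * S\<close>.\<close>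
  then have b: "5 * p * S < b" using L_pos rho_pos \<iota> by (simp add: b_def p_def S_def field_simps)
  have Npos: "1 \<le> N"
  proof -
    have "0 \<le> \<iota> * L / g" using g \<iota> L_pos by simp
    then show ?thesis using N(2) by linarith
  qed
  have S: "0 < S" using g rho_pos \<iota> by (simp add: S_def)
  have p: "0 < p" "p \<le> 1 / (4096 * \<iota>)" "p * 2 powr \<iota> = 1"
  proof -
    show "p * 2 powr \<iota> = 1" by (simp add: p_def flip: powr_add)
    have "256 * 16 * \<iota> \<le> 256 * \<iota>\<^sup>2" using \<iota> by (simp add: power2_eq_square)
    then have "4096 * \<iota> \<le> 2 powr \<iota>" using \<iota> by linarith
    then show "p \<le> 1 / (4096 * \<iota>)" using \<iota> by (simp add: p_def powr_minus inverse_eq_divide frac_le)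
  qed (simp add: p_def)
  have loc: "norm (z n - c) \<le> S" "norm (z' n - c) \<le> S" if "n \<le> N" for n
    unfolding S_def z0[symmetric]
    using stuck_path_localization[where z=z and s=s, OF g \<iota> r e N(1) z _ _ _ that]
      stuck_path_localization[where z=z' and s=s', OF g \<iota> r e N(1) z' _ _ _ that] e0 e1 e1' stuck z0 by auto
  have "0 < \<gamma>" using g \<gamma> by simp
  have e_nonneg: "0 \<le> e" using g rho_pos by (simp add: e)
  have b0: "0 \<le> b" using \<open>0 \<le> d\<close> L_pos by (simp add: b_def)
  have "z 1 - z' 1 = (1 / L) *\<^sub>R (s' 0 - s 0)"
    using z[of 0] z'[of 0] Npos z0 by (simp add: algebra_simps)
  then have init': "z 1 - z' 1 = b *\<^sub>R v" by (simp add: init b_def)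
  have "2 * b * \<alpha> ^ m - (\<alpha> + \<sigma>) ^ m * (b + 2 * e / \<gamma>) \<le> norm (z (Suc m) - z' (Suc m))"
    unfolding \<alpha>_def \<sigma>_def using Npos loc S e_nonneg \<open>0 < \<gamma>\<close> b0
    by (intro path_separation[where z=z and s=s and z'=z' and s'=s' and N=N and c=c and v=v] z z' e1 e1' v min init')
       (auto simp: m_def)
  also have "\<dots> \<le> 2 * S"
    using loc[of N] Npos norm_triangle_ineq4[of "z N - c" "z' N - c"] by (simp add: m_def)
  finally have sep: "2 * b * \<alpha> ^ m - (\<alpha> + \<sigma>) ^ m * (b + 2 * e / \<gamma>) \<le> 2 * S" .
  have \<alpha>: "1 \<le> \<alpha>" using \<open>0 < \<gamma>\<close> L_pos by (simp add: \<alpha>_def)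
  have \<sigma>: "0 \<le> \<sigma>" using S L_pos rho_pos by (simp add: \<sigma>_def)
  \<comment> \<open>The Hessian drift \<sigma> per step adds up to at most 1/40 over the
    \<open>m\<close> steps: this is what the radius \<open>S\<close> was chosen for.\<close>
  have "(\<alpha> + \<sigma>) ^ m \<le> \<alpha> ^ m * (103 / 100)"
  proof -
    have "\<alpha> + \<sigma> \<le> \<alpha> * (1 + \<sigma>)" using \<alpha> \<sigma> mult_right_mono[of 1 \<alpha> \<sigma>] by (simp add: algebra_simps)
    also have "\<dots> \<le> \<alpha> * exp \<sigma>" using \<alpha> by (intro mult_left_mono exp_ge_add_one_self) auto
    finally have "(\<alpha> + \<sigma>) ^ m \<le> (\<alpha> * exp \<sigma>) ^ m" using \<alpha> \<sigma> by (intro power_mono) auto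
    also have "\<dots> = \<alpha> ^ m * exp (real m * \<sigma>)" by (simp add: power_mult_distrib exp_of_nat_mult)
    also have "\<dots> \<le> \<alpha> ^ m * (103 / 100)"
    proof (intro mult_left_mono)
      have "real m * \<sigma> \<le> (\<iota> * L / g) * \<sigma>" using N(1) \<sigma> Npos by (intro mult_right_mono) (auto simp: m_def of_nat_diff)
      also have "\<dots> = 1 / 40" using g rho_pos L_pos \<iota> by (simp add: \<sigma>_def S_def field_simps)
      finally have "exp (real m * \<sigma>) \<le> exp (1 / 40)" by simp
      also have "\<dots> \<le> 1 + 1 / 40 + (1 / 40)\<^sup>2" by (rule exp_bound) auto
      finally show "exp (real m * \<sigma>) \<le> 103 / 100" by (simp add: power2_eq_square)
    qed (use \<alpha> in auto)
    finally show ?thesis .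
  qed
  \<comment> \<open>Here the second factor \<open>p\<close> in \<open>e\<close> is needed: the first
    one only matches the size of \<open>b\<close>.\<close>
  moreover have "2 * e / \<gamma> \<le> b / 100"
  proof -
    have "2 * e / \<gamma> \<le> 2 * e / g" using e_nonneg g \<gamma> by (intro divide_left_mono) auto
    also have "\<dots> = 2 * (g / \<rho> * p) * p" using g by (simp add: e p_def power2_eq_square)
    also have "\<dots> \<le> 2 * (g / \<rho> * p) * (1 / (4096 * \<iota>))" using p g rho_pos by (intro mult_left_mono) auto
    also have "\<dots> \<le> p * S / 20" using g rho_pos \<iota> p by (simp add: S_def field_simps)
    also have "\<dots> \<le> b / 100" using b by linarith
    finally show ?thesis .
  qed
  ultimately have "(\<alpha> + \<sigma>) ^ m * (b + 2 * e / \<gamma>) \<le> (\<alpha> ^ m * (103 / 100)) * (b + b / 100)"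
    using b0 \<alpha> \<sigma> e_nonneg \<open>0 < \<gamma>\<close> by (intro mult_mono) auto
  also have "\<dots> = 10403 / 10000 * (b * \<alpha> ^ m)" by simp
  finally have le: "(\<alpha> + \<sigma>) ^ m * (b + 2 * e / \<gamma>) \<le> 10403 / 10000 * (b * \<alpha> ^ m)" .
  \<comment> \<open>The factors 1.03 and 1.01 leave \<open>2 - 1.0403\<close> of the growth. Since
    \<open>\<alpha> ^ m\<close> turns \<open>b\<close> into more than \<open>5 / 2 * S\<close>, even
    0.95 of it exceeds \<open>2 * S\<close>.\<close>
  have 1: "95 / 100 * (b * \<alpha> ^ m) \<le> 2 * S"
  proof -
    have "2 * b * \<alpha> ^ m = 2 * (b * \<alpha> ^ m)" "0 \<le> b * \<alpha> ^ m" using b0 \<alpha> by simp_all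
    with sep le show ?thesis by linarith
  qed
  have gL: "0 \<le> g / L" "g / L \<le> 1" using g L_pos by auto
  \<comment> \<open>Only \<open>N - 1\<close> steps follow the perturbed one; as
    \<open>g / L\<close> is at most 1, this loses at most a factor 2.\<close>
  have "2 powr (\<iota> - 1) \<le> 2 powr (g / L * real m)"
  proof (rule powr_mono)
    have "\<iota> * L / g * (g / L) \<le> real N * (g / L)" using N(2) gL by (intro mult_right_mono) auto
    then have "\<iota> \<le> real N * (g / L)" using g L_pos by simp
    then show "\<iota> - 1 \<le> g / L * real m" using gL Npos by (simp add: m_def of_nat_diff algebra_simps)
  qed simp
  also have "\<dots> = (2 powr (g / L)) ^ m" by (simp add: powr_powr flip: powr_realpow)
  also have "\<dots> \<le> (1 + g / L) ^ m" using two_powr_le[OF gL] by (intro power_mono) auto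
  also have "\<dots> \<le> \<alpha> ^ m" using gL \<gamma> L_pos unfolding \<alpha>_def by (intro power_mono) (auto simp: divide_right_mono)
  finally have "2 powr \<iota> / 2 \<le> \<alpha> ^ m" by (simp add: powr_diff)
  then have "b * (2 powr \<iota> / 2) \<le> b * \<alpha> ^ m" using b0 by (rule mult_left_mono)
  moreover have "5 * p * S * (2 powr \<iota> / 2) < b * (2 powr \<iota> / 2)" using b by (intro mult_strict_right_mono) auto
  moreover have "5 * p * S * (2 powr \<iota> / 2) = 5 / 2 * S * (p * 2 powr \<iota>)" by simp
  ultimately show False using 1 S p(3) by simp
qed

end

section \<open>Thin sets in the ball\<close>

lemma card_int_interval_ge:
  fixes u v :: real
  assumes "u \<le> v" and "\<And>j::int. u \<le> real_of_int j \<Longrightarrow> real_of_int j \<le> v \<Longrightarrow> j \<in> J" and "finite J"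
  shows "v - u - 1 \<le> real (card {j \<in> J. u \<le> real_of_int j \<and> real_of_int j \<le> v})"
proof -
  have "{\<lceil>u\<rceil>..\<lfloor>v\<rfloor>} \<subseteq> {j \<in> J. u \<le> real_of_int j \<and> real_of_int j \<le> v}"
    using assms(2) by (auto simp: ceiling_le_iff le_floor_iff)
  then have "card {\<lceil>u\<rceil>..\<lfloor>v\<rfloor>} \<le> card {j \<in> J. u \<le> real_of_int j \<and> real_of_int j \<le> v}"
    using \<open>finite J\<close> by (intro card_mono) auto
  moreover have "v - u - 1 \<le> real (card {\<lceil>u\<rceil>..\<lfloor>v\<rfloor>})" by (simp, linarith)
  ultimately show ?thesis by linarith
qed

text \<open>For n at least 2, invert the inequality 1 + 1/(n-1) <= exp (1/(n-1)). It bounds the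
  square of the volume factor lost in \<open>measure_cylinder_le\<close>.\<close>

lemma exp_minus_one_le: "exp (- 1) \<le> (1 - 1 / real n) ^ (n - 1)" if "1 \<le> n"
proof (cases "n = 1")
  case False
  then have n: "2 \<le> n" using that by simp
  have "1 + 1 / (real n - 1) \<le> exp (1 / (real n - 1))" by (rule exp_ge_add_one_self)
  then have "inverse (exp (1 / (real n - 1))) \<le> inverse (1 + 1 / (real n - 1))"
    using n by (intro le_imp_inverse_le) (auto intro: add_pos_nonneg)
  also have "\<dots> = 1 - 1 / real n" using n by (simp add: field_simps)
  finally have "exp (- 1 / (real n - 1)) ^ (n - 1) \<le> (1 - 1 / real n) ^ (n - 1)"
    by (intro power_mono) (auto simp: exp_minus)
  also have "exp (- 1 / (real n - 1)) ^ (n - 1) = exp (- 1)"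
    using n by (simp add: of_nat_diff flip: exp_of_nat_mult)
  finally show ?thesis .
qed simp

text \<open>Each point of \<open>A\<close> is moved into the slab by every integer \<open>j\<close>
  in some interval of length \<open>2 * s / a\<close>, hence by at least
  \<open>2 * s / a - 1\<close> of them. Integrating this count and using translation invariance
  gives the sum of the volumes.\<close>

lemma measure_translates_in_slab_ge:
  fixes A :: "(real ^ 'n) set"
  assumes A: "A \<in> lmeasurable" "A \<subseteq> cball 0 r" and a: "0 < a" and s: "0 \<le> s"
    and J: "finite J" "\<And>j. \<bar>real_of_int j\<bar> * a \<le> s + r \<Longrightarrow> j \<in> J"
  shows "(2 * s / a - 1) * measure lebesgue A \<le>
    (\<Sum>j\<in>J. measure lebesgue ((\<lambda>x. (real_of_int j * a) *\<^sub>R axis k 1 + x) ` {x \<in> A. \<bar>x $ k + real_of_int j * a\<bar> \<le> s}))"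
proof -
  define B where "B j = {x \<in> A. \<bar>x $ k + real_of_int j * a\<bar> \<le> s}" for j
  have B: "B j \<in> lmeasurable" for j
  proof -
    have "closed {x::real ^ 'n. \<bar>x $ k + real_of_int j * a\<bar> \<le> s}"
      by (intro closed_Collect_le continuous_intros)
    then have "A \<inter> {x. \<bar>x $ k + real_of_int j * a\<bar> \<le> s} \<in> lmeasurable"
      using A(1) by (intro fmeasurable_Int_fmeasurable) (auto simp: borel_closed)
    moreover have "B j = A \<inter> {x. \<bar>x $ k + real_of_int j * a\<bar> \<le> s}" by (auto simp: B_def)
    ultimately show ?thesis by simp
  qed
  have fin: "B j \<in> sets lebesgue" "emeasure lebesgue (B j) < \<infinity>" for j
    using B[of j] by (auto simp: fmeasurable_def simp del: emeasure_completion)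
  have finA: "A \<in> sets lebesgue" "emeasure lebesgue A < \<infinity>"
    using A(1) by (auto simp: fmeasurable_def simp del: emeasure_completion)
  have int: "integrable lebesgue (\<lambda>x. \<Sum>j\<in>J. indicat_real (B j) x)" "integrable lebesgue (indicat_real A)"
    by (intro Bochner_Integration.integrable_sum integrable_real_indicator fin finA)+
  have pt: "(2 * s / a - 1) * indicat_real A x \<le> (\<Sum>j\<in>J. indicat_real (B j) x)" for x
  proof (cases "x \<in> A")
    case True
    let ?u = "(- s - x $ k) / a" and ?v = "(s - x $ k) / a"
    have xk: "\<bar>x $ k\<bar> \<le> r" using True A(2) component_le_norm_cart[of x k] by (force simp: dist_norm)
    have in_B: "x \<in> B j \<longleftrightarrow> ?u \<le> real_of_int j \<and> real_of_int j \<le> ?v" for j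
      using True a by (auto simp: B_def field_simps abs_le_iff)
    have "?v - ?u - 1 \<le> real (card {j \<in> J. ?u \<le> real_of_int j \<and> real_of_int j \<le> ?v})"
    proof (rule card_int_interval_ge)
      show "?u \<le> ?v" using a s by (simp add: divide_right_mono)
      fix j :: int assume "?u \<le> real_of_int j" "real_of_int j \<le> ?v"
      then have "\<bar>x $ k + real_of_int j * a\<bar> \<le> s" using in_B[of j] by (simp add: B_def)
      then have "\<bar>real_of_int j * a\<bar> \<le> s + r" using xk by linarith
      then show "j \<in> J" using a by (intro J(2)) (simp add: abs_mult)
    qed fact
    moreover have "?v - ?u - 1 = 2 * s / a - 1" using a by (simp add: field_simps)
    moreover have "real (card {j \<in> J. ?u \<le> real_of_int j \<and> real_of_int j \<le> ?v}) = (\<Sum>j\<in>J. indicat_real (B j) x)"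
    proof -
      have "(\<Sum>j\<in>J. indicat_real (B j) x) = (\<Sum>j\<in>J. if x \<in> B j then 1 else 0)"
        by (intro sum.cong) (auto simp: indicator_def)
      also have "\<dots> = (\<Sum>j\<in>{j \<in> J. x \<in> B j}. 1)" by (rule sum.inter_filter[OF J(1), symmetric])
      finally show ?thesis unfolding in_B by simp
    qed
    ultimately show ?thesis using True by simp
  qed (auto intro: sum_nonneg)
  have "(2 * s / a - 1) * measure lebesgue A = (LINT x|lebesgue. (2 * s / a - 1) * indicat_real A x)"
    using A by simp
  also have "\<dots> \<le> (LINT x|lebesgue. (\<Sum>j\<in>J. indicat_real (B j) x))"
    using int pt by (intro integral_mono) auto
  also have "\<dots> = (\<Sum>j\<in>J. measure lebesgue (B j))"
    by (subst Bochner_Integration.integral_sum) (auto intro!: integrable_real_indicator fin simp del: emeasure_completion)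
  also have "\<dots> = (\<Sum>j\<in>J. measure lebesgue ((\<lambda>x. (real_of_int j * a) *\<^sub>R axis k 1 + x) ` B j))"
    by (simp only: measure_translation)
  finally show ?thesis by (simp add: B_def)
qed

text \<open>Shrinking the directions orthogonal to the axis maps a cylinder into the ball and loses only
  the constant factor \<open>exp (- 1 / 2)\<close> in volume.\<close>

lemma measure_cylinder_le:
  fixes U :: "(real ^ 'n) set"
  assumes U: "U \<in> lmeasurable"
    and sub: "\<And>x. x \<in> U \<Longrightarrow> \<bar>x $ k\<bar> \<le> r / sqrt CARD('n) \<and> norm (x - (x $ k) *\<^sub>R axis k 1) \<le> r"
  shows "exp (- 1 / 2) * measure lebesgue U \<le> measure lebesgue (cball (0 :: real ^ 'n) r)"
proof (cases "0 \<le> r")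
  case r: True
  let ?n = "CARD('n)"
  \<comment> \<open>The coordinate \<open>k\<close> uses up at most \<open>r\<^sup>2 / n\<close> of
    the squared radius; \<open>c\<close> scales the other directions to fit into the rest.\<close>
  define c where "c = sqrt (1 - 1 / real ?n)"
  define m where "m i = (if i = k then 1 else c)" for i :: 'n
  have n: "1 \<le> ?n" by (simp add: Suc_le_eq)
  then have c: "0 \<le> c" "c\<^sup>2 = 1 - 1 / real ?n" by (auto simp: c_def)
  have "prod m UNIV = c ^ (?n - 1)"
    unfolding m_def by (subst prod.remove[of _ k]) (auto simp: card_Diff_singleton)
  moreover have "exp (- 1 / 2) \<le> c ^ (?n - 1)"
  proof (rule power2_le_imp_le)
    have "(exp (- 1 / 2))\<^sup>2 = exp (- 1 :: real)" by (simp flip: exp_double)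
    also have "\<dots> \<le> (c\<^sup>2) ^ (?n - 1)" using exp_minus_one_le[OF n] by (simp add: c)
    finally show "(exp (- 1 / 2))\<^sup>2 \<le> (c ^ (?n - 1))\<^sup>2" by (simp add: power_mult[symmetric] mult.commute)
  qed (use c in auto)
  ultimately have "exp (- 1 / 2) * measure lebesgue U \<le> \<bar>prod m UNIV\<bar> * measure lebesgue U"
    by (intro mult_right_mono) auto
  also have "\<dots> = measure lebesgue ((\<lambda>x. \<chi> i. m i * x $ i) ` U)" by (rule measure_stretch[OF U, symmetric])
  also have "\<dots> \<le> measure lebesgue (cball (0 :: real ^ 'n) r)"
  proof (rule measure_mono_fmeasurable)
    show "(\<lambda>x. \<chi> i. m i * x $ i) ` U \<subseteq> cball 0 r"
    proof (rule image_subsetI)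
      fix x assume "x \<in> U"
      let ?y = "x - (x $ k) *\<^sub>R axis k 1"
      have x: "\<bar>x $ k\<bar> \<le> r / sqrt ?n" "norm ?y \<le> r" using sub[OF \<open>x \<in> U\<close>] by auto
      have "(x $ k)\<^sup>2 \<le> (r / sqrt ?n)\<^sup>2" using power_mono[OF x(1), of 2] by simp
      moreover have "c\<^sup>2 * (norm ?y)\<^sup>2 \<le> c\<^sup>2 * r\<^sup>2" using x(2) by (intro mult_left_mono power_mono) auto
      moreover have "(norm ((\<chi> i. m i * x $ i) :: real ^ 'n))\<^sup>2 = (x $ k)\<^sup>2 + c\<^sup>2 * (norm ?y)\<^sup>2"
      proof -
        have "(norm ((\<chi> i. m i * x $ i) :: real ^ 'n))\<^sup>2 = (x $ k)\<^sup>2 + (\<Sum>i\<in>UNIV - {k}. (c * x $ i)\<^sup>2)"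
          unfolding power2_norm_eq_inner inner_vec_def
          by (subst sum.remove[of _ k]) (auto simp: m_def power2_eq_square intro!: sum.cong)
        moreover have "(norm ?y)\<^sup>2 = (\<Sum>i\<in>UNIV - {k}. (x $ i)\<^sup>2)"
          unfolding power2_norm_eq_inner inner_vec_def
          by (subst sum.remove[of _ k]) (auto simp: axis_def power2_eq_square intro!: sum.cong)
        ultimately show ?thesis by (simp add: sum_distrib_left power_mult_distrib)
      qed
      ultimately have "(norm ((\<chi> i. m i * x $ i) :: real ^ 'n))\<^sup>2 \<le> (r / sqrt ?n)\<^sup>2 + c\<^sup>2 * r\<^sup>2" by linarith
      also have "\<dots> = r\<^sup>2" by (simp add: c power_divide algebra_simps)
      finally show "(\<chi> i. m i * x $ i) \<in> cball (0 :: real ^ 'n) r"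
        using r by (auto simp: dist_norm dest: power2_le_imp_le)
    qed
  qed (use U measurable_stretch[OF U] in \<open>auto simp: fmeasurableD\<close>)
  finally show ?thesis .
next
  case False
  then have "U = {}" using sub norm_ge_zero by (metis equals0I order_trans)
  then show ?thesis by simp
qed

text \<open>A packing argument. Thinness makes the translates of \<open>A\<close> by multiples of
  \<open>a\<close> along the axis disjoint. Cut off at height \<open>s\<close>, they lie in a
  cylinder of half-height \<open>r / sqrt n\<close>, whose volume is comparable to that of the
  ball.\<close>

lemma measure_thin_set_axis:
  fixes A :: "(real ^ 'n) set"
  assumes A: "A \<in> lmeasurable" "A \<subseteq> cball 0 r" and "0 < r" "0 < a"
    and thin: "\<And>x y d. x \<in> A \<Longrightarrow> y \<in> A \<Longrightarrow> 0 \<le> d \<Longrightarrow> y - x = d *\<^sub>R axis k 1 \<Longrightarrow> d < a"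
  shows "exp (- 1 / 2) * (2 * r / (sqrt CARD('n) * a) - 1) * measure lebesgue A \<le> measure lebesgue (cball (0 :: real ^ 'n) r)"
proof -
  define s where "s = r / sqrt CARD('n)"
  have s: "0 < s" using \<open>0 < r\<close> by (simp add: s_def)
  define J where "J = {- \<lceil>(s + r) / a\<rceil>..\<lceil>(s + r) / a\<rceil>}"
  have J: "j \<in> J" if "\<bar>real_of_int j\<bar> * a \<le> s + r" for j
  proof -
    have "\<bar>real_of_int j\<bar> \<le> (s + r) / a" using that \<open>0 < a\<close> by (simp add: field_simps)
    then have "\<bar>j\<bar> \<le> \<lceil>(s + r) / a\<rceil>" by linarith
    then show ?thesis by (auto simp: J_def)
  qed
  define C where "C j = (\<lambda>x. (real_of_int j * a) *\<^sub>R axis k 1 + x) ` {x \<in> A. \<bar>x $ k + real_of_int j * a\<bar> \<le> s}" for j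
  have C: "C j \<in> lmeasurable" for j
  proof -
    have "closed {x::real ^ 'n. \<bar>x $ k + real_of_int j * a\<bar> \<le> s}"
      by (intro closed_Collect_le continuous_intros)
    then have "A \<inter> {x. \<bar>x $ k + real_of_int j * a\<bar> \<le> s} \<in> lmeasurable"
      using A(1) by (intro fmeasurable_Int_fmeasurable) (auto simp: borel_closed)
    moreover have "{x \<in> A. \<bar>x $ k + real_of_int j * a\<bar> \<le> s} = A \<inter> {x. \<bar>x $ k + real_of_int j * a\<bar> \<le> s}" by auto
    ultimately have "{x \<in> A. \<bar>x $ k + real_of_int j * a\<bar> \<le> s} \<in> lmeasurable" by simp
    then show ?thesis unfolding C_def by (rule measurable_translation)
  qed
  have disj: "disjoint_family_on C J"
    unfolding disjoint_family_on_def
  proof (intro ballI impI)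
    have aux: False if "i < j" "z \<in> C i" "z \<in> C j" for i j z
    proof -
      obtain x where x: "x \<in> A" "z = (real_of_int i * a) *\<^sub>R axis k 1 + x"
        using \<open>z \<in> C i\<close> unfolding C_def by blast
      obtain y where y: "y \<in> A" "z = (real_of_int j * a) *\<^sub>R axis k 1 + y"
        using \<open>z \<in> C j\<close> unfolding C_def by blast
      have "x - y = ((real_of_int j - real_of_int i) * a) *\<^sub>R axis k 1"
        using x(2) y(2) by (simp add: algebra_simps)
      moreover have "1 * a \<le> (real_of_int j - real_of_int i) * a"
        using \<open>i < j\<close> \<open>0 < a\<close> by (intro mult_right_mono) auto
      ultimately show False using thin[OF y(1) x(1), of "(real_of_int j - real_of_int i) * a"] \<open>0 < a\<close> by simp
    qed
    fix i j :: int assume "i \<noteq> j"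
    then show "C i \<inter> C j = {}" using aux[of i j] aux[of j i] by (cases "i < j") auto
  qed
  define U where "U = (\<Union>j\<in>J. C j)"
  have "(2 * s / a - 1) * measure lebesgue A \<le> (\<Sum>j\<in>J. measure lebesgue (C j))"
    unfolding C_def using s \<open>0 < a\<close> A J by (intro measure_translates_in_slab_ge[where r=r]) (auto simp: J_def)
  also have "\<dots> = measure lebesgue U"
  proof -
    have "C j \<in> sets lebesgue" "emeasure lebesgue (C j) \<noteq> \<infinity>" for j
      using C[of j] by (auto simp: fmeasurable_def simp del: emeasure_completion)
    then show ?thesis unfolding U_def using disj
      by (intro measure_finite_Union[symmetric]) (auto simp: J_def simp del: emeasure_completion)
  qed
  finally have "exp (- 1 / 2) * ((2 * s / a - 1) * measure lebesgue A) \<le> exp (- 1 / 2) * measure lebesgue U"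
    by (intro mult_left_mono) auto
  also have "\<dots> \<le> measure lebesgue (cball (0 :: real ^ 'n) r)"
  proof (rule measure_cylinder_le)
    show "U \<in> lmeasurable" unfolding U_def using C by (intro fmeasurable.finite_UN) (auto simp: J_def)
    fix z assume "z \<in> U"
    then obtain j x where z: "z = (real_of_int j * a) *\<^sub>R axis k 1 + x" "x \<in> A" "\<bar>x $ k + real_of_int j * a\<bar> \<le> s"
      by (auto simp: U_def C_def)
    have zk: "z $ k = x $ k + real_of_int j * a" by (simp add: z axis_def)
    have zx: "z - (z $ k) *\<^sub>R axis k 1 = x - (x $ k) *\<^sub>R axis k 1" unfolding zk by (simp add: z algebra_simps)
    have "norm (x - (x $ k) *\<^sub>R axis k 1) \<le> norm x"
      by (rule norm_le_componentwise_cart) (auto simp: axis_def)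
    moreover have "norm x \<le> r" using z A by auto
    ultimately have "norm (z - (z $ k) *\<^sub>R axis k 1) \<le> r" unfolding zx by linarith
    moreover have "\<bar>z $ k\<bar> \<le> r / sqrt CARD('n)" using z(3) unfolding zk s_def .
    ultimately show "\<bar>z $ k\<bar> \<le> r / sqrt CARD('n) \<and> norm (z - (z $ k) *\<^sub>R axis k 1) \<le> r" by blast
  qed
  finally show ?thesis by (simp add: s_def mult.assoc)
qed

text \<open>The library proves that orthogonal transformations preserve Lebesgue measure only for index
  types of class \<open>wellorder\<close>.  In general, a Vitali covering by balls reduces the claim for open sets
  to balls, which are mapped to balls.\<close>

lemma emeasure_orthogonal_image_open_le:
  fixes f :: "'a::euclidean_space \<Rightarrow> 'a"
  assumes f: "orthogonal_transformation f" and "open U"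
  shows "emeasure lborel (f ` U) \<le> emeasure lborel U"
proof -
  define K where "K = {(x, s). 0 < s \<and> ball x s \<subseteq> U}"
  have "\<exists>i. i \<in> K \<and> x \<in> ball (fst i) (snd i) \<and> snd i < d" if x: "x \<in> U" "0 < d" for x d
  proof -
    obtain s where "0 < s" "ball x s \<subseteq> U" using \<open>open U\<close> x(1) open_contains_ball by blast
    then have "(x, min s (d / 2)) \<in> K" using x(2) by (auto simp: K_def)
    then show ?thesis using x(2) \<open>0 < s\<close> by (intro exI[of _ "(x, min s (d / 2))"]) auto
  qed
  then obtain C where C: "countable C" "C \<subseteq> K"
    and disj: "pairwise (\<lambda>i j. disjnt (ball (fst i) (snd i)) (ball (fst j) (snd j))) C"
    and neg: "negligible (U - (\<Union>i\<in>C. ball (fst i) (snd i)))"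
    by (rule Vitali_covering_theorem_balls[of U K fst snd]) auto
  have lin: "linear f" and inj: "inj f"
    using f by (auto intro: orthogonal_transformation_linear orthogonal_transformation_inj)
  have f_ball: "f ` ball x s = ball (f x) s" for x s using image_orthogonal_transformation_ball[OF f] .
  have f_open: "open (f ` U)" using \<open>open U\<close> lin inj by (simp add: open_bijective_linear_image_eq orthogonal_transformation_bij[OF f])
  let ?B = "\<Union>i\<in>C. ball (fst i) (snd i)"
  have "negligible (f ` (U - ?B))"
    by (rule negligible_differentiable_image_negligible[OF order_refl neg])
      (intro linear_imp_differentiable_on lin)
  then have "f ` (U - ?B) \<in> null_sets lebesgue" by (simp add: negligible_iff_null_sets)
  then have null: "emeasure lebesgue (f ` (U - ?B)) = 0" "f ` (U - ?B) \<in> sets lebesgue" by auto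
  have disj': "disjoint_family_on (\<lambda>i. ball (fst i) (snd i)) C"
    using disj by (auto simp: disjoint_family_on_def pairwise_def disjnt_def)
  have "disjoint_family_on (\<lambda>i. f ` ball (fst i) (snd i)) C"
    using disj' unfolding disjoint_family_on_def by (simp flip: image_Int[OF inj])
  then have disj'': "disjoint_family_on (\<lambda>i. ball (f (fst i)) (snd i)) C" by (simp add: f_ball)
  have B_borel: "(\<Union>i\<in>C. ball (f (fst i)) (snd i)) \<in> sets borel" by (intro borel_open open_UN) auto
  have "emeasure lborel (f ` U) = emeasure lebesgue (f ` U)" using f_open by (simp add: borel_open)
  also have "\<dots> \<le> emeasure lebesgue (f ` (U - ?B) \<union> (\<Union>i\<in>C. ball (f (fst i)) (snd i)))"
  proof (rule emeasure_mono)
    show "f ` U \<subseteq> f ` (U - ?B) \<union> (\<Union>i\<in>C. ball (f (fst i)) (snd i))"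
      by (auto simp flip: f_ball)
  qed (use null(2) B_borel in \<open>auto intro!: sets.Un\<close>)
  also have "\<dots> \<le> emeasure lebesgue (f ` (U - ?B)) + emeasure lebesgue (\<Union>i\<in>C. ball (f (fst i)) (snd i))"
    using null(2) B_borel by (intro emeasure_subadditive) auto
  also have "\<dots> = emeasure lborel (\<Union>i\<in>C. ball (f (fst i)) (snd i))"
    using null(1) B_borel by simp
  also have "\<dots> = (\<integral>\<^sup>+i. emeasure lborel (ball (f (fst i)) (snd i)) \<partial>count_space C)"
    using C disj'' by (intro emeasure_UN_countable) auto
  also have "\<dots> = (\<integral>\<^sup>+i. emeasure lborel (ball (fst i) (snd i)) \<partial>count_space C)"
    using C(2) by (intro nn_integral_cong) (auto simp: K_def emeasure_ball)
  also have "\<dots> = emeasure lborel ?B"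
    using C disj' by (intro emeasure_UN_countable[symmetric]) auto
  also have "\<dots> \<le> emeasure lborel U"
  proof (rule emeasure_mono)
    show "?B \<subseteq> U" using C(2) unfolding K_def by fastforce
  qed (use \<open>open U\<close> in auto)
  finally show ?thesis .
qed

text \<open>Outer regularity passes from open sets to Borel sets. Equality then follows by applying
  the inequality to the inverse map as well.\<close>

lemma emeasure_orthogonal_image_le:
  fixes f :: "'a::euclidean_space \<Rightarrow> 'a"
  assumes f: "orthogonal_transformation f" and A: "A \<in> sets borel"
  shows "emeasure lborel (f ` A) \<le> emeasure lborel A"
proof (rule ennreal_le_epsilon)
  fix e :: real assume "0 < e"
  obtain U where U: "open U" "A \<subseteq> U" "emeasure lborel (U - A) < ennreal e"
    using outer_regular_lborel[OF A \<open>0 < e\<close>] by blast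
  have f_open: "open (f ` U)"
    using U(1) by (simp add: open_bijective_linear_image_eq orthogonal_transformation_bij[OF f] orthogonal_transformation_linear[OF f])
  have "emeasure lborel (f ` A) \<le> emeasure lborel (f ` U)"
    using U(2) f_open by (intro emeasure_mono image_mono) (auto intro: borel_open)
  also have "\<dots> \<le> emeasure lborel U" by (rule emeasure_orthogonal_image_open_le[OF f U(1)])
  also have "\<dots> = emeasure lborel (A \<union> (U - A))" using U(2) by (simp add: Un_absorb1)
  also have "\<dots> \<le> emeasure lborel A + emeasure lborel (U - A)"
    using A U(1) by (intro emeasure_subadditive) (auto intro: borel_open)
  also have "\<dots> \<le> emeasure lborel A + ennreal e" using U(3) by (intro add_left_mono) auto
  finally show "emeasure lborel (f ` A) \<le> emeasure lborel A + ennreal e" .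
qed

lemma
  fixes f :: "'a::euclidean_space \<Rightarrow> 'a"
  assumes f: "orthogonal_transformation f" and A: "A \<in> sets borel"
  shows borel_orthogonal_image: "f ` A \<in> sets borel"
    and emeasure_orthogonal_image: "emeasure lborel (f ` A) = emeasure lborel A"
proof -
  have g: "orthogonal_transformation (inv f)" by (rule orthogonal_transformation_inv[OF f])
  have bij: "bij f" by (rule orthogonal_transformation_bij[OF f])
  have "inv f \<in> borel_measurable borel"
    by (intro borel_measurable_continuous_onI linear_continuous_on linear_conv_bounded_linear[THEN iffD1]
        orthogonal_transformation_linear[OF g])
  then have "inv f -` A \<in> sets borel" using A measurable_sets[of "inv f" borel borel A] by simp
  moreover have "inv f -` A = f ` A"
    using bij_vimage_eq_inv_image[OF bij_imp_bij_inv[OF bij], of A] by (simp add: inv_inv_eq[OF bij])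
  ultimately show fA: "f ` A \<in> sets borel" by simp
  have "inv f ` f ` A = A" using bij by (simp add: image_comp bij_is_inj inv_o_cancel)
  then show "emeasure lborel (f ` A) = emeasure lborel A"
    using emeasure_orthogonal_image_le[OF f A] emeasure_orthogonal_image_le[OF g fA] by simp
qed

text \<open>An orthogonal map takes \<open>v\<close> to a coordinate axis; it preserves the ball,
  thinness and volume.\<close>

lemma measure_thin_set:
  fixes A :: "(real ^ 'n) set"
  assumes A: "A \<in> sets borel" "A \<subseteq> cball 0 r" and "0 < r" "0 < a" and v: "norm v = 1"
    and thin: "\<And>x y d. x \<in> A \<Longrightarrow> y \<in> A \<Longrightarrow> 0 \<le> d \<Longrightarrow> y - x = d *\<^sub>R v \<Longrightarrow> d < a"
  shows "exp (- 1 / 2) * (2 * r / (sqrt CARD('n) * a) - 1) * measure lborel A \<le> measure lborel (cball (0 :: real ^ 'n) r)"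
proof -
  fix k :: 'n
  have "norm (axis k 1 :: real ^ 'n) = 1" by simp
  then obtain f :: "real ^ 'n \<Rightarrow> real ^ 'n" where f: "orthogonal_transformation f" "f v = axis k 1"
    by (rule orthogonal_transformation_exists_1[OF v])
  have lin: "linear f" using f(1) by (rule orthogonal_transformation_linear)
  have fA: "f ` A \<in> sets borel" using f(1) A(1) by (rule borel_orthogonal_image)
  have sub: "f ` A \<subseteq> cball 0 r" using A(2) f(1) by (auto simp: orthogonal_transformation_norm)
  have "exp (- 1 / 2) * (2 * r / (sqrt CARD('n) * a) - 1) * measure lebesgue (f ` A) \<le> measure lebesgue (cball (0 :: real ^ 'n) r)"
  proof (rule measure_thin_set_axis)
    show "f ` A \<in> lmeasurable"
      using fA bounded_subset[OF bounded_cball sub] by (intro bounded_set_imp_lmeasurable) auto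
    show "f ` A \<subseteq> cball 0 r" by (rule sub)
    fix x y d assume "x \<in> f ` A" "y \<in> f ` A" "0 \<le> d" and eq: "y - x = d *\<^sub>R axis k 1"
    then obtain x' y' where x': "x' \<in> A" "x = f x'" and y': "y' \<in> A" "y = f y'" by auto
    have "f (y' - x') = f (d *\<^sub>R v)" using eq x' y' f(2) by (simp add: linear_diff[OF lin] linear_cmul[OF lin])
    then have "y' - x' = d *\<^sub>R v" using orthogonal_transformation_inj[OF f(1)] by (simp add: inj_eq)
    then show "d < a" using thin x'(1) y'(1) \<open>0 \<le> d\<close> by blast
  qed fact+
  moreover have "measure lebesgue (f ` A) = measure lborel A"
    using fA emeasure_orthogonal_image[OF f(1) A(1)] by (simp add: measure_def)
  ultimately show ?thesis by simp
qed

section \<open>The maximum function of a strongly concave problem\<close>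

text \<open>The correction \<open>d * t\<close> vanishes in the limit of one-sided difference
  quotients. It absorbs the factor \<open>1 - t\<close> of strong concavity.\<close>

lemma has_real_derivative_ge_of_difference:
  assumes "DERIV \<psi> 0 :> D" and ge: "\<And>t::real. 0 < t \<Longrightarrow> t \<le> 1 \<Longrightarrow> t * (c - d * t) \<le> \<psi> t - \<psi> 0"
  shows "c \<le> D"
proof (rule tendsto_le)
  show "((\<lambda>t. (\<psi> t - \<psi> 0) / t) \<longlongrightarrow> D) (at_right 0)"
    using assms(1) by (auto simp: has_field_derivative_iff intro: filterlim_at_split[THEN iffD1, THEN conjunct2])
  have "((\<lambda>t. c - d * t) \<longlongrightarrow> c - d * 0) (at_right 0)" by (intro tendsto_intros)
  then show "((\<lambda>t. c - d * t) \<longlongrightarrow> c) (at_right 0)" by simp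
  have "eventually (\<lambda>t. t \<in> {0<..<1}) (at_right (0::real))" by (rule eventually_at_right_real) simp
  then show "\<forall>\<^sub>F t in at_right 0. c - d * t \<le> (\<psi> t - \<psi> 0) / t"
    by eventually_elim (use ge in \<open>auto simp: field_simps\<close>)
qed simp

text \<open>\<open>grad\<close> is a definite description; the Riesz vector of the derivative shows
  that it denotes.\<close>

lemma has_derivative_grad:
  fixes f :: "'a::euclidean_space \<Rightarrow> real"
  assumes "f differentiable (at z)"
  shows "(f has_derivative (\<lambda>h. grad f z \<bullet> h)) (at z)"
proof -
  obtain D where D: "(f has_derivative D) (at z)" using assms by (auto simp: differentiable_def)
  then have lin: "linear D" by (rule has_derivative_linear)
  define d where "d = (\<Sum>b\<in>Basis. D b *\<^sub>R b)"
  have "D h = d \<bullet> h" for h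
  proof -
    have "D h = D (\<Sum>b\<in>Basis. (h \<bullet> b) *\<^sub>R b)" by (simp add: euclidean_representation)
    also have "\<dots> = (\<Sum>b\<in>Basis. (h \<bullet> b) * D b)" by (simp add: linear_sum[OF lin] linear_cmul[OF lin])
    also have "\<dots> = d \<bullet> h" unfolding d_def inner_sum_left by (simp add: inner_commute mult.commute)
    finally show ?thesis .
  qed
  then have "D = (\<lambda>h. d \<bullet> h)" by auto
  with D show ?thesis using grad_eqI by metis
qed

lemma norm_fst_le_norm: "norm (fst p) \<le> norm p"
  using norm_fst_le[of "fst p" "snd p"] by simp

lemma norm_snd_le_norm: "norm (snd p) \<le> norm p"
  using norm_snd_le[of "snd p" "fst p"] by simp

lemma jacobian_apply:
  assumes "(f has_derivative D) (at x)"
  shows "jacobian f x v = D v"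
proof -
  have "(f has_derivative blinfun_apply (jacobian f x)) (at x)"
    using assms by (intro has_derivative_jacobian differentiableI)
  from has_derivative_unique[OF this assms] show ?thesis by simp
qed

locale strongly_concave_problem =
  fixes f :: "'a::euclidean_space \<times> 'b::euclidean_space \<Rightarrow> real" and \<mu> l \<rho> :: real
  assumes mu_pos: "0 < \<mu>" and l_pos: "0 < l" and rho_pos: "0 < \<rho>"
    and twice: "twice_differentiable f"
    and concave: "\<And>x. strongly_concave \<mu> (\<lambda>y. f (x, y))"
    and lip: "l-lipschitz_on UNIV (grad f)"
    and xx: "\<rho>-lipschitz_on UNIV (hess_xx f)"
    and xy: "\<rho>-lipschitz_on UNIV (hess_xy f)"
    and yy: "\<rho>-lipschitz_on UNIV (hess_yy f)"
begin

text \<open>The joint Hessian in both variables. The block Hessians of the hypotheses are its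
  components, see \<open>hess_xx_apply\<close> and its companions.\<close>

definition "J = jacobian (grad f)"

lemma f_deriv: "(f has_derivative (\<lambda>h. grad f z \<bullet> h)) (at z)"
  using twice has_derivative_grad unfolding twice_differentiable_def by blast

lemma grad_deriv: "(grad f has_derivative blinfun_apply (J z)) (at z)"
  using twice has_derivative_jacobian unfolding twice_differentiable_def J_def by blast

lemma grad_lip: "norm (grad f z - grad f z') \<le> l * norm (z - z')"
  using lipschitz_onD[OF lip, of z z'] by (simp add: dist_norm)

lemma J_symmetric: "J z u \<bullet> v = u \<bullet> J z v"
  by (rule second_derivative_symmetric[OF f_deriv grad_deriv])

lemma J_norm_le: "norm (J z v) \<le> l * norm v"
  by (rule derivative_norm_le_of_lipschitz[OF grad_deriv grad_lip])

lemma grad_x_eq: "grad_x f x y = fst (grad f (x, y))"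
  unfolding grad_x_def
proof (rule grad_eqI)
  have "((\<lambda>x'. f (x', y)) has_derivative (\<lambda>h. grad f (x, y) \<bullet> (h, 0))) (at x)"
    by (intro has_derivative_compose[OF _ f_deriv] has_derivative_Pair has_derivative_ident has_derivative_const)
  then show "((\<lambda>x'. f (x', y)) has_derivative (\<lambda>h. fst (grad f (x, y)) \<bullet> h)) (at x)"
    by (simp add: inner_prod_def)
qed

lemma grad_y_eq: "grad_y f x y = snd (grad f (x, y))"
  unfolding grad_y_def
proof (rule grad_eqI)
  have "((\<lambda>y'. f (x, y')) has_derivative (\<lambda>h. grad f (x, y) \<bullet> (0, h))) (at y)"
    by (intro has_derivative_compose[OF _ f_deriv] has_derivative_Pair has_derivative_ident has_derivative_const)
  then show "((\<lambda>y'. f (x, y')) has_derivative (\<lambda>h. snd (grad f (x, y)) \<bullet> h)) (at y)"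
    by (simp add: inner_prod_def)
qed

lemma grad_y_deriv: "((\<lambda>y. grad_y f x y) has_derivative (\<lambda>w. snd (J (x, y) (0, w)))) (at y)"
  unfolding grad_y_eq
  by (intro has_derivative_snd has_derivative_compose[OF _ grad_deriv] has_derivative_Pair
      has_derivative_ident has_derivative_const)

lemma hess_xx_apply: "hess_xx f z v = fst (J z (v, 0))"
proof -
  have "((\<lambda>x. grad_x f x (snd z)) has_derivative (\<lambda>v. fst (J (fst z, snd z) (v, 0)))) (at (fst z))"
    unfolding grad_x_eq
    by (intro has_derivative_fst has_derivative_compose[OF _ grad_deriv] has_derivative_Pair
      has_derivative_ident has_derivative_const)
  from jacobian_apply[OF this] show ?thesis by (simp add: hess_xx_def)
qed

lemma hess_xy_apply: "hess_xy f z w = fst (J z (0, w))"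
proof -
  have "((\<lambda>y. grad_x f (fst z) y) has_derivative (\<lambda>w. fst (J (fst z, snd z) (0, w)))) (at (snd z))"
    unfolding grad_x_eq
    by (intro has_derivative_fst has_derivative_compose[OF _ grad_deriv] has_derivative_Pair
      has_derivative_ident has_derivative_const)
  from jacobian_apply[OF this] show ?thesis by (simp add: hess_xy_def)
qed

lemma hess_yy_apply: "hess_yy f z w = snd (J z (0, w))"
  using jacobian_apply[OF grad_y_deriv[of "fst z" "snd z"]] by (simp add: hess_yy_def)

text \<open>Divide the strong concavity inequality by \<open>t\<close> and let \<open>t\<close> tend
  to 0.\<close>

lemma concave_upper_bound:
  "f (x, v) \<le> f (x, u) + grad_y f x u \<bullet> (v - u) - \<mu> / 2 * (norm (u - v))\<^sup>2"
proof -
  define \<psi> where "\<psi> t = f (x, u + t *\<^sub>R (v - u))" for t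
  define m where "m = \<mu> / 2 * (norm (u - v))\<^sup>2"
  have "(\<psi> has_derivative (\<lambda>s. grad f (x, u + 0 *\<^sub>R (v - u)) \<bullet> (0, s *\<^sub>R (v - u)))) (at 0)"
    unfolding \<psi>_def
    by (intro has_derivative_compose[OF _ f_deriv]) (auto intro!: derivative_eq_intros)
  then have "DERIV \<psi> 0 :> grad_y f x u \<bullet> (v - u)"
    by (simp add: has_field_derivative_def grad_y_eq inner_prod_def mult_commute_abs)
  then have "f (x, v) - f (x, u) + m \<le> grad_y f x u \<bullet> (v - u)"
  proof (rule has_real_derivative_ge_of_difference)
    fix t :: real assume t: "0 < t" "t \<le> 1"
    have "(1 - t) *\<^sub>R u + t *\<^sub>R v = u + t *\<^sub>R (v - u)" by (simp add: algebra_simps)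
    moreover have "(1 - t) * f (x, u) + t * f (x, v) + \<mu> / 2 * t * (1 - t) * (norm (u - v))\<^sup>2
        \<le> f (x, (1 - t) *\<^sub>R u + t *\<^sub>R v)"
      using concave[of x] t unfolding strongly_concave_def by simp
    moreover have "\<mu> / 2 * t * (1 - t) * (norm (u - v))\<^sup>2 = t * (1 - t) * m" by (simp add: m_def)
    ultimately have "(1 - t) * f (x, u) + t * f (x, v) + t * (1 - t) * m \<le> \<psi> t" unfolding \<psi>_def by metis
    then show "t * (f (x, v) - f (x, u) + m - m * t) \<le> \<psi> t - \<psi> 0"
      by (simp add: \<psi>_def algebra_simps)
  qed
  then show ?thesis by (simp add: m_def)
qed

lemma grad_y_monotone: "\<mu> * (norm (u - v))\<^sup>2 \<le> (grad_y f x u - grad_y f x v) \<bullet> (v - u)"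
  using concave_upper_bound[of x v u] concave_upper_bound[of x u v]
  by (simp add: norm_minus_commute inner_diff_left inner_diff_right)

lemma J_yy_le: "snd (J z (0, w)) \<bullet> w \<le> - \<mu> * (norm w)\<^sup>2"
proof -
  obtain x y where z: "z = (x, y)" by (cases z)
  define \<psi> where "\<psi> t = - (grad_y f x (y + t *\<^sub>R w) \<bullet> w)" for t
  have "(\<psi> has_derivative (\<lambda>s. - (snd (J (x, y + 0 *\<^sub>R w) (0, s *\<^sub>R w)) \<bullet> w))) (at 0)"
    unfolding \<psi>_def
    by (intro has_derivative_minus has_derivative_inner_left has_derivative_compose[OF _ grad_y_deriv])
      (auto intro!: derivative_eq_intros)
  moreover have "snd (J (x, y) (0, s *\<^sub>R w)) = s *\<^sub>R snd (J (x, y) (0, w))" for s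
  proof -
    have "(0, s *\<^sub>R w) = s *\<^sub>R (0::'a, w)" by simp
    then show ?thesis by (simp only: blinfun.scaleR_right snd_scaleR)
  qed
  ultimately have "(\<psi> has_derivative (\<lambda>s. - (snd (J z (0, w)) \<bullet> w) * s)) (at 0)"
    by (simp add: z mult.commute)
  then have "DERIV \<psi> 0 :> - (snd (J z (0, w)) \<bullet> w)" unfolding has_field_derivative_def .
  then have "\<mu> * (norm w)\<^sup>2 \<le> - (snd (J z (0, w)) \<bullet> w)"
  proof (rule has_real_derivative_ge_of_difference[where d=0])
    fix t :: real assume t: "0 < t" "t \<le> 1"
    have "\<mu> * (t * norm w)\<^sup>2 \<le> (grad_y f x y - grad_y f x (y + t *\<^sub>R w)) \<bullet> (t *\<^sub>R w)"
      using grad_y_monotone[of y "y + t *\<^sub>R w" x] t by simp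
    then have "t * (t * (\<mu> * (norm w)\<^sup>2)) \<le> t * (\<psi> t - \<psi> 0)"
      by (simp add: \<psi>_def inner_diff_left power2_eq_square algebra_simps)
    then show "t * (\<mu> * (norm w)\<^sup>2 - 0 * t) \<le> \<psi> t - \<psi> 0" using t by (simp add: mult_le_cancel_left_pos)
  qed
  then show ?thesis by simp
qed

lemma J_yy_ge: "- l * (norm w)\<^sup>2 \<le> snd (J z (0, w)) \<bullet> w"
proof -
  have "\<bar>J z (0, w) \<bullet> (0, w)\<bar> \<le> norm (J z (0, w)) * norm (0::'a, w)" by (rule Cauchy_Schwarz_ineq2)
  also have "\<dots> \<le> l * norm (0::'a, w) * norm (0::'a, w)" by (intro mult_right_mono J_norm_le) simp
  finally show ?thesis by (simp add: inner_prod_def norm_Pair power2_eq_square abs_le_iff)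
qed

lemma mu_le_l: "\<mu> \<le> l"
proof -
  obtain b :: 'b where "b \<in> Basis" using nonempty_Basis by blast
  then show ?thesis using J_yy_le[of "(0, 0)" b] J_yy_ge[of b "(0, 0)"] by simp
qed

definition "\<kappa> = l / \<mu>"

lemma kappa_ge_1: "1 \<le> \<kappa>"
  using mu_le_l mu_pos by (simp add: \<kappa>_def)

definition "contr = 1 - \<mu> / l"

lemma contr: "0 \<le> contr" "contr < 1"
  using mu_le_l mu_pos l_pos by (auto simp: contr_def)

text \<open>The derivative of the ascent map, the identity plus \<open>1 / l\<close> times the
  Hessian in \<open>y\<close>, is symmetric with form between 0 and
  \<open>1 - \<mu> / l\<close>.\<close>

lemma ascent_contraction:
  "norm ((y + (1 / l) *\<^sub>R grad_y f x y) - (y' + (1 / l) *\<^sub>R grad_y f x y')) \<le> contr * norm (y - y')"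
proof (rule differentiable_bound[where S=UNIV and f="\<lambda>y. y + (1 / l) *\<^sub>R grad_y f x y"
      and f'="\<lambda>y w. w + (1 / l) *\<^sub>R snd (J (x, y) (0, w))"])
  fix y
  show "((\<lambda>y. y + (1 / l) *\<^sub>R grad_y f x y) has_derivative (\<lambda>w. w + (1 / l) *\<^sub>R snd (J (x, y) (0, w)))) (at y)"
    by (intro derivative_intros grad_y_deriv)
  then have lin: "linear (\<lambda>w. w + (1 / l) *\<^sub>R snd (J (x, y) (0, w)))" by (rule has_derivative_linear)
  show "onorm (\<lambda>w. w + (1 / l) *\<^sub>R snd (J (x, y) (0, w))) \<le> contr"
  proof (rule onorm_le, rule symmetric_norm_le_of_quadratic_form[OF lin])
    fix u v
    show "(u + (1 / l) *\<^sub>R snd (J (x, y) (0, u))) \<bullet> v = u \<bullet> (v + (1 / l) *\<^sub>R snd (J (x, y) (0, v)))"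
      using J_symmetric[of "(x, y)" "(0, u)" "(0, v)"] by (simp add: inner_prod_def algebra_simps)
    have "(v + (1 / l) *\<^sub>R snd (J (x, y) (0, v))) \<bullet> v = (norm v)\<^sup>2 + (snd (J (x, y) (0, v)) \<bullet> v) / l"
      by (simp add: inner_add_left dot_square_norm)
    moreover have "(snd (J (x, y) (0, v)) \<bullet> v) / l \<le> - (\<mu> / l) * (norm v)\<^sup>2"
      using divide_right_mono[OF J_yy_le[of "(x, y)" v], of l] l_pos by simp
    moreover have "- (norm v)\<^sup>2 \<le> (snd (J (x, y) (0, v)) \<bullet> v) / l"
      using divide_right_mono[OF J_yy_ge[of v "(x, y)"], of l] l_pos by simp
    ultimately show "\<bar>(v + (1 / l) *\<^sub>R snd (J (x, y) (0, v))) \<bullet> v\<bar> \<le> contr * (norm v)\<^sup>2"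
      by (simp add: contr_def algebra_simps)
  qed
qed auto

section \<open>The maximizer as a function of x\<close>

definition "ymax x = (THE y. grad_y f x y = 0)"

lemma grad_y_zero_unique: "grad_y f x u = 0 \<Longrightarrow> grad_y f x v = 0 \<Longrightarrow> u = v"
  using grad_y_monotone[of u v x] mu_pos by (simp add: mult_le_0_iff)

text \<open>Critical points are the fixed points of the ascent map, so the contraction that drives
  the inner loop also yields existence, by Banach's theorem.\<close>

lemma grad_y_ymax: "grad_y f x (ymax x) = 0"
proof -
  have "\<exists>!y. y \<in> UNIV \<and> y + (1 / l) *\<^sub>R grad_y f x y = y"
    by (rule Banach_fix[OF complete_UNIV _ contr]) (auto simp: dist_norm ascent_contraction)
  then obtain y where "y + (1 / l) *\<^sub>R grad_y f x y = y" by blast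
  then have "grad_y f x y = 0" using l_pos by simp
  then show ?thesis unfolding ymax_def by (rule theI) (rule grad_y_zero_unique[OF _ \<open>grad_y f x y = 0\<close>])
qed

lemma f_le_ymax: "f (x, y) \<le> f (x, ymax x) - \<mu> / 2 * (norm (ymax x - y))\<^sup>2"
  using concave_upper_bound[of x y "ymax x"] by (simp add: grad_y_ymax)

lemma max_value_eq: "max_value f x = f (x, ymax x)"
  unfolding max_value_def
proof (rule cSup_eq_maximum)
  fix v assume "v \<in> range (\<lambda>y. f (x, y))"
  then obtain y where "v = f (x, y)" by auto
  moreover have "0 \<le> \<mu> / 2 * (norm (ymax x - y))\<^sup>2" using mu_pos by simp
  ultimately show "v \<le> f (x, ymax x)" using f_le_ymax[of x y] by linarith
qed auto

lemma maximizer_eq_ymax: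
  assumes "\<And>y. f (x, y) \<le> f (x, y')" shows "y' = ymax x"
proof -
  have "\<mu> / 2 * (norm (ymax x - y'))\<^sup>2 \<le> 0" using assms[of "ymax x"] f_le_ymax[of x y'] by linarith
  then show ?thesis using mu_pos by (simp add: mult_le_0_iff)
qed

text \<open>Strong monotonicity bounds the distance of the maximizers by the gradient in
  \<open>y\<close> at \<open>(x, ymax x')\<close>, which is small since it vanishes at
  \<open>(x', ymax x')\<close>.\<close>

lemma ymax_lip: "norm (ymax x - ymax x') \<le> \<kappa> * norm (x - x')"
proof (cases "ymax x = ymax x'")
  case False
  let ?n = "norm (ymax x - ymax x')" and ?G = "grad_y f x (ymax x')"
  have "\<mu> * ?n\<^sup>2 \<le> ?G \<bullet> (ymax x - ymax x')"
    using grad_y_monotone[of "ymax x'" "ymax x" x] by (simp add: grad_y_ymax norm_minus_commute)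
  also have "\<dots> \<le> norm ?G * ?n" by (rule norm_cauchy_schwarz)
  finally have "\<mu> * ?n \<le> norm ?G" using False by (simp add: power2_eq_square mult.assoc[symmetric])
  also have "?G = snd (grad f (x, ymax x') - grad f (x', ymax x'))"
    using grad_y_ymax[of x'] by (simp add: grad_y_eq)
  also have "norm \<dots> \<le> norm (grad f (x, ymax x') - grad f (x', ymax x'))" by (rule norm_snd_le_norm)
  also have "\<dots> \<le> l * norm ((x, ymax x') - (x', ymax x'))" by (rule grad_lip)
  finally show ?thesis using mu_pos by (simp add: norm_Pair \<kappa>_def field_simps)
qed (use kappa_ge_1 in simp)

lemma graph_norm_le: "norm ((x, ymax x) - (x', ymax x')) \<le> (1 + \<kappa>) * norm (x - x')"
proof -
  have "norm (x - x', ymax x - ymax x') \<le> norm (x - x') + norm (ymax x - ymax x')" by (rule norm_Pair_le)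
  then show ?thesis using ymax_lip[of x x'] by (simp add: algebra_simps)
qed

text \<open>Implicit differentiation at one point. As \<open>ymax\<close> is already known to be
  Lipschitz, expanding the vanishing gradient along its graph suffices; \<open>A\<close>, the
  Hessian in \<open>y\<close>, is invertible because it expands by at least \<mu>.\<close>

lemma ymax_derivative:
  obtains W where "(ymax has_derivative W) (at x)" "\<And>v. snd (J (x, ymax x) (v, W v)) = 0"
    "\<And>v. norm (W v) \<le> \<kappa> * norm v"
proof -
  let ?z = "(x, ymax x)"
  define A where "A w = snd (J ?z (0, w))" for w
  define C where "C v = snd (J ?z (v, 0))" for v
  have linA: "linear A" unfolding A_def
    by (rule linearI) (simp_all flip: blinfun.add_right blinfun.scaleR_right snd_add snd_scaleR)
  have linC: "linear C" unfolding C_def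
    by (rule linearI) (simp_all flip: blinfun.add_right blinfun.scaleR_right snd_add snd_scaleR)
  have split: "snd (J ?z (v, w)) = C v + A w" for v w
    by (simp add: A_def C_def flip: snd_add blinfun.add_right)
  have A_ge: "\<mu> * norm w \<le> norm (A w)" for w
  proof (cases "w = 0")
    case False
    have "\<mu> * (norm w)\<^sup>2 \<le> - A w \<bullet> w" using J_yy_le[of ?z w] by (simp add: A_def)
    also have "\<dots> \<le> norm (A w) * norm w" using norm_cauchy_schwarz[of "- A w" w] by simp
    finally show ?thesis using False by (simp add: power2_eq_square mult.assoc[symmetric])
  qed simp
  have "inj A"
  proof (rule linear_injective_0[OF linA, THEN iffD2], intro allI impI)
    fix w assume "A w = 0"
    then show "w = 0" using A_ge[of w] mu_pos by (simp add: mult_le_0_iff)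
  qed
  then obtain B where B: "linear B" "\<forall>w. B (A w) = w" "\<forall>w. A (B w) = w"
    using linear_injective_isomorphism[OF linA] by metis
  define W where "W v = B (- C v)" for v
  have AW: "A (W v) = - C v" for v using B by (simp add: W_def)
  have linW: "linear W" unfolding W_def
    using linear_compose[OF linear_compose_neg[OF linC] B(1)] by (simp add: o_def)
  have deriv: "(ymax has_derivative W) (at x)"
    unfolding has_derivative_at_alt
  proof (intro conjI allI impI)
    show "bounded_linear W" using linW by (simp add: linear_conv_bounded_linear)
    fix e :: real assume "0 < e"
    \<comment> \<open>The factor \<open>1 + \<kappa>\<close> comes from the distance along the
      graph, and \<mu> is lost when \<open>A\<close> is inverted.\<close>
    define e' where "e' = e * \<mu> / (1 + \<kappa>)"
    have "0 < e'" using \<open>0 < e\<close> mu_pos kappa_ge_1 by (simp add: e'_def)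
    then obtain d where d: "0 < d" "\<And>h. norm h < d \<Longrightarrow> norm (grad f (?z + h) - grad f ?z - J ?z h) \<le> e' * norm h"
      using has_derivative_remainder[OF grad_deriv] by metis
    have "norm (ymax x' - ymax x - W (x' - x)) \<le> e * norm (x' - x)"
      if "norm (x' - x) < d / (1 + \<kappa>)" for x'
    proof -
      define h where "h = (x', ymax x') - ?z"
      have h: "norm h \<le> (1 + \<kappa>) * norm (x' - x)" using graph_norm_le[of x' x] by (simp add: h_def)
      also have "\<dots> < d" using that kappa_ge_1 by (simp add: field_simps)
      finally have "norm h < d" .
      then have "norm (snd (grad f (?z + h) - grad f ?z - J ?z h)) \<le> e' * norm h"
        using d(2)[of h] norm_snd_le_norm[of "grad f (?z + h) - grad f ?z - J ?z h"] by linarith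
      moreover have "snd (grad f (?z + h) - grad f ?z - J ?z h) = - (C (x' - x) + A (ymax x' - ymax x))"
        using grad_y_ymax[of x'] grad_y_ymax[of x] split by (simp add: h_def grad_y_eq)
      moreover have "A (ymax x' - ymax x - W (x' - x)) = C (x' - x) + A (ymax x' - ymax x)"
        by (simp add: linear_diff[OF linA] AW)
      ultimately have "norm (A (ymax x' - ymax x - W (x' - x))) \<le> e' * norm h"
        by (simp only: norm_minus_cancel)
      also have "\<dots> \<le> e' * ((1 + \<kappa>) * norm (x' - x))" using h \<open>0 < e'\<close> by (intro mult_left_mono) auto
      also have "\<dots> = \<mu> * (e * norm (x' - x))" using kappa_ge_1 by (simp add: e'_def)
      finally have "\<mu> * norm (ymax x' - ymax x - W (x' - x)) \<le> \<mu> * (e * norm (x' - x))"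
        using A_ge order_trans by blast
      then show ?thesis using mu_pos by simp
    qed
    then show "\<exists>d>0. \<forall>y. norm (y - x) < d \<longrightarrow> norm (ymax y - ymax x - W (y - x)) \<le> e * norm (y - x)"
      using d(1) kappa_ge_1 by (intro exI[of _ "d / (1 + \<kappa>)"]) auto
  qed
  show thesis
  proof
    show "(ymax has_derivative W) (at x)" by (rule deriv)
    show "snd (J ?z (v, W v)) = 0" for v by (simp add: split AW)
    show "norm (W v) \<le> \<kappa> * norm v" for v by (rule derivative_norm_le_of_lipschitz[OF deriv ymax_lip])
  qed
qed

section \<open>Gradient and Hessian of the maximum function\<close>

definition "grad_max x = fst (grad f (x, ymax x))"

definition "hess_max = jacobian grad_max"

text \<open>The envelope theorem: the derivative of \<open>ymax\<close> meets the
  \<open>y\<close>-gradient, which vanishes at the maximizer.\<close>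

lemma max_value_deriv: "(max_value f has_derivative (\<lambda>h. grad_max x \<bullet> h)) (at x)"
proof -
  obtain W where W: "(ymax has_derivative W) (at x)" using ymax_derivative by blast
  have "((\<lambda>x. f (x, ymax x)) has_derivative (\<lambda>h. grad f (x, ymax x) \<bullet> (h, W h))) (at x)"
    by (intro has_derivative_compose[OF _ f_deriv] has_derivative_Pair has_derivative_ident W)
  moreover have "snd (grad f (x, ymax x)) = 0" using grad_y_ymax[of x] by (simp add: grad_y_eq)
  ultimately show ?thesis by (simp add: inner_prod_def grad_max_def max_value_eq[abs_def])
qed

lemma grad_max_deriv_explicit:
  assumes "(ymax has_derivative W) (at x)"
  shows "(grad_max has_derivative (\<lambda>v. fst (J (x, ymax x) (v, W v)))) (at x)"
  unfolding grad_max_def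
  by (intro has_derivative_fst has_derivative_compose[OF _ grad_deriv] has_derivative_Pair has_derivative_ident assms)

lemma grad_max_deriv: "(grad_max has_derivative blinfun_apply (hess_max x)) (at x)"
  unfolding hess_max_def
  by (rule has_derivative_jacobian) (metis differentiableI grad_max_deriv_explicit ymax_derivative)

lemma grad_max_lip: "norm (grad_max x - grad_max x') \<le> l * (1 + \<kappa>) * norm (x - x')"
proof -
  have "norm (grad_max x - grad_max x') \<le> norm (grad f (x, ymax x) - grad f (x', ymax x'))"
    unfolding grad_max_def fst_diff[symmetric] by (rule norm_fst_le_norm)
  also have "\<dots> \<le> l * norm ((x, ymax x) - (x', ymax x'))" by (rule grad_lip)
  also have "\<dots> \<le> l * ((1 + \<kappa>) * norm (x - x'))" using l_pos by (intro mult_left_mono graph_norm_le) auto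
  finally show ?thesis by simp
qed

lemma J_quadratic_form:
  "J z (v, w) \<bullet> (v, w) = hess_xx f z v \<bullet> v + 2 * (hess_xy f z w \<bullet> v) + hess_yy f z w \<bullet> w"
proof -
  have "J z (v, w) = J z (v, 0) + J z (0, w)" by (simp flip: blinfun.add_right)
  moreover have "J z (v, 0) \<bullet> (0, w) = (v, 0) \<bullet> J z (0, w)" by (rule J_symmetric)
  ultimately show ?thesis
    by (simp add: hess_xx_apply hess_xy_apply hess_yy_apply inner_prod_def inner_add_left inner_add_right inner_commute)
qed

text \<open>The three block bounds combine to a perfect square, the mixed block counting
  twice.\<close>

lemma J_quadratic_form_lip:
  "J z (v, w) \<bullet> (v, w) - J z' (v, w) \<bullet> (v, w) \<le> \<rho> * norm (z - z') * (norm v + norm w)\<^sup>2"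
proof -
  have *: "(A u - B u) \<bullet> u' \<le> \<rho> * norm (z - z') * norm u * norm u'"
    if "norm (A - B) \<le> \<rho> * norm (z - z')" for A B :: "'c::real_normed_vector \<Rightarrow>\<^sub>L 'd::real_inner" and u u'
  proof -
    have "(A u - B u) \<bullet> u' \<le> norm ((A - B) u) * norm u'" by (metis blinfun.diff_left norm_cauchy_schwarz)
    also have "\<dots> \<le> norm (A - B) * norm u * norm u'" by (intro mult_right_mono norm_blinfun) simp
    also have "\<dots> \<le> \<rho> * norm (z - z') * norm u * norm u'" using that by (intro mult_right_mono) auto
    finally show ?thesis .
  qed
  have 1: "(hess_xx f z v - hess_xx f z' v) \<bullet> v \<le> \<rho> * norm (z - z') * norm v * norm v"
    using lipschitz_onD[OF xx, of z z'] by (intro *) (simp add: dist_norm)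
  have 2: "(hess_xy f z w - hess_xy f z' w) \<bullet> v \<le> \<rho> * norm (z - z') * norm w * norm v"
    using lipschitz_onD[OF xy, of z z'] by (intro *) (simp add: dist_norm)
  have 3: "(hess_yy f z w - hess_yy f z' w) \<bullet> w \<le> \<rho> * norm (z - z') * norm w * norm w"
    using lipschitz_onD[OF yy, of z z'] by (intro *) (simp add: dist_norm)
  have "\<rho> * norm (z - z') * (norm v + norm w)\<^sup>2 = \<rho> * norm (z - z') * norm v * norm v
    + 2 * (\<rho> * norm (z - z') * norm w * norm v) + \<rho> * norm (z - z') * norm w * norm w"
    by (simp add: power2_eq_square algebra_simps)
  then show ?thesis using 1 2 3 unfolding J_quadratic_form by (simp add: inner_diff_left)
qed

text \<open>The quadratic form of the Hessian of the maximum function is the maximum over \<open>w\<close> of the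
  quadratic forms of the full Hessian, which avoids inverting \<open>\<nabla>\<^sub>y\<^sup>2 f\<close>.\<close>

lemma hess_max_quadratic_form_lip:
  "hess_max x v \<bullet> v - hess_max x' v \<bullet> v \<le> \<rho> * (1 + \<kappa>) ^ 3 * norm (x - x') * (norm v)\<^sup>2"
proof -
  let ?z = "(x, ymax x)" and ?z' = "(x', ymax x')"
  obtain W where W: "(ymax has_derivative W) (at x)" "\<And>v. snd (J ?z (v, W v)) = 0" "\<And>v. norm (W v) \<le> \<kappa> * norm v"
    using ymax_derivative[of x] by blast
  obtain W' where W': "(ymax has_derivative W') (at x')" "\<And>v. snd (J ?z' (v, W' v)) = 0"
    using ymax_derivative[of x'] by blast
  have H: "hess_max x v = fst (J ?z (v, W v))"
    using has_derivative_unique[OF grad_max_deriv grad_max_deriv_explicit[OF W(1)]] by metis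
  have H': "hess_max x' v = fst (J ?z' (v, W' v))"
    using has_derivative_unique[OF grad_max_deriv grad_max_deriv_explicit[OF W'(1)]] by metis
  have "hess_max x v \<bullet> v = J ?z (v, W v) \<bullet> (v, W v)" by (simp add: H inner_prod_def W(2))
  \<comment> \<open>\<open>W' v\<close> maximizes the form at \<open>?z'\<close> over the second
    argument: expanding around it, the mixed term vanishes and the remaining one is
    nonpositive.\<close>
  moreover have "J ?z' (v, W v) \<bullet> (v, W v) \<le> hess_max x' v \<bullet> v"
  proof -
    let ?p = "(v, W' v)" and ?q = "(0::'a, W v - W' v)"
    have pq: "(v, W v) = ?p + ?q" by simp
    have "J ?z' (v, W v) \<bullet> (v, W v) = J ?z' ?p \<bullet> ?p + 2 * (J ?z' ?p \<bullet> ?q) + J ?z' ?q \<bullet> ?q"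
      unfolding pq blinfun.add_right inner_add_left inner_add_right
      using J_symmetric[of ?z' ?q ?p] by (simp only: inner_commute[of ?q "J ?z' ?p"])
    moreover have "J ?z' ?p \<bullet> ?q = 0" by (simp add: inner_prod_def W'(2))
    moreover have "J ?z' ?p \<bullet> ?p = hess_max x' v \<bullet> v" by (simp add: H' inner_prod_def W'(2))
    moreover have "J ?z' ?q \<bullet> ?q \<le> 0"
    proof -
      have "0 \<le> \<mu> * (norm (W v - W' v))\<^sup>2" using mu_pos by simp
      then show ?thesis using J_yy_le[of ?z' "W v - W' v"] by (simp add: inner_prod_def)
    qed
    ultimately show ?thesis by linarith
  qed
  moreover have "J ?z (v, W v) \<bullet> (v, W v) - J ?z' (v, W v) \<bullet> (v, W v)
      \<le> \<rho> * norm (?z - ?z') * (norm v + norm (W v))\<^sup>2" by (rule J_quadratic_form_lip)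
  \<comment> \<open>One factor \<open>1 + \<kappa>\<close> measures distance along the graph of
    \<open>ymax\<close>; two more come from the square of
    \<open>norm v + norm (W v)\<close>.\<close>
  moreover have "\<dots> \<le> \<rho> * ((1 + \<kappa>) * norm (x - x')) * ((1 + \<kappa>) * norm v)\<^sup>2"
    using rho_pos kappa_ge_1 W(3)[of v] graph_norm_le[of x x']
    by (intro mult_mono power_mono) (auto simp: algebra_simps)
  moreover have "\<dots> = \<rho> * (1 + \<kappa>) ^ 3 * norm (x - x') * (norm v)\<^sup>2"
    by (simp add: power_mult_distrib power2_eq_square power3_eq_cube)
  ultimately show ?thesis by linarith
qed

lemma hess_max_lip: "norm (hess_max x - hess_max x') \<le> \<rho> * (1 + \<kappa>) ^ 3 * norm (x - x')"
proof (rule norm_blinfun_bound)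
  show "0 \<le> \<rho> * (1 + \<kappa>) ^ 3 * norm (x - x')" using rho_pos kappa_ge_1 by simp
  fix v
  show "norm ((hess_max x - hess_max x') v) \<le> \<rho> * (1 + \<kappa>) ^ 3 * norm (x - x') * norm v"
  proof (rule symmetric_norm_le_of_quadratic_form)
    show "linear (blinfun_apply (hess_max x - hess_max x'))"
      by (rule bounded_linear.linear[OF blinfun.bounded_linear_right])
    have sym: "hess_max x u \<bullet> v = u \<bullet> hess_max x v" for x u v
      by (rule second_derivative_symmetric[OF max_value_deriv grad_max_deriv])
    show "(hess_max x - hess_max x') u \<bullet> v = u \<bullet> (hess_max x - hess_max x') v" for u v
      by (simp add: blinfun.diff_left inner_diff_left inner_diff_right sym)
    show "\<bar>(hess_max x - hess_max x') v \<bullet> v\<bar> \<le> \<rho> * (1 + \<kappa>) ^ 3 * norm (x - x') * (norm v)\<^sup>2" for v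
      using hess_max_quadratic_form_lip[of x v x'] hess_max_quadratic_form_lip[of x' v x]
      by (simp add: blinfun.diff_left inner_diff_left norm_minus_commute abs_le_iff)
  qed
qed

sublocale smooth_hessian "max_value f" grad_max hess_max "l * (1 + \<kappa>)" "\<rho> * (1 + \<kappa>) ^ 3"
  using l_pos rho_pos kappa_ge_1
  by unfold_locales (auto intro: max_value_deriv grad_max_deriv grad_max_lip hess_max_lip)

section \<open>Accuracy of the inner loop\<close>

lemma inner_ascent_error:
  "norm (inner_ascent f (1 / l) D x y - ymax x) \<le> contr ^ D * norm (y - ymax x)"
proof (induction D)
  case (Suc D)
  let ?y = "inner_ascent f (1 / l) D x y"
  have "inner_ascent f (1 / l) (Suc D) x y = ?y + (1 / l) *\<^sub>R grad_y f x ?y" by (simp add: inner_ascent_def)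
  then have "norm (inner_ascent f (1 / l) (Suc D) x y - ymax x) \<le> contr * norm (?y - ymax x)"
    using ascent_contraction[of ?y x "ymax x"] by (simp add: grad_y_ymax)
  also have "\<dots> \<le> contr * (contr ^ D * norm (y - ymax x))" using Suc contr by (intro mult_left_mono) auto
  finally show ?case by (simp add: mult.assoc)
qed (simp add: inner_ascent_def)

lemma grad_estimate_error: "norm (grad_x f x y - grad_max x) \<le> l * norm (y - ymax x)"
proof -
  have "norm (grad_x f x y - grad_max x) \<le> norm (grad f (x, y) - grad f (x, ymax x))"
    unfolding grad_x_eq grad_max_def fst_diff[symmetric] by (rule norm_fst_le_norm)
  also have "\<dots> \<le> l * norm ((x, y) - (x, ymax x))" by (rule grad_lip)
  finally show ?thesis by (simp add: norm_Pair)
qed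

end

section \<open>Trajectories of the algorithm\<close>

text \<open>At 16 both sides of the second assumption agree. Below 16, the logarithm to base 2 lies
  above its chord from 1 to 16; with \<open>\<iota> = 1 + 15 * t\<close> the assumption becomes
  \<open>8 + 8 * t \<le> 1 + 15 * t\<close>, forcing \<open>t \<ge> 1\<close>.\<close>

lemma iota_ge_16:
  fixes \<iota> :: real
  assumes "1 < \<iota>" "256 * \<iota>\<^sup>2 \<le> 2 powr \<iota>"
  shows "16 \<le> \<iota>"
proof (rule ccontr)
  assume "\<not> 16 \<le> \<iota>"
  define t where "t = (\<iota> - 1) / 15"
  have t: "0 \<le> t" "t \<le> 1" using assms \<open>\<not> 16 \<le> \<iota>\<close> by (auto simp: t_def)
  have "\<iota> = 1 + 15 * t" by (simp add: t_def field_simps)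
  then have t3: "\<iota> = (1 - t) * 1 + t * 16" by simp
  have "(1 - t) * ln 1 + t * ln 16 \<le> ln ((1 - t) *\<^sub>R 1 + t *\<^sub>R (16::real))"
    using concave_onD[OF ln_concave t(1,2), of 1 16] by simp
  moreover have "ln (16::real) = 4 * ln 2" using ln_realpow[of "2::real" 4] by simp
  ultimately have lower: "4 * t * ln 2 \<le> ln \<iota>" using t3 by simp
  have "ln (256 * \<iota>\<^sup>2) \<le> ln (2 powr \<iota>)" by (subst ln_le_cancel_iff) (use assms in auto)
  moreover have "ln (256 * \<iota>\<^sup>2) = ln 256 + 2 * ln \<iota>" using assms by (simp add: ln_mult ln_realpow)
  moreover have "ln (256::real) = 8 * ln 2" using ln_realpow[of "2::real" 8] by simp
  ultimately have "8 * ln 2 + 8 * t * ln 2 \<le> \<iota> * ln 2" using lower by (simp add: ln_powr)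
  then have "(8 + 8 * t) * ln 2 \<le> \<iota> * ln 2" by (simp add: algebra_simps)
  then have "8 + 8 * t \<le> \<iota>" by simp
  then show False using \<open>\<iota> = 1 + 15 * t\<close> \<open>\<not> 16 \<le> \<iota>\<close> by linarith
qed

locale perturbed_gdmax = strongly_concave_problem f \<mu> l \<rho>
  for f :: "(real ^ 'd) \<times> (real ^ 'n) \<Rightarrow> real" and \<mu> l \<rho> :: real +
  fixes \<epsilon> \<iota> \<delta> :: real and x0 xstar :: "real ^ 'd" and y0 :: "real ^ 'n" and D :: nat
    and L R g p \<Delta> r e :: real
  assumes eps: "0 < \<epsilon>"
    and L_eq: "L = l * (1 + \<kappa>)" and R_eq: "R = \<rho> * (1 + \<kappa>) ^ 3" and g_eq: "g = sqrt (R * \<epsilon>)"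
    and g_le: "g \<le> L" and iota_gt_1: "1 < \<iota>" and p_eq: "p = 2 powr (- \<iota>)"
    and delta: "256 * \<iota>\<^sup>2 * (L / g) * sqrt CARD('d) * p \<le> \<delta>" "\<delta> < 1"
    and xstar: "\<And>x. max_value f xstar \<le> max_value f x"
    and \<Delta>_eq: "\<Delta> = max_value f x0 - max_value f xstar"
    and r_eq: "r = \<epsilon> / (400 * \<iota> ^ 3)" and e_eq: "e = \<epsilon> * p\<^sup>2"
    and D: "inner_steps \<kappa> \<iota> (l * norm (y0 - ymax x0) + sqrt (L * \<Delta>)) \<epsilon> \<le> real D"
begin

abbreviation "\<Phi> \<equiv> max_value f"

sublocale max: smooth_hessian \<Phi> grad_max hess_max L R
  unfolding L_eq R_eq by (rule smooth_hessian_axioms)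

lemma g_pos: "0 < g" and eps_eq: "\<epsilon> = g\<^sup>2 / R"
  using eps max.rho_pos by (auto simp: g_eq)

lemma p_pos: "0 < p" by (simp add: p_eq)

lemma ratio: "1 \<le> L / g" using g_le g_pos by simp

lemma delta_pos: "0 < \<delta>"
proof -
  have "0 < 256 * \<iota>\<^sup>2 * (L / g) * sqrt CARD('d) * p"
    using iota_gt_1 g_pos max.L_pos p_pos by simp
  then show ?thesis using delta(1) by linarith
qed

text \<open>As \<open>L / g\<close> and the dimension are at least 1, the condition
  \<open>\<delta> < 1\<close> alone forces \<iota> to be this large.\<close>

lemma iota_powr: "256 * \<iota>\<^sup>2 \<le> 2 powr \<iota>"
proof -
  have "1 * 1 \<le> (L / g) * sqrt CARD('d)"
    using ratio by (intro mult_mono) (auto simp: Suc_le_eq)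
  then have "(256 * \<iota>\<^sup>2 * p) * 1 \<le> (256 * \<iota>\<^sup>2 * p) * ((L / g) * sqrt CARD('d))"
    using p_pos by (intro mult_left_mono) auto
  also have "\<dots> = 256 * \<iota>\<^sup>2 * (L / g) * sqrt CARD('d) * p" by simp
  also have "\<dots> \<le> 1" using delta by linarith
  finally have "256 * \<iota>\<^sup>2 * p \<le> 1" by simp
  then show ?thesis by (simp add: p_eq powr_minus field_simps)
qed

lemma iota: "16 \<le> \<iota>" using iota_ge_16[OF iota_gt_1 iota_powr] .

lemma e_pos: "0 < e" and r_pos: "0 < r"
  using eps p_pos iota by (auto simp: e_eq r_eq)

lemma Delta_nonneg: "0 \<le> \<Delta>" using xstar by (simp add: \<Delta>_eq)

lemma e_le: "e \<le> \<epsilon> / (16000 * \<iota> ^ 3)"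
proof -
  have "p \<le> 1 / (256 * \<iota>\<^sup>2)" using iota_powr iota by (simp add: p_eq powr_minus inverse_eq_divide frac_le)
  then have "p\<^sup>2 \<le> (1 / (256 * \<iota>\<^sup>2))\<^sup>2" using p_pos by (intro power_mono) auto
  also have "\<dots> = 1 / (65536 * \<iota> * \<iota> ^ 3)" by (simp add: power2_eq_square power3_eq_cube)
  also have "\<dots> \<le> 1 / (16000 * \<iota> ^ 3)" using iota by (intro divide_left_mono mult_right_mono) auto
  finally show ?thesis using mult_left_mono[of "p\<^sup>2" "1 / (16000 * \<iota> ^ 3)" \<epsilon>] eps by (simp add: e_eq)
qed

lemma e_le': "e \<le> \<epsilon> / 100"
proof -
  have "1 \<le> \<iota> ^ 3" using iota by simp
  then have "100 \<le> 16000 * \<iota> ^ 3" by linarith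
  then have "\<epsilon> / (16000 * \<iota> ^ 3) \<le> \<epsilon> / 100" using eps iota by (intro divide_left_mono) auto
  then show ?thesis using e_le by linarith
qed

lemma re_le: "r + e \<le> \<epsilon> / (390 * \<iota> ^ 3)"
proof -
  have "r + e \<le> \<epsilon> / (400 * \<iota> ^ 3) + \<epsilon> / (16000 * \<iota> ^ 3)" using e_le by (simp add: r_eq)
  also have "\<dots> \<le> \<epsilon> / (390 * \<iota> ^ 3)" using eps iota by (simp add: field_simps)
  finally show ?thesis .
qed

lemma re_le': "r + e \<le> \<epsilon> / 100"
proof -
  have "1 \<le> \<iota> ^ 3" using iota by simp
  then have "100 \<le> 390 * \<iota> ^ 3" by linarith
  then have "\<epsilon> / (390 * \<iota> ^ 3) \<le> \<epsilon> / 100" using eps iota by (intro divide_left_mono) auto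
  then show ?thesis using re_le by linarith
qed

text \<open>The most that a single step, perturbed or not, can raise \<Phi>.\<close>

definition "cost = (r + e)\<^sup>2 / (2 * L)"

definition "Z = 10 ^ 6 * \<iota> ^ 4 * (L * \<Delta> / \<epsilon>\<^sup>2)"

lemma cost_nonneg: "0 \<le> cost" using max.L_pos by (simp add: cost_def)

lemma Z_nonneg: "0 \<le> Z" using max.L_pos Delta_nonneg iota by (simp add: Z_def)

text \<open>\<open>r\<close> is of order \<open>\<epsilon> / \<iota> ^ 3\<close> and enters squared,
  which outweighs the \<open>\<iota> ^ 4\<close> in \<open>Z\<close>. So all perturbations together
  cannot raise \<Phi> noticeably.\<close>

lemma cost_Z_le: "cost * Z \<le> \<Delta> / 50"
proof -
  have "(r + e)\<^sup>2 \<le> (\<epsilon> / (390 * \<iota> ^ 3))\<^sup>2" using re_le r_pos e_pos by (intro power_mono) auto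
  then have "cost * Z \<le> (\<epsilon> / (390 * \<iota> ^ 3))\<^sup>2 / (2 * L) * Z"
    unfolding cost_def using max.L_pos Z_nonneg by (intro mult_right_mono divide_right_mono) auto
  also have "\<dots> = 10 ^ 6 / 304200 * \<Delta> / \<iota>\<^sup>2"
    using eps iota max.L_pos by (simp add: Z_def eval_nat_numeral field_simps)
  also have "\<dots> \<le> 10 ^ 6 / 304200 * \<Delta> / 16\<^sup>2"
    using Delta_nonneg iota by (intro divide_left_mono power_mono) auto
  also have "\<dots> \<le> \<Delta> / 50" using Delta_nonneg by simp
  finally show ?thesis .
qed

text \<open>\<open>contr\<close> is at most \<open>exp (- 1 / \<kappa>)\<close>. In the exponent of
  the \<open>D\<close>-th power, the logarithm in \<open>inner_steps\<close> cancels the initial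
  error, and the part with \<iota> supplies \<open>p\<^sup>2\<close> and the constant 3. The
  quantity multiplied is the warm-start error maintained by
  \<open>trajectory_invariant\<close>.\<close>

lemma contr_power_le: "contr ^ D * (3 * (l * norm (y0 - ymax x0) + sqrt (L * \<Delta>) + \<epsilon>)) \<le> e"
proof -
  let ?A = "l * norm (y0 - ymax x0) + sqrt (L * \<Delta>)"
  have A: "0 \<le> ?A" using l_pos max.L_pos Delta_nonneg by simp
  define q where "q = ln (1 + ?A / \<epsilon>)"
  have q: "0 \<le> q" using A eps by (simp add: q_def)
  have k: "0 < \<kappa>" using kappa_ge_1 by simp
  have "contr \<le> exp (- 1 / \<kappa>)" using exp_ge_add_one_self[of "- 1 / \<kappa>"] by (simp add: contr_def \<kappa>_def)
  then have "contr ^ D \<le> exp (- 1 / \<kappa>) ^ D" using contr by (intro power_mono) auto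
  also have "\<dots> = exp (- real D / \<kappa>)" by (simp flip: exp_of_nat_mult)
  also have "\<dots> \<le> exp (- (100 * (\<iota> + q)))"
  proof -
    have "100 * \<kappa> * (\<iota> + q) \<le> real D" using D by (simp add: inner_steps_def q_def)
    then have "100 * (\<iota> + q) \<le> real D / \<kappa>" using k by (simp add: field_simps)
    then show ?thesis by simp
  qed
  also have "\<dots> \<le> exp (- q + (- 2 - 2 * \<iota> * ln 2))"
  proof -
    have "\<iota> * ln 2 \<le> \<iota> * 1" using iota ln2_le_25_over_36 by (intro mult_left_mono) auto
    moreover have "- (100 * (\<iota> + q)) \<le> - q + (- 2 - 2 * x)" if "x \<le> \<iota>" for x
      using that iota q by (simp add: distrib_left)
    ultimately have "- (100 * (\<iota> + q)) \<le> - q + (- 2 - 2 * \<iota> * ln 2)" by (simp add: mult.assoc)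
    then show ?thesis by simp
  qed
  also have "\<dots> = exp (- q) * (exp (- 2) * p\<^sup>2)"
  proof -
    have "p\<^sup>2 = exp (2 * (- \<iota> * ln 2))" by (simp only: p_eq powr_def exp_double) simp
    then show ?thesis by (simp add: mult_exp_exp algebra_simps)
  qed
  also have "exp (- q) = \<epsilon> / (?A + \<epsilon>)"
    unfolding q_def using A eps by (subst exp_minus, subst exp_ln) (auto simp: field_simps add_pos_nonneg)
  finally have "contr ^ D * (3 * (?A + \<epsilon>)) \<le> \<epsilon> / (?A + \<epsilon>) * (exp (- 2) * p\<^sup>2) * (3 * (?A + \<epsilon>))"
    using A eps by (intro mult_right_mono) auto
  also have "\<dots> = (3 * exp (- 2)) * e"
  proof -
    have "\<epsilon> / B * (exp (- 2) * p\<^sup>2) * (3 * B) = 3 * exp (- 2) * e" if "B \<noteq> 0" for B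
      using that by (simp add: e_eq)
    moreover have "?A + \<epsilon> \<noteq> 0" using A eps by linarith
    ultimately show ?thesis .
  qed
  also have "\<dots> \<le> 1 * e"
  proof (intro mult_right_mono)
    have "3 \<le> exp (2::real)" using exp_ge_add_one_self[of "2::real"] by simp
    then show "3 * exp (- 2) \<le> (1::real)" by (simp add: exp_minus field_simps)
  qed (use e_pos in simp)
  finally show ?thesis by simp
qed

definition "T = L / g * \<iota>"

text \<open>The least integer above \<open>T\<close>: the strict test on the time since the last
  perturbation becomes \<open>P u k + N \<le> k\<close>.\<close>

definition "N = nat \<lfloor>T\<rfloor> + 1"

lemma T_ge: "16 \<le> T"
proof -
  have "1 * 16 \<le> L / g * \<iota>" using ratio iota by (intro mult_mono) auto
  then show ?thesis by (simp add: T_def)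
qed

lemma N: "T < real N" "real N \<le> T + 1" "1 \<le> N"
  using T_ge unfolding N_def by (simp_all, linarith+)

lemma exceeds_T_iff: "T < real k - real j \<longleftrightarrow> j + N \<le> k"
proof
  assume "T < real k - real j"
  then have "\<lfloor>T\<rfloor> < int k - int j" by (simp add: floor_less_iff)
  moreover have "int (nat \<lfloor>T\<rfloor>) = \<lfloor>T\<rfloor>" using T_ge by simp
  ultimately show "j + N \<le> k" unfolding N_def by linarith
next
  assume "j + N \<le> k"
  then have "real j + real N \<le> real k" by (simp flip: of_nat_add)
  then show "T < real k - real j" using N by linarith
qed

subsection \<open>The iterates\<close>

definition "st u k = gdmax_state f D (1 / l) (1 / L) \<epsilon> T x0 y0 u k"
definition "X u k = fst (st u k)"
definition "Y u k = fst (snd (st u k))"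
definition "P u k = snd (snd (st u k))"
definition "Y' u k = inner_ascent f (1 / l) D (X u k) (Y u k)"
definition "gh u k = grad_x f (X u k) (Y' u k)"
definition "small u k \<longleftrightarrow> norm (gh u k) \<le> 4 / 5 * \<epsilon>"
definition "pert u k \<longleftrightarrow> small u k \<and> P u k + N \<le> k"
text \<open>The gradient estimate is computed before the perturbation, so a perturbed iteration is a single
  inexact gradient step whose direction has an error of at most \<open>r\<close> more.  Its cost is therefore
  quadratic in \<open>r\<close>.\<close>

definition "sd u k = gh u k + (if pert u k then u k else 0)"

lemma st_0: "X u 0 = x0" "Y u 0 = y0" "P u 0 = 0"
  by (simp_all add: X_def Y_def P_def st_def)

lemma st_Suc:
  "X u (Suc k) = X u k - (1 / L) *\<^sub>R sd u k" "Y u (Suc k) = Y' u k"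
  "P u (Suc k) = (if pert u k then k else P u k)"
proof -
  obtain x y q where xyq: "gdmax_state f D (1 / l) (1 / L) \<epsilon> T x0 y0 u k = (x, y, q)"
    by (metis prod_cases3)
  then have eqs: "X u k = x" "Y u k = y" "P u k = q" by (simp_all add: X_def Y_def P_def st_def)
  have pert: "pert u k \<longleftrightarrow> norm (gh u k) \<le> 4 / 5 * \<epsilon> \<and> real k - real q > T"
    unfolding pert_def small_def eqs exceeds_T_iff ..
  have gh: "gh u k = grad_x f x (inner_ascent f (1 / l) D x y)" by (simp add: gh_def Y'_def eqs)
  show "X u (Suc k) = X u k - (1 / L) *\<^sub>R sd u k" "Y u (Suc k) = Y' u k"
    "P u (Suc k) = (if pert u k then k else P u k)"
    unfolding sd_def pert gh
    by (simp_all add: X_def Y_def P_def st_def xyq Let_def Y'_def algebra_simps)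
qed

text \<open>Causality: the state at time \<open>k\<close> is independent of \<open>u k\<close>, so
  this coordinate may be varied or resampled with the history kept fixed.\<close>

lemma st_cong:
  assumes "\<And>j. j < k \<Longrightarrow> u j = u' j"
  shows "st u k = st u' k"
  unfolding st_def using assms by (induction k) (auto simp: Let_def split: prod.splits)

lemma st_upd:
  assumes "k \<le> j"
  shows "X (u(j := v)) k = X u k" "Y (u(j := v)) k = Y u k" "P (u(j := v)) k = P u k"
    "gh (u(j := v)) k = gh u k" "pert (u(j := v)) k = pert u k"
proof -
  have "st (u(j := v)) k = st u k" using assms by (intro st_cong) auto
  then show XYP: "X (u(j := v)) k = X u k" "Y (u(j := v)) k = Y u k" "P (u(j := v)) k = P u k"
    by (simp_all add: X_def Y_def P_def)
  then show "gh (u(j := v)) k = gh u k" by (simp add: gh_def Y'_def)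
  with XYP show "pert (u(j := v)) k = pert u k" by (simp add: pert_def small_def)
qed

lemma P_less: "P u (Suc k) \<le> k"
  by (induction k) (auto simp: st_Suc st_0)

lemma P_after_pert:
  assumes "pert u k" "1 \<le> t" "t \<le> N"
  shows "P u (k + t) = k"
  using assms(2,3)
proof (induction t rule: dec_induct)
  case base
  then show ?case using assms(1) by (simp add: st_Suc)
next
  case (step t)
  then have "P u (k + t) = k" by simp
  then have "\<not> pert u (k + t)" using step by (simp add: pert_def)
  then show ?case using \<open>P u (k + t) = k\<close> by (simp add: st_Suc)
qed

lemma not_pert_after_pert:
  assumes "pert u k" "1 \<le> t" "t < N"
  shows "\<not> pert u (k + t)"
  using P_after_pert[OF assms(1,2)] assms(3) by (simp add: pert_def)

definition "ok u \<longleftrightarrow> (\<forall>k. norm (u k) \<le> r)"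

text \<open>The two claims need each other. A small warm-start error gives accurate gradients and
  thus controls \<Phi>; bounded values of \<Phi> bound the gradient and thus the step. The maximizer
  then moves at most \<kappa> times the step, and \<open>l * \<kappa> / L \<le> 1\<close> turns this
  into the next warm-start error.\<close>

lemma trajectory_invariant:
  assumes "ok u" "real k \<le> Z"
  shows "l * norm (Y u k - ymax (X u k)) \<le> 3 * (l * norm (y0 - ymax x0) + sqrt (L * \<Delta>) + \<epsilon>)
    \<and> \<Phi> (X u k) \<le> \<Phi> x0 + cost * k"
  using \<open>real k \<le> Z\<close>
proof (induction k)
  case 0
  have "a \<le> 3 * (a + b + \<epsilon>)" if "0 \<le> a" "0 \<le> b" for a b using that eps by (simp add: distrib_left)
  then show ?case unfolding st_0 using l_pos max.L_pos Delta_nonneg by simp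
next
  case (Suc k)
  let ?A = "l * norm (y0 - ymax x0) + sqrt (L * \<Delta>)"
  let ?x = "X u k" and ?G = "grad_max (X u k)"
  have k: "real k \<le> Z" using Suc.prems by simp
  note IH = conjunct1[OF Suc.IH[OF k]] conjunct2[OF Suc.IH[OF k]]
  have err: "l * norm (Y' u k - ymax ?x) \<le> e"
  proof -
    have "l * norm (Y' u k - ymax ?x) \<le> l * (contr ^ D * norm (Y u k - ymax ?x))"
      unfolding Y'_def using l_pos by (intro mult_left_mono inner_ascent_error) auto
    also have "\<dots> = contr ^ D * (l * norm (Y u k - ymax ?x))" by simp
    also have "\<dots> \<le> contr ^ D * (3 * (?A + \<epsilon>))" using IH(1) contr by (intro mult_left_mono) auto
    also have "\<dots> \<le> e" by (rule contr_power_le)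
    finally show ?thesis .
  qed
  have "norm (gh u k - ?G) \<le> e" using grad_estimate_error[of ?x "Y' u k"] err by (simp add: gh_def)
  moreover have "norm (if pert u k then u k else 0) \<le> r" using \<open>ok u\<close> r_pos by (simp add: ok_def)
  moreover have "sd u k - ?G = (if pert u k then u k else 0) + (gh u k - ?G)" by (simp add: sd_def)
  ultimately have sd: "norm (sd u k - ?G) \<le> r + e" using norm_triangle_mono by metis
  have "\<Phi> (X u (Suc k)) \<le> \<Phi> ?x - (norm ?G)\<^sup>2 / (2 * L) + (norm (sd u k - ?G))\<^sup>2 / (2 * L)"
    unfolding st_Suc by (rule max.step_decrease)
  also have "\<dots> \<le> \<Phi> ?x - 0 + cost"
    unfolding cost_def using sd max.L_pos by (intro add_mono diff_mono divide_right_mono power_mono) auto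
  finally have dec: "\<Phi> (X u (Suc k)) \<le> \<Phi> x0 + cost * real (Suc k)" using IH(2) by (simp add: algebra_simps)
  \<comment> \<open>An exact gradient step cannot fall below the minimum, so the gradient is bounded
    by the remaining gap.\<close>
  have G: "norm ?G \<le> 2 * sqrt (L * \<Delta>)"
  proof -
    have "\<Phi> xstar \<le> \<Phi> (?x - (1 / L) *\<^sub>R ?G)" by (rule xstar)
    also have "\<dots> \<le> \<Phi> ?x - (norm ?G)\<^sup>2 / (2 * L)" using max.step_decrease[of ?x ?G] by simp
    finally have "(norm ?G)\<^sup>2 / (2 * L) \<le> \<Phi> ?x - \<Phi> xstar" by simp
    also have "\<dots> \<le> \<Delta> + cost * k" using IH(2) by (simp add: \<Delta>_eq)
    also have "\<dots> \<le> \<Delta> + cost * Z" using k cost_nonneg by (intro add_left_mono mult_left_mono) auto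
    also have "\<dots> \<le> 2 * \<Delta>" using cost_Z_le Delta_nonneg by simp
    finally have "(norm ?G)\<^sup>2 \<le> 4 * (L * \<Delta>)" using max.L_pos by (simp add: field_simps)
    also have "\<dots> = (2 * sqrt (L * \<Delta>))\<^sup>2" using max.L_pos Delta_nonneg by (simp add: power_mult_distrib)
    finally show ?thesis by (rule power2_le_imp_le) (use max.L_pos Delta_nonneg in auto)
  qed
  have "l * norm (Y u (Suc k) - ymax (X u (Suc k)))
      \<le> l * (norm (Y' u k - ymax ?x) + norm (ymax ?x - ymax (X u (Suc k))))"
    unfolding st_Suc(2) using l_pos norm_triangle_ineq[of "Y' u k - ymax ?x" "ymax ?x - ymax (X u (Suc k))"]
    by (intro mult_left_mono) auto
  also have "\<dots> \<le> e + l * (\<kappa> * norm (?x - X u (Suc k)))"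
    using err ymax_lip[of ?x "X u (Suc k)"] l_pos by (simp add: distrib_left add_mono)
  also have "l * (\<kappa> * norm (?x - X u (Suc k))) = (l * \<kappa> / L) * norm (sd u k)"
    using max.L_pos by (simp add: st_Suc)
  also have "\<dots> \<le> 1 * norm (sd u k)"
  proof (intro mult_right_mono)
    have "l * \<kappa> \<le> L" using l_pos by (simp add: L_eq distrib_left)
    then show "l * \<kappa> / L \<le> 1" using max.L_pos by simp
  qed simp
  also have "norm (sd u k) \<le> norm ?G + norm (sd u k - ?G)" by (rule norm_triangle_sub)
  also have "\<dots> \<le> 2 * sqrt (L * \<Delta>) + (r + e)" using G sd by (rule add_mono)
  finally have "l * norm (Y u (Suc k) - ymax (X u (Suc k))) \<le> e + (2 * sqrt (L * \<Delta>) + (r + e))" by simp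
  moreover have "0 \<le> l * norm (y0 - ymax x0)" "0 \<le> sqrt (L * \<Delta>)" using l_pos max.L_pos Delta_nonneg by auto
  moreover have "x \<le> 3 * (a + b + \<epsilon>)" if "x \<le> e + (2 * b + (r + e))" "0 \<le> a" "0 \<le> b" for x a b
    using that e_le' re_le' eps by (simp add: distrib_left)
  ultimately have "l * norm (Y u (Suc k) - ymax (X u (Suc k))) \<le> 3 * (?A + \<epsilon>)" by blast
  then show ?case using dec by blast
qed

lemma gh_error:
  assumes "ok u" "real k \<le> Z"
  shows "norm (gh u k - grad_max (X u k)) \<le> e"
proof -
  let ?x = "X u k"
  have "norm (gh u k - grad_max ?x) \<le> l * norm (Y' u k - ymax ?x)"
    unfolding gh_def by (rule grad_estimate_error)
  also have "\<dots> \<le> l * (contr ^ D * norm (Y u k - ymax ?x))"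
    unfolding Y'_def using l_pos by (intro mult_left_mono inner_ascent_error) auto
  also have "\<dots> = contr ^ D * (l * norm (Y u k - ymax ?x))" by simp
  also have "\<dots> \<le> contr ^ D * (3 * (l * norm (y0 - ymax x0) + sqrt (L * \<Delta>) + \<epsilon>))"
    using conjunct1[OF trajectory_invariant[OF assms]] contr by (intro mult_left_mono) auto
  also have "\<dots> \<le> e" by (rule contr_power_le)
  finally show ?thesis .
qed

lemma sd_error:
  assumes "ok u" "real k \<le> Z"
  shows "norm (sd u k - grad_max (X u k)) \<le> r + e"
proof -
  have "norm (if pert u k then u k else 0) \<le> r" using \<open>ok u\<close> r_pos by (simp add: ok_def)
  moreover have "sd u k - grad_max (X u k) = (if pert u k then u k else 0) + (gh u k - grad_max (X u k))"
    by (simp add: sd_def)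
  ultimately show ?thesis using norm_triangle_mono gh_error[OF assms] by metis
qed

lemma Phi_le:
  assumes "ok u" "real k \<le> Z"
  shows "\<Phi> (X u k) - \<Phi> xstar \<le> 51 / 50 * \<Delta>"
proof -
  have "\<Phi> (X u k) - \<Phi> xstar \<le> \<Delta> + cost * k" using conjunct2[OF trajectory_invariant[OF assms]] by (simp add: \<Delta>_eq)
  also have "\<dots> \<le> \<Delta> + cost * Z" using assms(2) cost_nonneg by (intro add_left_mono mult_left_mono) auto
  finally show ?thesis using cost_Z_le by simp
qed

lemma step_cost:
  assumes "ok u" "real k \<le> Z"
  shows "\<Phi> (X u (Suc k)) \<le> \<Phi> (X u k) + cost"
proof -
  have "\<Phi> (X u (Suc k)) \<le> \<Phi> (X u k) - (norm (grad_max (X u k)))\<^sup>2 / (2 * L) + (norm (sd u k - grad_max (X u k)))\<^sup>2 / (2 * L)"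
    unfolding st_Suc by (rule max.step_decrease)
  also have "\<dots> \<le> \<Phi> (X u k) - 0 + cost"
    unfolding cost_def using sd_error[OF assms] max.L_pos by (intro add_mono diff_mono divide_right_mono power_mono) auto
  finally show ?thesis by simp
qed

text \<open>The error is at most \<open>\<epsilon> / 100\<close>, so the true gradient is at least
  0.79 \<epsilon>, and half of \<open>0.79\<^sup>2 - 0.01\<^sup>2\<close> exceeds 3/10.\<close>

lemma big_step:
  assumes "ok u" "real k \<le> Z" "\<not> small u k"
  shows "\<Phi> (X u (Suc k)) \<le> \<Phi> (X u k) - 3 / 10 * (\<epsilon>\<^sup>2 / L)"
proof -
  let ?G = "grad_max (X u k)"
  have sd: "sd u k = gh u k" using assms(3) by (simp add: sd_def pert_def)
  have err: "norm (gh u k - ?G) \<le> \<epsilon> / 100" using gh_error[OF assms(1,2)] e_le' by simp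
  then have "79 / 100 * \<epsilon> \<le> norm ?G"
    using assms(3) norm_triangle_sub[of "gh u k" ?G] by (simp add: small_def)
  then have "(79 / 100 * \<epsilon>)\<^sup>2 \<le> (norm ?G)\<^sup>2" using eps by (intro power_mono) auto
  moreover have "(norm (gh u k - ?G))\<^sup>2 \<le> (\<epsilon> / 100)\<^sup>2" using err by (intro power_mono) auto
  moreover have "(79 / 100 * \<epsilon>)\<^sup>2 = 6241 / 10000 * \<epsilon>\<^sup>2" "(\<epsilon> / 100)\<^sup>2 = \<epsilon>\<^sup>2 / 10000" "0 \<le> \<epsilon>\<^sup>2"
    by (simp_all add: power2_eq_square)
  ultimately have "6 / 10 * \<epsilon>\<^sup>2 \<le> (norm ?G)\<^sup>2 - (norm (gh u k - ?G))\<^sup>2" by linarith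
  then have "(6 / 10 * \<epsilon>\<^sup>2) / (2 * L) \<le> ((norm ?G)\<^sup>2 - (norm (gh u k - ?G))\<^sup>2) / (2 * L)"
    using max.L_pos by (intro divide_right_mono) auto
  then have "3 / 10 * (\<epsilon>\<^sup>2 / L) \<le> (norm ?G)\<^sup>2 / (2 * L) - (norm (gh u k - ?G))\<^sup>2 / (2 * L)"
    by (simp add: diff_divide_distrib)
  then show ?thesis using max.step_decrease[of "X u k" "sd u k"] by (simp add: st_Suc sd)
qed

definition "elm x \<longleftrightarrow> eps_local_min \<Phi> R \<epsilon> x"

lemma elm_iff: "elm x \<longleftrightarrow> norm (grad_max x) \<le> \<epsilon> \<and> - g \<le> lambda_min (hess_max x)"
  by (simp add: elm_def eps_local_min_def max.grad_eq max.hess_eq g_eq)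

text \<open>The threshold 4/5 leaves room for the gradient error, so local minimality can only fail
  through the curvature.\<close>

lemma small_not_elm:
  assumes "ok u" "real k \<le> Z" "small u k" "\<not> elm (X u k)"
  shows "lambda_min (hess_max (X u k)) < - g"
proof -
  have "norm (grad_max (X u k)) \<le> norm (gh u k) + norm (grad_max (X u k) - gh u k)" by (rule norm_triangle_sub)
  then have "norm (grad_max (X u k)) \<le> \<epsilon>"
    using gh_error[OF assms(1,2)] e_le' assms(3) eps by (simp add: small_def norm_minus_commute)
  then show ?thesis using assms(4) by (simp add: elm_iff)
qed

text \<open>\<open>saddle_gap\<close> at a value at most 51/50 \<Delta> above the minimum; 27/2
  times 51/50 is below 14.\<close>

lemma saddle_Delta:
  assumes "ok u" "real k \<le> Z" "small u k" "\<not> elm (X u k)"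
  shows "g ^ 3 / R\<^sup>2 \<le> 14 * \<Delta>"
proof -
  obtain v where v: "norm v = 1" "hess_max (X u k) v = lambda_min (hess_max (X u k)) *\<^sub>R v"
    using lambda_min_symmetric(2)[OF max.H_symmetric] by blast
  have "hess_max (X u k) v \<bullet> v \<le> - g" using v small_not_elm[OF assms] by (simp add: dot_square_norm)
  then have "2 / 27 * (g ^ 3 / R\<^sup>2) \<le> \<Phi> (X u k) - \<Phi> xstar"
    by (rule max.saddle_gap[OF xstar v(1) _ g_pos])
  then show ?thesis using Phi_le[OF assms(1,2)] Delta_nonneg by linarith
qed

end

lemma card_less_Suc:
  "card {j. j < Suc k \<and> Q j} = card {j. j < k \<and> Q j} + (if Q k then 1 else 0)"
proof -
  have "{j. j < Suc k \<and> Q j} = (if Q k then insert k {j. j < k \<and> Q j} else {j. j < k \<and> Q j})"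
    by (auto simp: less_Suc_eq)
  then show ?thesis by simp
qed

lemma card_less_split: "card {j. j < k \<and> Q j} + card {j. j < k \<and> \<not> Q j} = (k :: nat)"
  by (induction k) (auto simp: card_less_Suc)

context perturbed_gdmax
begin

subsection \<open>Counting perturbations\<close>

definition "K = nat \<lfloor>Z\<rfloor>"

definition "F = g ^ 3 / (8000 * R\<^sup>2 * \<iota> ^ 3)"

definition "fail u k \<longleftrightarrow> pert u k \<and> \<not> elm (X u k) \<and> \<Phi> (X u k) - F \<le> \<Phi> (X u (k + N))"

text \<open>The \<open>N\<close> steps that start with a perturbation before time \<open>K'\<close> end by time \<open>K + 1\<close>.\<close>

definition "K' = K + 2 - N"

definition "bad u \<longleftrightarrow> (\<forall>k\<le>K. \<not> elm (X u k))"

lemma K: "real K \<le> Z" "Z < real K + 1"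
  using Z_nonneg unfolding K_def by linarith+

lemma le_Z: "k \<le> K \<Longrightarrow> real k \<le> Z"
  using K(1) by (meson of_nat_mono order_trans)

text \<open>The last perturbation time grows by at least \<open>N\<close> with each perturbation. It
  starts at 0, so the first perturbation waits \<open>N\<close> steps as well.\<close>

lemma perturbation_count: "N * card {j. j < k \<and> pert u j} \<le> P u k"
proof (induction k)
  case (Suc k)
  then show ?case unfolding card_less_Suc by (auto simp: st_Suc pert_def)
qed simp

lemma P_le: "P u k \<le> k"
  using P_less[of u "k - 1"] by (cases k) (auto simp: st_0)

text \<open>Amortized counting: without a perturbation, a small gradient can occur only while the
  last perturbation is less than \<open>N\<close> steps old. The term with \<open>min\<close> counts
  these steps, and a perturbation resets it.\<close>

lemma small_count: "card {j. j < k \<and> small u j} \<le> N * card {j. j < k \<and> pert u j} + min (k - P u k) N"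
proof (induction k)
  case (Suc k)
  show ?case
  proof (cases "pert u k")
    case True
    then have "small u k" by (simp add: pert_def)
    then show ?thesis using True Suc N(3) unfolding card_less_Suc by (simp add: st_Suc)
  next
    case False
    then have "small u k \<Longrightarrow> k - P u k < N" using P_le[of u k] by (auto simp: pert_def)
    then show ?thesis using False Suc P_le[of u k] unfolding card_less_Suc by (auto simp: st_Suc)
  qed
qed simp

lemma pert_le_P: "pert u i \<Longrightarrow> i < j \<Longrightarrow> i \<le> P u j"
proof (induction j)
  case (Suc j)
  then show ?case by (cases "i = j") (auto simp: st_Suc pert_def)
qed simp

lemma big_count:
  assumes "ok u" "k \<le> Suc K"
  shows "\<Phi> (X u k) + 3 / 10 * (\<epsilon>\<^sup>2 / L) * real (card {j. j < k \<and> \<not> small u j})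
    \<le> \<Phi> x0 + cost * real (card {j. j < k \<and> small u j})"
  using assms(2)
proof (induction k)
  case 0
  then show ?case by (simp add: st_0)
next
  case (Suc k)
  then have k: "real k \<le> Z" using le_Z by simp
  show ?case unfolding card_less_Suc using Suc big_step[OF assms(1) k] step_cost[OF assms(1) k]
    by (auto simp: distrib_left)
qed

text \<open>At the end of a successful window the induction jumps back to its start, collecting the
  decrease \<open>F\<close>; any other step costs at most \<open>cost\<close>. The jump is sound
  because windows do not overlap.\<close>

lemma success_count:
  assumes "ok u" "k \<le> Suc K"
  shows "\<Phi> (X u k) + F * real (card {j. j + N \<le> k \<and> pert u j \<and> \<Phi> (X u (j + N)) < \<Phi> (X u j) - F})
    \<le> \<Phi> x0 + cost * real k"
  using assms(2)
proof (induction k rule: less_induct)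
  case (less k)
  let ?Q = "\<lambda>j. pert u j \<and> \<Phi> (X u (j + N)) < \<Phi> (X u j) - F"
  show ?case
  proof (cases "N \<le> k \<and> ?Q (k - N)")
    case True
    define j where "j = k - N"
    have j: "j + N = k" "?Q j" "j < k" using True N(3) by (auto simp: j_def)
    \<comment> \<open>Perturbations are at least \<open>N\<close> apart, so every earlier success is
      complete by time \<open>j\<close>.\<close>
    have "{i. i + N \<le> k \<and> ?Q i} = insert j {i. i + N \<le> j \<and> ?Q i}"
    proof (intro set_eqI iffI)
      fix i assume i: "i \<in> {i. i + N \<le> k \<and> ?Q i}"
      show "i \<in> insert j {i. i + N \<le> j \<and> ?Q i}"
      proof (cases "i = j")
        case False
        then have "i < j" using i j by auto
        then have "i \<le> P u j" using i pert_le_P by auto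
        then have "i + N \<le> j" using j(2) by (auto simp: pert_def)
        then show ?thesis using i by auto
      qed simp
    qed (use j N(3) in auto)
    moreover have "j \<notin> {i. i + N \<le> j \<and> ?Q i}" using N(3) by auto
    moreover have "finite {i. i + N \<le> j \<and> ?Q i}" by (rule finite_subset[of _ "{..j}"]) auto
    ultimately have "real (card {i. i + N \<le> k \<and> ?Q i}) = 1 + real (card {i. i + N \<le> j \<and> ?Q i})" by simp
    moreover have "\<Phi> (X u j) + F * real (card {i. i + N \<le> j \<and> ?Q i}) \<le> \<Phi> x0 + cost * real j"
      using less.IH[of j] j less.prems by simp
    moreover have "cost * real j \<le> cost * real k" using cost_nonneg j by (intro mult_left_mono) auto
    moreover have "\<Phi> (X u k) < \<Phi> (X u j) - F" using j by simp
    ultimately show ?thesis by (simp add: distrib_left)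
  next
    case False
    show ?thesis
    proof (cases k)
      case 0
      then show ?thesis using N(3) by (simp add: st_0)
    next
      case (Suc i)
      have "\<not> ?Q j" if "j + N = k" for j
      proof -
        have "N \<le> k" "k - N = j" using that by auto
        then show ?thesis using False by blast
      qed
      then have "{j. j + N \<le> k \<and> ?Q j} = {j. j + N \<le> i \<and> ?Q j}"
        unfolding Suc le_Suc_eq by blast
      moreover have "\<Phi> (X u i) + F * real (card {j. j + N \<le> i \<and> ?Q j}) \<le> \<Phi> x0 + cost * real i"
        using less.IH[of i] Suc less.prems by simp
      moreover have "\<Phi> (X u k) \<le> \<Phi> (X u i) + cost"
        using step_cost[OF assms(1), of i] le_Z[of i] Suc less.prems by simp
      ultimately show ?thesis using Suc by (simp add: distrib_left)
    qed
  qed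
qed

lemma F_pos: "0 < F"
  using g_pos max.rho_pos iota by (simp add: F_def)

text \<open>In this form \<open>Z / T\<close> is 125 times \<open>\<Delta> / F\<close>, which bounds
  the number of successes: they can fill only about one window in a hundred.\<close>

lemma Z_eq: "Z = 10 ^ 6 * \<iota> ^ 3 * T * (\<Delta> * R\<^sup>2 / g ^ 3)"
proof -
  have e2: "\<epsilon>\<^sup>2 = g ^ 4 / R\<^sup>2" using eps_eq by (simp add: power_divide flip: power_mult)
  show ?thesis unfolding Z_def T_def e2 using g_pos max.rho_pos by (simp add: eval_nat_numeral field_simps)
qed

text \<open>Some small gradient that is not at a local minimum gives the bound by
  \<open>saddle_Delta\<close>. Otherwise all \<open>K + 1\<close> steps are big, and as
  \<open>K + 1\<close> strictly exceeds \<open>Z\<close>, they would decrease \<Phi> by more than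
  \<Delta>; this also settles \<Delta> = 0.\<close>

lemma bad_Delta:
  assumes "ok u" "bad u"
  shows "g ^ 3 / R\<^sup>2 \<le> 14 * \<Delta>"
proof (cases "\<exists>k\<le>K. small u k")
  case True
  then show ?thesis using saddle_Delta[OF assms(1)] le_Z assms(2) by (auto simp: bad_def)
next
  case False
  then have "{j. j < Suc K \<and> small u j} = {}" "{j. j < Suc K \<and> \<not> small u j} = {..<Suc K}"
    by (auto simp: less_Suc_eq_le)
  then have c: "card {j. j < Suc K \<and> small u j} = 0" "card {j. j < Suc K \<and> \<not> small u j} = Suc K"
    by (simp_all only: card.empty card_lessThan)
  have "\<Phi> (X u (Suc K)) + 3 / 10 * (\<epsilon>\<^sup>2 / L) * (real K + 1) \<le> \<Phi> x0"
    using big_count[OF assms(1) order_refl, unfolded c] by (simp add: add.commute)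
  then have "3 / 10 * (\<epsilon>\<^sup>2 / L) * (real K + 1) \<le> \<Delta>" using xstar[of "X u (Suc K)"] by (simp add: \<Delta>_eq)
  moreover have "3 / 10 * (\<epsilon>\<^sup>2 / L) * Z < 3 / 10 * (\<epsilon>\<^sup>2 / L) * (real K + 1)"
    using K(2) eps max.L_pos by (intro mult_strict_left_mono) auto
  moreover have "3 / 10 * (\<epsilon>\<^sup>2 / L) * Z = 300000 * (\<iota> ^ 4 * \<Delta>)"
    using eps max.L_pos by (simp add: Z_def field_simps)
  moreover have "1 * \<Delta> \<le> \<iota> ^ 4 * \<Delta>" using iota Delta_nonneg by (intro mult_right_mono) auto
  ultimately show ?thesis using Delta_nonneg by linarith
qed

lemma bad_Z_pos:
  assumes "ok u" "bad u"
  shows "1000 * real N \<le> Z"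
proof -
  have W: "1 / 14 \<le> \<Delta> * R\<^sup>2 / g ^ 3"
    using bad_Delta[OF assms] g_pos max.rho_pos by (simp add: field_simps)
  have "16 ^ 3 \<le> \<iota> ^ 3" using iota by (intro power_mono) auto
  then have "10 ^ 6 * 16 ^ 3 * T * (1 / 14) \<le> Z" unfolding Z_eq
    using W T_ge iota by (intro mult_mono) auto
  then show ?thesis using N(2) T_ge by simp
qed

text \<open>Big gradients use up at most one percent of the time, so nearly all of it is spent
  waiting for perturbations to become possible. Hence almost \<open>Z / N\<close> perturbations
  occur, and few of them can succeed.\<close>

lemma bad_fail_count:
  assumes "ok u" "bad u"
  shows "9 / 10 * (Z / N) \<le> real (card {k. k < K' \<and> fail u k})"
proof -
  define q where "q = Z / N"
  define W where "W = \<Delta> * R\<^sup>2 / g ^ 3"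
  let ?Q = "\<lambda>j. pert u j \<and> \<Phi> (X u (j + N)) < \<Phi> (X u j) - F"
  have n: "0 < real N" using N(3) by simp
  have q: "1000 \<le> q" using bad_Z_pos[OF assms] n by (simp add: q_def field_simps)
  have Z1: "1000 \<le> Z" using bad_Z_pos[OF assms] N(3) by simp
  have W: "0 \<le> W" using Delta_nonneg g_pos by (simp add: W_def)
  have N_le: "real N \<le> 17 / 16 * T" using N(2) T_ge by simp
  have NK: "N \<le> K + 1"
  proof -
    have "real N \<le> real K + 1" using bad_Z_pos[OF assms] K(2) n by linarith
    then show ?thesis by simp
  qed
  have K': "real K' = real K + 2 - real N" "K' \<le> Suc K" using NK N(3) by (auto simp: K'_def of_nat_diff)
  have low: "\<Phi> x0 - \<Phi> (X u k) \<le> \<Delta>" for k using xstar[of "X u k"] by (simp add: \<Delta>_eq)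
  have cost_K: "cost * real k \<le> \<Delta> / 25" if "k \<le> Suc K" for k
  proof -
    have "real k \<le> 2 * Z" using that K(1) Z1 by linarith
    then have "cost * real k \<le> cost * (2 * Z)" using cost_nonneg by (rule mult_left_mono)
    then show ?thesis using cost_Z_le by simp
  qed
  let ?big = "real (card {j. j < K' \<and> \<not> small u j})"
  let ?small = "real (card {j. j < K' \<and> small u j})"
  let ?pert = "real (card {j. j < K' \<and> pert u j})"
  let ?succ = "real (card {j. j + N \<le> Suc K \<and> ?Q j})"
  let ?fail = "real (card {k. k < K' \<and> fail u k})"
  have big: "?big \<le> Z / 100"
  proof -
    have "card {j. j < K' \<and> small u j} \<le> card {..<K'}" by (intro card_mono) auto
    then have "cost * ?small \<le> \<Delta> / 25" using cost_K[of "card {j. j < K' \<and> small u j}"] K'(2) by simp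
    then have "3 / 10 * (\<epsilon>\<^sup>2 / L) * ?big \<le> 26 / 25 * \<Delta>"
      using big_count[OF assms(1) K'(2)] low[of K'] by linarith
    then have "?big \<le> 26 / 25 * \<Delta> / (3 / 10 * (\<epsilon>\<^sup>2 / L))" using eps max.L_pos by (simp add: field_simps)
    also have "\<dots> = 52 / 15 * (L * \<Delta> / \<epsilon>\<^sup>2)" using eps max.L_pos by (simp add: field_simps)
    also have "\<dots> \<le> (10 ^ 6 * \<iota> ^ 4 / 100) * (L * \<Delta> / \<epsilon>\<^sup>2)"
    proof (intro mult_right_mono)
      have "1 \<le> \<iota> ^ 4" using iota by simp
      then show "52 / 15 \<le> 10 ^ 6 * \<iota> ^ 4 / 100" by simp
    qed (use max.L_pos Delta_nonneg in auto)
    finally show ?thesis by (simp add: Z_def mult_ac)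
  qed
  have succ: "?succ \<le> q / 100"
  proof -
    have "F * ?succ \<le> 26 / 25 * \<Delta>"
      using success_count[OF assms(1) order_refl] low[of "Suc K"] cost_K[of "Suc K"] by linarith
    then have "?succ \<le> 26 / 25 * \<Delta> / F" using F_pos by (simp add: field_simps)
    also have "\<dots> = 8320 * (\<iota> ^ 3 * W)" using g_pos max.rho_pos iota by (simp add: F_def W_def field_simps)
    also have "\<dots> \<le> q / 100"
    proof -
      have "16 / 17 * 10 ^ 6 * (\<iota> ^ 3 * W) * real N \<le> 16 / 17 * 10 ^ 6 * (\<iota> ^ 3 * W) * (17 / 16 * T)"
        using N_le W iota by (intro mult_left_mono) auto
      also have "\<dots> = Z" by (simp add: Z_eq W_def)
      finally have "16 / 17 * 10 ^ 6 * (\<iota> ^ 3 * W) \<le> q" using n by (simp add: q_def field_simps)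
      moreover have "0 \<le> \<iota> ^ 3 * W" using W iota by simp
      moreover have "8320 * V \<le> q / 100" if "16 / 17 * 10 ^ 6 * V \<le> q" "0 \<le> V" for V
        using that by simp
      ultimately show ?thesis by blast
    qed
    finally show ?thesis .
  qed
  have split: "real K' = ?small + ?big"
    by (simp add: card_less_split flip: of_nat_add)
  have small: "?small \<le> real N * (?pert + 1)"
  proof -
    have "card {j. j < K' \<and> small u j} \<le> N * card {j. j < K' \<and> pert u j} + N"
      using small_count[of K' u] by linarith
    then have "?small \<le> real (N * card {j. j < K' \<and> pert u j} + N)" by (rule of_nat_mono)
    then show ?thesis by (simp add: distrib_left)
  qed
  \<comment> \<open>One extra \<open>N\<close> is the stretch after the last perturbation, the other
    one the windows cut off at the end, where \<open>K'\<close> replaces \<open>K\<close>.\<close>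
  have "Z \<le> real N * (?pert + 2) + Z / 100"
    using split small big K'(1) K(2) by (simp add: distrib_left)
  then have "q \<le> ?pert + 2 + q / 100" using n by (simp add: q_def field_simps)
  moreover have "?pert \<le> ?fail + ?succ"
  proof -
    have "{j. j < K' \<and> pert u j} \<subseteq> {k. k < K' \<and> fail u k} \<union> {j. j + N \<le> Suc K \<and> ?Q j}"
      using assms(2) K'(2) NK by (auto simp: fail_def bad_def K'_def not_le)
    then have "card {j. j < K' \<and> pert u j} \<le> card ({k. k < K' \<and> fail u k} \<union> {j. j + N \<le> Suc K \<and> ?Q j})"
      by (intro card_mono finite_UnI) (auto intro: finite_subset[of _ "{..Suc K}"])
    also have "\<dots> \<le> card {k. k < K' \<and> fail u k} + card {j. j + N \<le> Suc K \<and> ?Q j}" by (rule card_Un_le)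
    finally show ?thesis by linarith
  qed
  \<comment> \<open>What remains is \<open>0.98 * q - 2\<close>, and \<open>q\<close> is at least
    1000.\<close>
  ultimately show ?thesis using succ q unfolding q_def[symmetric] by linarith
qed

lemma perturbation_count_le: "real (card {k. k < K' \<and> pert u k}) \<le> Z / N"
proof -
  have "N * card {k. k < K' \<and> pert u k} \<le> K"
  proof -
    have "P u K' \<le> K"
    proof (cases "K' = 0")
      case False
      then have "P u K' \<le> K' - 1" using P_less[of u "K' - 1"] by simp
      moreover have "K' - 1 \<le> K" using N(3) by (simp add: K'_def)
      ultimately show ?thesis by linarith
    qed (simp add: st_0)
    then show ?thesis using perturbation_count[of K' u] by linarith
  qed
  then have "real N * real (card {k. k < K' \<and> pert u k}) \<le> real K" by (simp flip: of_nat_mult)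
  then show ?thesis using K(1) N(3) by (simp add: field_simps)
qed

subsection \<open>Failing perturbations\<close>

lemma ok_upd: "ok u \<Longrightarrow> norm v \<le> r \<Longrightarrow> ok (u(k := v))"
  by (simp add: ok_def)

text \<open>Both runs share the history before \<open>k\<close>, hence the saddle, the gradient
  estimate there and the direction \<open>w\<close>. No other perturbation occurs in the next
  \<open>N\<close> steps, so both are inexact gradient paths as in
  \<open>stuck_pair_close\<close>.\<close>

lemma fail_pair_close:
  assumes "ok u" "k < K'" and w: "norm w = 1" "hess_max (X u k) w = lambda_min (hess_max (X u k)) *\<^sub>R w"
    and v: "norm v \<le> r" "norm v' \<le> r" "fail (u(k := v)) k" "fail (u(k := v')) k"
    and d: "0 \<le> d" "v' - v = d *\<^sub>R w"
  shows "d \<le> L * g * p / (8 * R * \<iota>)"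
proof -
  define a where "a = u(k := v)"
  define b where "b = u(k := v')"
  have ok: "ok a" "ok b" using ok_upd assms(1) v by (auto simp: a_def b_def)
  have ak: "X a k = X u k" "gh a k = gh u k" "pert a k = pert u k"
    and bk: "X b k = X u k" "gh b k = gh u k" "pert b k = pert u k"
    using st_upd[of k k u] by (auto simp: a_def b_def)
  have pert: "pert u k" "pert a k" "pert b k" using v(3) ak(3) bk(3) by (auto simp: fail_def a_def)
  \<comment> \<open>This is the purpose of \<open>K'\<close>: the whole window stays where the
    gradient errors are controlled.\<close>
  have tk: "k + t \<le> K" if "t < N" for t using \<open>k < K'\<close> that by (auto simp: K'_def)
  have kK: "real k \<le> Z" using tk[of 0] N(3) le_Z by auto
  have small: "small u k" "\<not> elm (X u k)"
    using pert v(3) ak by (auto simp: pert_def fail_def a_def)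
  have lam: "g \<le> - lambda_min (hess_max (X u k))" using small_not_elm[OF assms(1) kK small] by simp
  have err: "norm (sd c (k + t) - grad_max (X c (k + t))) \<le> e" if "ok c" "pert c k" "1 \<le> t" "t < N" for c t
  proof -
    have "sd c (k + t) = gh c (k + t)" using not_pert_after_pert[OF that(2-4)] by (simp add: sd_def)
    then show ?thesis using gh_error[OF that(1) le_Z[OF tk[OF that(4)]]] by simp
  qed
  show ?thesis unfolding p_eq
  proof (rule max.stuck_pair_close[where N=N and r=r and e=e and c="X u k" and v=w
      and \<gamma>="- lambda_min (hess_max (X u k))"
      and z="\<lambda>t. X a (k + t)" and s="\<lambda>t. sd a (k + t)" and z'="\<lambda>t. X b (k + t)" and s'="\<lambda>t. sd b (k + t)"])
    show "real N \<le> \<iota> * L / g + 1" "\<iota> * L / g < real N" using N by (auto simp: T_def mult.commute)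
    show "X a (k + Suc t) = X a (k + t) - (1 / L) *\<^sub>R sd a (k + t)"
      "X b (k + Suc t) = X b (k + t) - (1 / L) *\<^sub>R sd b (k + t)" for t by (simp_all add: st_Suc)
    show "norm (sd a (k + 0) - grad_max (X u k)) \<le> r + e" "norm (sd b (k + 0) - grad_max (X u k)) \<le> r + e"
      using sd_error[OF ok(1) kK] sd_error[OF ok(2) kK] ak bk by auto
    show "\<Phi> (X u k) - g ^ 3 / (8000 * R\<^sup>2 * \<iota> ^ 3) \<le> \<Phi> (X a (k + N))"
      "\<Phi> (X u k) - g ^ 3 / (8000 * R\<^sup>2 * \<iota> ^ 3) \<le> \<Phi> (X b (k + N))"
      using v(3,4) ak bk by (auto simp: fail_def F_def a_def b_def)
    show "hess_max (X u k) w = - (- lambda_min (hess_max (X u k))) *\<^sub>R w" using w(2) by simp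
    show "- (- lambda_min (hess_max (X u k))) * (norm w')\<^sup>2 \<le> hess_max (X u k) w' \<bullet> w'" for w'
      using lambda_min_symmetric(1)[OF max.H_symmetric] by simp
    show "sd b (k + 0) - sd a (k + 0) = d *\<^sub>R w"
      using pert ak bk d(2) by (simp add: sd_def) (simp add: a_def b_def)
  qed (use g_pos g_le iota iota_powr w d lam ak bk ok pert err in \<open>auto simp: r_eq e_eq eps_eq p_eq\<close>)
qed

subsection \<open>Measurability\<close>

lemma continuous_grad: "continuous_on UNIV (grad f)"
  by (rule lipschitz_on_continuous_on[OF lip])

lemma continuous_grad_x: "continuous_on UNIV (\<lambda>z. grad_x f (fst z) (snd z))"
  unfolding grad_x_eq using continuous_on_fst[OF continuous_grad] by simp

lemma continuous_inner_ascent: "continuous_on UNIV (\<lambda>z. inner_ascent f \<tau> k (fst z) (snd z))"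
proof (induction k)
  case 0
  then show ?case by (simp add: inner_ascent_def continuous_on_snd)
next
  case (Suc k)
  let ?h = "\<lambda>z. inner_ascent f \<tau> k (fst z) (snd z)"
  have "continuous_on UNIV (\<lambda>z. grad f (fst z, ?h z))"
    by (rule continuous_on_compose2[OF continuous_grad]) (auto intro!: continuous_on_Pair continuous_on_fst Suc)
  then have "continuous_on UNIV (\<lambda>z. ?h z + \<tau> *\<^sub>R snd (grad f (fst z, ?h z)))"
    by (intro continuous_on_add continuous_on_scaleR continuous_on_const continuous_on_snd Suc)
  then show ?case by (simp add: inner_ascent_def grad_y_eq)
qed

lemma continuous_Phi: "continuous_on UNIV \<Phi>"
  using max.F_deriv by (metis has_derivative_continuous continuous_at_imp_continuous_on)

text \<open>The gradient and, by Weyl's inequality, the smallest eigenvalue of the Hessian are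
  continuous in \<open>x\<close>, so the set is closed.\<close>

lemma elm_borel: "{x. elm x} \<in> sets borel"
proof -
  have G: "continuous_on UNIV grad_max"
    using max.G_deriv by (metis has_derivative_continuous continuous_at_imp_continuous_on)
  have "\<bar>lambda_min (hess_max x) - lambda_min (hess_max y)\<bar> \<le> R * norm (x - y)" for x y
    using lambda_min_lipschitz[OF max.H_symmetric max.H_symmetric, of x y]
      lambda_min_lipschitz[OF max.H_symmetric max.H_symmetric, of y x] max.H_lip[of x y] max.H_lip[of y x]
    by (simp add: norm_minus_commute abs_le_iff)
  then have "R-lipschitz_on UNIV (\<lambda>x. lambda_min (hess_max x))"
    using max.rho_pos by (intro lipschitz_onI) (auto simp: dist_norm)
  then have "continuous_on UNIV (\<lambda>x. lambda_min (hess_max x))" by (rule lipschitz_on_continuous_on)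
  then have "closed ({x. norm (grad_max x) \<le> \<epsilon>} \<inter> {x. - g \<le> lambda_min (hess_max x)})"
    using G by (intro closed_Int closed_Collect_le continuous_intros)
  moreover have "{x. elm x} = {x. norm (grad_max x) \<le> \<epsilon>} \<inter> {x. - g \<le> lambda_min (hess_max x)}"
    by (auto simp: elm_iff)
  ultimately show ?thesis by (simp add: borel_closed)
qed

text \<open>Carries only the product sigma-algebra, which it shares with
  \<open>perturbations r\<close>, so that measurability is settled independently of the
  distribution.\<close>

definition "B = (\<Pi>\<^sub>M k\<in>(UNIV :: nat set). (borel :: (real ^ 'd) measure))"

lemma component_measurable [measurable]: "(\<lambda>u. u k) \<in> borel_measurable B"
  unfolding B_def by (rule measurable_component_singleton) simp

lemma gh_measurable_aux:
  assumes "(\<lambda>u. X u k) \<in> borel_measurable B" "(\<lambda>u. Y u k) \<in> borel_measurable B"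
  shows "(\<lambda>u. Y' u k) \<in> borel_measurable B" "(\<lambda>u. gh u k) \<in> borel_measurable B"
proof -
  have "(\<lambda>u. (X u k, Y u k)) \<in> borel_measurable B" using assms by (rule borel_measurable_Pair)
  from measurable_compose[OF this borel_measurable_continuous_onI[OF continuous_inner_ascent]]
  show Y': "(\<lambda>u. Y' u k) \<in> borel_measurable B" by (simp add: Y'_def)
  have "(\<lambda>u. (X u k, Y' u k)) \<in> borel_measurable B" using assms(1) Y' by (rule borel_measurable_Pair)
  from measurable_compose[OF this borel_measurable_continuous_onI[OF continuous_grad_x]]
  show "(\<lambda>u. gh u k) \<in> borel_measurable B" by (simp add: gh_def)
qed

lemma pert_measurable_aux:
  assumes [measurable]: "(\<lambda>u. gh u k) \<in> borel_measurable B" "(\<lambda>u. P u k) \<in> measurable B (count_space UNIV)"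
  shows "Measurable.pred B (\<lambda>u. pert u k)"
  unfolding pert_def small_def by measurable

lemma st_measurable:
  "(\<lambda>u. X u k) \<in> borel_measurable B \<and> (\<lambda>u. Y u k) \<in> borel_measurable B
    \<and> (\<lambda>u. P u k) \<in> measurable B (count_space UNIV)"
proof (induction k)
  case 0
  show ?case by (simp add: st_0)
next
  case (Suc k)
  then have [measurable]: "(\<lambda>u. X u k) \<in> borel_measurable B" "(\<lambda>u. P u k) \<in> measurable B (count_space UNIV)"
    by auto
  have [measurable]: "(\<lambda>u. Y' u k) \<in> borel_measurable B" "(\<lambda>u. gh u k) \<in> borel_measurable B"
    using gh_measurable_aux Suc by auto
  have [measurable]: "Measurable.pred B (\<lambda>u. pert u k)" by (rule pert_measurable_aux) measurable
  have "(\<lambda>u. X u k - (1 / L) *\<^sub>R (gh u k + (if pert u k then u k else 0))) \<in> borel_measurable B"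
    by measurable
  moreover have "(\<lambda>u. if pert u k then k else P u k) \<in> measurable B (count_space UNIV)" by measurable
  ultimately show ?case by (simp add: st_Suc sd_def)
qed

lemma X_measurable [measurable]: "(\<lambda>u. X u k) \<in> borel_measurable B"
  using st_measurable by blast

lemma pert_measurable [measurable]: "Measurable.pred B (\<lambda>u. pert u k)"
  using st_measurable gh_measurable_aux by (intro pert_measurable_aux) auto

lemma elm_measurable [measurable]: "Measurable.pred B (\<lambda>u. elm (X u k))"
proof -
  have "Measurable.pred borel elm" using elm_borel by (simp add: pred_def)
  from measurable_compose[OF X_measurable this] show ?thesis .
qed

lemma fail_measurable [measurable]: "Measurable.pred B (\<lambda>u. fail u k)"
proof -
  have \<Phi>: "(\<lambda>u. \<Phi> (X u j)) \<in> borel_measurable B" for j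
    using measurable_compose[OF X_measurable borel_measurable_continuous_onI[OF continuous_Phi]] .
  have "Measurable.pred B (\<lambda>u. \<Phi> (X u k) - F \<le> \<Phi> (X u (k + N)))"
    unfolding pred_def by (intro borel_measurable_le borel_measurable_diff \<Phi> borel_measurable_const)
  then show ?thesis unfolding fail_def
    by (intro pred_intros_logic pert_measurable elm_measurable)
qed

definition "U = uniform_measure lborel (cball (0 :: real ^ 'd) r)"

lemma emeasure_ball: "emeasure lborel (cball (0 :: real ^ 'd) r) \<noteq> 0" "emeasure lborel (cball (0 :: real ^ 'd) r) \<noteq> \<infinity>"
proof -
  have "0 < measure lborel (cball (0 :: real ^ 'd) r)" using r_pos by (simp add: content_cball_pos)
  then show "emeasure lborel (cball (0 :: real ^ 'd) r) \<noteq> 0" by (auto simp: measure_def)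
  show "emeasure lborel (cball (0 :: real ^ 'd) r) \<noteq> \<infinity>" using r_pos by (simp add: emeasure_cball)
qed

lemma prob_space_U: "prob_space U"
  unfolding U_def by (rule prob_space_uniform_measure[OF emeasure_ball])

lemma sets_perturbations: "sets (perturbations r) = sets B"
  unfolding perturbations_def B_def by (intro sets_PiM_cong) auto

lemma space_perturbations: "space (perturbations r :: (nat \<Rightarrow> real ^ 'd) measure) = UNIV"
  using sets_eq_imp_space_eq[OF sets_perturbations] by (simp add: B_def space_PiM PiE_UNIV_domain)

lemma upd_measurable: "(\<lambda>v. u(k := v)) \<in> measurable borel B"
proof -
  have "(\<lambda>v i. if i = k then v else u i) \<in> measurable borel B"
    unfolding B_def by (rule measurable_PiM_single') (auto simp: PiE_UNIV_domain)
  then show ?thesis by (simp add: fun_upd_def)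
qed

text \<open>With \<open>c\<close> the lower bound on \<delta>, the number of packed translates is
  5.12 / \<open>c\<close>, hence at least 5 / \<delta>. The subtracted 1 is at most 1 / \<delta>,
  and \<open>exp (- 1 / 2)\<close> is at least 1/2.\<close>

lemma volume_ratio_le:
  assumes "0 \<le> m" "exp (- 1 / 2) * (2 * r / (sqrt CARD('d) * (2 * (L * g * p / (8 * R * \<iota>)))) - 1) * m \<le> V"
  shows "2 / \<delta> * m \<le> V"
proof -
  define c where "c = 256 * \<iota>\<^sup>2 * (L / g) * sqrt CARD('d) * p"
  have c: "0 < c" "c \<le> \<delta>"
    using delta(1) iota g_pos max.L_pos p_pos by (auto simp: c_def)
  have "2 * r / (sqrt CARD('d) * (2 * (L * g * p / (8 * R * \<iota>)))) = 128 / 25 / c"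
    using iota g_pos max.L_pos p_pos max.rho_pos
    by (simp add: c_def r_eq eps_eq power2_eq_square power3_eq_cube field_simps)
  moreover have "128 / 25 / \<delta> \<le> 128 / 25 / c" using c by (intro divide_left_mono) auto
  moreover have "1 \<le> 1 / \<delta>" using c delta(2) by simp
  ultimately have "4 / \<delta> \<le> 2 * r / (sqrt CARD('d) * (2 * (L * g * p / (8 * R * \<iota>)))) - 1" by simp
  moreover have "1 / 2 \<le> exp (- 1 / 2 :: real)" using exp_ge_add_one_self[of "- 1 / 2 :: real"] by simp
  ultimately have "1 / 2 * (4 / \<delta>) \<le> exp (- 1 / 2) * (2 * r / (sqrt CARD('d) * (2 * (L * g * p / (8 * R * \<iota>)))) - 1)"
    using c by (intro mult_mono) auto
  then have "1 / 2 * (4 / \<delta>) * m \<le> exp (- 1 / 2) * (2 * r / (sqrt CARD('d) * (2 * (L * g * p / (8 * R * \<iota>)))) - 1) * m"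
    using \<open>0 \<le> m\<close> by (rule mult_right_mono)
  then show ?thesis using assms(2) by simp
qed

text \<open>With all other coordinates fixed, the failing values of coordinate \<open>k\<close> form
  a thin set along \<open>w\<close>. The indicator is kept because expected failures are compared
  with expected perturbations.\<close>

lemma fail_prob:
  assumes "ok u" "k < K'"
  shows "emeasure U {v. fail (u(k := v)) k} \<le> ennreal (\<delta> / 2) * indicator {u. pert u k} u"
proof (cases "pert u k \<and> \<not> elm (X u k)")
  case False
  then have "{v. fail (u(k := v)) k} = {}" using st_upd[of k k u] by (auto simp: fail_def)
  then show ?thesis by simp
next
  case True
  have "Measurable.pred borel (\<lambda>v. fail (u(k := v)) k)"
    using measurable_compose[OF upd_measurable fail_measurable] .
  then have fail: "{v. fail (u(k := v)) k} \<in> sets borel" by (simp add: pred_def)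
  define A where "A = cball 0 r \<inter> {v. fail (u(k := v)) k}"
  have A: "A \<in> sets borel" "A \<subseteq> cball 0 r" using fail by (auto simp: A_def)
  obtain w where w: "norm w = 1" "hess_max (X u k) w = lambda_min (hess_max (X u k)) *\<^sub>R w"
    using lambda_min_symmetric(2)[OF max.H_symmetric] by blast
  define d0 where "d0 = L * g * p / (8 * R * \<iota>)"
  have d0: "0 < d0" using max.L_pos g_pos p_pos max.rho_pos iota by (simp add: d0_def)
  have "exp (- 1 / 2) * (2 * r / (sqrt CARD('d) * (2 * d0)) - 1) * measure lborel A \<le> measure lborel (cball (0 :: real ^ 'd) r)"
  proof (rule measure_thin_set[OF A r_pos _ w(1)])
    show "0 < 2 * d0" using d0 by simp
    fix x y d assume "x \<in> A" "y \<in> A" "0 \<le> d" "y - x = d *\<^sub>R w"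
    then have "d \<le> d0" unfolding d0_def by (intro fail_pair_close[OF assms w, of x y]) (auto simp: A_def)
    \<comment> \<open>Doubling the width makes the inequality strict, as disjointness of the
      translates requires.\<close>
    then show "d < 2 * d0" using d0 by simp
  qed
  then have "2 / \<delta> * measure lborel A \<le> measure lborel (cball (0 :: real ^ 'd) r)"
    unfolding d0_def by (intro volume_ratio_le) auto
  moreover have pos: "0 < measure lborel (cball (0 :: real ^ 'd) r)"
    using r_pos by (simp add: content_cball_pos)
  ultimately have "measure lborel A / measure lborel (cball (0 :: real ^ 'd) r) \<le> \<delta> / 2"
    using delta_pos by (simp add: field_simps)
  moreover have "measure U {v. fail (u(k := v)) k} = measure lborel A / measure lborel (cball (0 :: real ^ 'd) r)"
    unfolding U_def A_def using fail by (intro measure_uniform_measure emeasure_ball) auto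
  ultimately have "measure U {v. fail (u(k := v)) k} \<le> \<delta> / 2" by simp
  then show ?thesis
    using True prob_space.finite_measure[OF prob_space_U] by (simp add: finite_measure.emeasure_eq_measure ennreal_leI)
qed

subsection \<open>Probabilities\<close>

lemma AE_ok: "AE u in (perturbations r :: (nat \<Rightarrow> real ^ 'd) measure). ok u"
proof -
  interpret product_prob_space "\<lambda>_::nat. U" UNIV
    using prob_space_U by (simp add: product_prob_space_def product_prob_space_axioms_def product_sigma_finite_def prob_space_imp_sigma_finite)
  have "AE v in U. norm v \<le> r"
    unfolding U_def using emeasure_ball by (intro AE_uniform_measureI) auto
  then have "AE u in (perturbations r :: (nat \<Rightarrow> real ^ 'd) measure). norm (u k) \<le> r" for k
    unfolding perturbations_def U_def[symmetric] by (intro AE_component) auto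
  then have "\<forall>k. AE u in (perturbations r :: (nat \<Rightarrow> real ^ 'd) measure). norm (u k) \<le> r" by blast
  then show ?thesis unfolding ok_def AE_all_countable[symmetric] .
qed

lemma prob_space_perturbations: "prob_space (perturbations r :: (nat \<Rightarrow> real ^ 'd) measure)"
  unfolding perturbations_def U_def[symmetric] by (intro prob_space_PiM prob_space_U)

text \<open>Resampling coordinate \<open>k\<close> does not change the distribution, and whether
  iteration \<open>k\<close> perturbs does not depend on it. By Fubini, \<open>fail_prob\<close> is
  then integrated over the history.\<close>

lemma fail_prob_le:
  assumes "k < K'"
  shows "measure (perturbations r) {u. fail u k} \<le> \<delta> / 2 * measure (perturbations r) {u. pert u k}"
proof -
  let ?P = "perturbations r :: (nat \<Rightarrow> real ^ 'd) measure"
  interpret U: prob_space U by (rule prob_space_U)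
  interpret P: prob_space ?P by (rule prob_space_perturbations)
  interpret pair: pair_prob_space U ?P ..
  have P_def: "?P = Pi\<^sub>M UNIV (\<lambda>_. U)" by (simp add: perturbations_def U_def)
  have spB: "space B = UNIV" using sets_eq_imp_space_eq[OF sets_perturbations] space_perturbations by metis
  have F: "{u. fail u k} \<in> sets ?P" and Q: "{u. pert u k} \<in> sets ?P"
    using fail_measurable[of k] pert_measurable[of k] by (simp_all add: sets_perturbations pred_def spB)
  have "distr (U \<Otimes>\<^sub>M ?P) ?P (\<lambda>(v, u). u(k := v)) = ?P"
    unfolding P_def using distr_pair_PiM_eq_PiM[of UNIV "\<lambda>_. U" k] prob_space_U by simp
  moreover have upd: "(\<lambda>(v, u). u(k := v)) \<in> measurable (U \<Otimes>\<^sub>M ?P) ?P"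
  proof -
    have "(\<lambda>w i. if i = k then fst w else snd w i) \<in> measurable (U \<Otimes>\<^sub>M ?P) ?P"
      unfolding P_def by (rule measurable_PiM_single') (auto simp: space_PiM space_pair_measure)
    then show ?thesis by (simp add: fun_upd_def case_prod_beta')
  qed
  ultimately have "emeasure ?P {u. fail u k} = emeasure (U \<Otimes>\<^sub>M ?P) ((\<lambda>(v, u). u(k := v)) -` {u. fail u k} \<inter> space (U \<Otimes>\<^sub>M ?P))"
    using F by (metis emeasure_distr)
  also have "\<dots> = (\<integral>\<^sup>+u. emeasure U ((\<lambda>v. (v, u)) -` ((\<lambda>(v, u). u(k := v)) -` {u. fail u k} \<inter> space (U \<Otimes>\<^sub>M ?P))) \<partial>?P)"
    using measurable_sets[OF upd F] by (rule pair.emeasure_pair_measure_alt2)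
  also have "\<dots> = (\<integral>\<^sup>+u. emeasure U {v. fail (u(k := v)) k} \<partial>?P)"
    by (intro nn_integral_cong arg_cong2[where f=emeasure]) (auto simp: space_pair_measure space_perturbations U_def)
  also have "\<dots> \<le> (\<integral>\<^sup>+u. ennreal (\<delta> / 2) * indicator {u. pert u k} u \<partial>?P)"
    using AE_ok by (intro nn_integral_mono_AE) (auto elim!: eventually_mono intro: fail_prob[OF _ assms])
  also have "\<dots> = ennreal (\<delta> / 2) * emeasure ?P {u. pert u k}"
    using Q by (rule nn_integral_cmult_indicator)
  finally have "ennreal (P.prob {u. fail u k}) \<le> ennreal (\<delta> / 2) * ennreal (P.prob {u. pert u k})"
    by (simp add: P.emeasure_eq_measure)
  then show ?thesis using delta_pos by (simp add: ennreal_mult'[symmetric] ennreal_le_iff)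
qed

text \<open>With \<open>q = Z / N\<close>: a bad run has at least \<open>9 / 10 * q\<close>
  failures, and no run has more than \<open>q\<close> perturbations. Taking expectations,
  \<open>q\<close> cancels.\<close>

lemma local_min_probability:
  "1 - \<delta> \<le> measure (perturbations r) {u. \<exists>k\<le>K. elm (X u k)}"
proof -
  let ?P = "perturbations r :: (nat \<Rightarrow> real ^ 'd) measure"
  interpret P: prob_space ?P by (rule prob_space_perturbations)
  have spB: "space B = UNIV" using sets_eq_imp_space_eq[OF sets_perturbations] space_perturbations by metis
  have meas: "{u. fail u k} \<in> P.events" "{u. pert u k} \<in> P.events" "{u. elm (X u k)} \<in> P.events" for k
    using fail_measurable[of k] pert_measurable[of k] elm_measurable[of k]
    by (simp_all add: sets_perturbations pred_def spB)
  have good: "{u. \<exists>k\<le>K. elm (X u k)} \<in> P.events"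
  proof -
    have "{u. \<exists>k\<le>K. elm (X u k)} = (\<Union>k\<le>K. {u. elm (X u k)})" by auto
    then show ?thesis using meas(3) by simp
  qed
  have bad_eq: "{u. bad u} = space ?P - {u. \<exists>k\<le>K. elm (X u k)}" by (auto simp: bad_def space_perturbations)
  then have bad: "{u. bad u} \<in> P.events" using good by simp
  have "P.prob {u. bad u} \<le> \<delta>"
  proof (cases "\<exists>u. ok u \<and> bad u")
    case False
    then have "AE u in ?P. u \<notin> {u. bad u}" using AE_ok by (auto elim!: eventually_mono)
    then have "P.prob {u. bad u} = 0" using bad by (simp add: P.prob_eq_0)
    then show ?thesis using delta_pos by simp
  next
    case True
    \<comment> \<open>A single admissible bad run already forces \<open>q\<close> to be positive, so
      that it may be cancelled below.\<close>
    define q where "q = Z / N"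
    have q: "0 < q"
    proof -
      have "1000 * real N \<le> Z" using True bad_Z_pos by blast
      moreover have "1 \<le> real N" using N(3) by simp
      ultimately show ?thesis by (simp add: q_def)
    qed
    have int: "integrable ?P (\<lambda>u. \<Sum>k<K'. indicat_real {u. fail u k} u)"
      "integrable ?P (\<lambda>u. \<Sum>k<K'. indicat_real {u. pert u k} u)"
      using meas by (auto intro!: Bochner_Integration.integrable_sum integrable_real_indicator simp: P.emeasure_eq_measure)
    have count: "(\<Sum>k<K'. indicat_real {u. Q u k} u) = real (card {k. k < K' \<and> Q u k})" for Q u
    proof -
      have "(\<Sum>k<K'. indicat_real {u. Q u k} u) = (\<Sum>k\<in>{..<K'}. if Q u k then 1 else 0)"
        by (intro sum.cong) (auto simp: indicator_def)
      also have "\<dots> = (\<Sum>k\<in>{k \<in> {..<K'}. Q u k}. 1)" by (rule sum.inter_filter[symmetric]) simp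
      finally show ?thesis by simp
    qed
    have "9 / 10 * q * P.prob {u. bad u} = (LINT u|?P. 9 / 10 * q * indicat_real {u. bad u} u)"
      using bad by simp
    also have "\<dots> \<le> (LINT u|?P. (\<Sum>k<K'. indicat_real {u. fail u k} u))"
    proof (rule integral_mono_AE)
      show "AE u in ?P. 9 / 10 * q * indicat_real {u. bad u} u \<le> (\<Sum>k<K'. indicat_real {u. fail u k} u)"
        using AE_ok
      proof eventually_elim
        case (elim u)
        show ?case unfolding count using bad_fail_count[OF elim] by (cases "bad u") (auto simp: q_def)
      qed
      show "integrable ?P (\<lambda>u. 9 / 10 * q * indicat_real {u. bad u} u)"
        using bad by (intro integrable_mult_right integrable_real_indicator) (auto simp: P.emeasure_eq_measure)
    qed (rule int)
    also have "\<dots> = (\<Sum>k<K'. P.prob {u. fail u k})"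
      using meas by (subst Bochner_Integration.integral_sum)
        (auto intro!: integrable_real_indicator simp: P.emeasure_eq_measure)
    also have "\<dots> \<le> (\<Sum>k<K'. \<delta> / 2 * P.prob {u. pert u k})" by (intro sum_mono fail_prob_le) auto
    also have "\<dots> = \<delta> / 2 * (LINT u|?P. (\<Sum>k<K'. indicat_real {u. pert u k} u))"
      using meas by (subst Bochner_Integration.integral_sum)
        (auto intro!: integrable_real_indicator simp: P.emeasure_eq_measure sum_distrib_left)
    also have "\<dots> \<le> \<delta> / 2 * (LINT u|?P. q)"
    proof (intro mult_left_mono integral_mono)
      show "(\<Sum>k<K'. indicat_real {u. pert u k} u) \<le> q" for u
        unfolding count q_def by (rule perturbation_count_le)
      show "0 \<le> \<delta> / 2" using delta_pos by simp
    qed (use int in auto)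
    also have "\<dots> = q * (\<delta> / 2)" by (simp add: P.prob_space)
    finally have "q * (9 / 10 * P.prob {u. bad u}) \<le> q * (\<delta> / 2)" by simp
    then have "9 / 10 * P.prob {u. bad u} \<le> \<delta> / 2" using q by (simp only: mult_le_cancel_left_pos)
    moreover have "0 \<le> P.prob {u. bad u}" by simp
    ultimately show ?thesis by linarith
  qed
  moreover have "P.prob {u. bad u} = 1 - P.prob {u. \<exists>k\<le>K. elm (X u k)}"
    unfolding bad_eq by (rule P.prob_compl[OF good])
  ultimately show ?thesis by linarith
qed

end

theorem theorem3p7:
  fixes f :: "(real ^ 'd) \<times> (real ^ 'n) \<Rightarrow> real"
    and \<Phi> :: "real ^ 'd::finite \<Rightarrow> real"
    and x0 xstar :: "real ^ 'd" and y0 ystar :: "real ^ 'n"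
    and \<mu> l \<rho> \<kappa> L\<^sub>\<phi> \<rho>\<^sub>\<phi> \<epsilon> \<delta> \<iota> \<tau> \<eta> r T \<Delta> :: real
    and D :: nat
  assumes "0 < \<mu>" and "0 < l" and "0 < \<rho>" and "0 < \<epsilon>"
    and "\<Phi> = max_value f"
    (* (i) *)
    and "twice_differentiable f"
    and "\<And>x. strongly_concave \<mu> (\<lambda>y. f (x, y))"
    (* (ii) *)
    and "l-lipschitz_on UNIV (grad f)"
    (* (iii) *)
    and "\<rho>-lipschitz_on UNIV (hess_xx f)"
    and "\<rho>-lipschitz_on UNIV (hess_xy f)"
    and "\<rho>-lipschitz_on UNIV (hess_yy f)"
    (* (iv) *)
    and "bdd_below (range \<Phi>)"
    and "\<And>c. compact {x. \<Phi> x \<le> c}"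
    (* xstar minimizes \<Phi>, and ystar maximizes f (x0, _) *)
    and "\<And>x. \<Phi> xstar \<le> \<Phi> x"
    and "\<And>y. f (x0, y) \<le> f (x0, ystar)"
    (* parameters *)
    and "\<kappa> = l / \<mu>"
    and "L\<^sub>\<phi> = l * (1 + \<kappa>)"
    and "\<rho>\<^sub>\<phi> = \<rho> * (1 + \<kappa>) ^ 3"
    and "\<Delta> = \<Phi> x0 - \<Phi> xstar"
    and "0 < \<delta>" and "\<delta> < 1"
    and "L\<^sub>\<phi> / sqrt (\<rho>\<^sub>\<phi> * \<epsilon>) \<ge> 1"
    and "\<iota> > 1"
    and "\<delta> \<ge> L\<^sub>\<phi> * sqrt (real CARD('d::finite)) / sqrt (\<rho>\<^sub>\<phi> * \<epsilon>) * \<iota>\<^sup>2 * 2 powr (8 - \<iota>)"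
    and "\<tau> = 1 / l"
    and "\<eta> = 1 / L\<^sub>\<phi>"
    and "r = \<epsilon> / (400 * \<iota> ^ 3)"
    and "T = L\<^sub>\<phi> / sqrt (\<rho>\<^sub>\<phi> * \<epsilon>) * \<iota>"
    and "real D \<ge> inner_steps \<kappa> \<iota> (l * norm (y0 - ystar) + sqrt (L\<^sub>\<phi> * \<Delta>)) \<epsilon>"
  shows "\<exists>K. real K \<le> outer_steps L\<^sub>\<phi> \<iota> \<Delta> \<epsilon>
           \<and> real K \<le> 2 * 10 ^ 6 * \<iota> ^ 4 * (l * \<Delta>) * (\<kappa> / \<epsilon>\<^sup>2)
           \<and> \<P>(u in perturbations r. \<exists>k\<le>K.
                 eps_local_min \<Phi> \<rho>\<^sub>\<phi> \<epsilon> (gdmax_iterate f D \<tau> \<eta> \<epsilon> T x0 y0 u k)) \<ge> 1 - \<delta>"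
proof -
  interpret strongly_concave_problem f \<mu> l \<rho>
    using assms(1-3,6-11) by unfold_locales
  define p where "p = 2 powr (- \<iota>)"
  define g where "g = sqrt (\<rho>\<^sub>\<phi> * \<epsilon>)"
  define e where "e = \<epsilon> * p\<^sup>2"
  have kappa: "\<kappa> = strongly_concave_problem.\<kappa> \<mu> l" using assms(16) by (simp add: \<kappa>_def)
  have ystar: "ystar = ymax x0" using assms(15) by (rule maximizer_eq_ymax)
  have L: "L\<^sub>\<phi> = l * (1 + strongly_concave_problem.\<kappa> \<mu> l)" using assms(17) kappa by simp
  have R: "\<rho>\<^sub>\<phi> = \<rho> * (1 + strongly_concave_problem.\<kappa> \<mu> l) ^ 3" using assms(18) kappa by simp
  have g_pos: "0 < g" using assms(4) rho_pos kappa_ge_1 by (simp add: g_def R)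
  interpret perturbed_gdmax f \<mu> l \<rho> \<epsilon> \<iota> \<delta> x0 xstar y0 D "L\<^sub>\<phi>" "\<rho>\<^sub>\<phi>" g p \<Delta> r e
  proof
    show "g \<le> L\<^sub>\<phi>" using assms(22) g_pos by (simp add: g_def[symmetric])
    \<comment> \<open>\<open>2 powr (8 - \<iota>)\<close> equals \<open>256 * p\<close>.\<close>
    show "256 * \<iota>\<^sup>2 * (L\<^sub>\<phi> / g) * sqrt (real CARD('d)) * p \<le> \<delta>"
      using assms(24) by (simp add: p_def g_def powr_diff powr_minus field_simps)
    show "inner_steps (strongly_concave_problem.\<kappa> \<mu> l) \<iota> (l * norm (y0 - ymax x0) + sqrt (L\<^sub>\<phi> * \<Delta>)) \<epsilon> \<le> real D"
      using assms(29) kappa ystar by simp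
    show "max_value f xstar \<le> max_value f x" for x using assms(14) assms(5) by simp
    show "\<Delta> = max_value f x0 - max_value f xstar" using assms(19) assms(5) by simp
  qed (use assms(4,21,23,27) L R in \<open>simp_all add: g_def p_def e_def\<close>)
  have K_le: "real K \<le> outer_steps L\<^sub>\<phi> \<iota> \<Delta> \<epsilon>" using K(1) by (simp add: Z_def outer_steps_def)
  also have "\<dots> \<le> 10 ^ 6 * \<iota> ^ 4 * ((2 * l * \<kappa>) * \<Delta> / \<epsilon>\<^sup>2)"
  proof -
    \<comment> \<open>As \<kappa> is at least 1, the factor \<open>1 + \<kappa>\<close> in the
      Lipschitz constant is at most \<open>2 * \<kappa>\<close>.\<close>
    have "l * 1 \<le> l * \<kappa>" using l_pos kappa_ge_1 kappa by (intro mult_left_mono) auto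
    then have "L\<^sub>\<phi> \<le> 2 * l * \<kappa>" using assms(17) by (simp add: distrib_left mult_ac)
    then show ?thesis unfolding outer_steps_def
      using Delta_nonneg by (intro mult_left_mono divide_right_mono mult_right_mono) auto
  qed
  finally have "real K \<le> 2 * 10 ^ 6 * \<iota> ^ 4 * (l * \<Delta>) * (\<kappa> / \<epsilon>\<^sup>2)" by (simp add: mult_ac)
  moreover have "gdmax_iterate f D \<tau> \<eta> \<epsilon> T x0 y0 u k = X u k" for u k
    unfolding gdmax_iterate_def X_def st_def T_def assms(25,26,28) g_def[symmetric] by (rule refl)
  moreover have "eps_local_min \<Phi> \<rho>\<^sub>\<phi> \<epsilon> x = elm x" for x using assms(5) by (simp add: elm_def)
  ultimately show ?thesis
    using K_le local_min_probability by (intro exI[of _ K]) (simp add: space_perturbations)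
qed

end
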